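(* Let $q\in\mathbb{N}^+$ and let $G=(V,E)$ be a (possibly infinite) $(q+1)$-regular graph with adjacency operator $A$ acting on $\ell^2(V)$, and for $r\in\mathbb{N}$ let $A_r$ be its non-backtracking matrix of length $r$. Let $\rho>q^{1/2}$ and let $h$ be holomorphic on $\Omega(\rho)$. Then $$h(q^{-1/2}A)=\left(\int_{\mathbb{R}} h(x)\,d\mu_q(x)\right)\mathrm{I}+\sum_{r=1}^{\infty}q^{-r/2}a_{r,q}(h)\, A_r,$$ where for $r\geq 1$ $$a_{r,q}(h)=(1+q^{-1})\int_{-2}^{2}h(x)X_{r,q}(x)\,d\mu_q(x),$$ and the series on the right converges in operator norm.
   Context: Graphs: $G=(V,E)$ is undirected and may have multiple edges and loops. Each edge gives two directed edges, each the inverse $\bar e$ of the other; $o(e),t(e)$ denote origin and terminus. $(q+1)$-regular means every vertex is the origin of exactly $q+1$ directed edges; $A_{ab}$ is the number of directed edges from $a$ to $b$. A walk of length $n$ from $a$ to $b$ is a sequence of directed edges $e_0,\dots,e_{n-1}$ with $o(e_0)=a$, $t(e_{i})=o(e_{i+1})$, $t(e_{n-1})=b$ (length $0$ walks are trivial). It is non-backtracking if $e_{i+1}\neq\bar e_i$ for all $0\le i\le n-2$. $(A_r)_{ab}$ is the number of non-backtracking walks of length $r$ from $a$ to $b$ (so $A_0=\mathrm I$). Chebyshev-type polynomials: for $q\in\mathbb{N}^+\cup\{\infty\}$ (with $1/\infty=0$) the polynomials $X_{r,q}$, $r\in\mathbb{N}$, are defined by $\frac{1-q^{-1}t^2}{1-xt+t^2}=\sum_{r\ge0}X_{r,q}(x)t^r$.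 Kesten–McKay distribution: $d\mu_1(x)=\frac{1}{\pi\sqrt{4-x^2}}\mathbf{1}_{|x|\le2}dx$ and, for $q>1$, $d\mu_q(x)=\frac{1}{2\pi}\frac{(q+1)\sqrt{4-x^2}}{(q^{1/2}+q^{-1/2})^2-x^2}\mathbf{1}_{|x|\le 2}dx$. For $\rho>0,\rho\ne1$: $\Omega(\rho)=\{w\in\mathbb{C}: \frac{(\mathrm{Re}\,w)^2}{(\rho+\rho^{-1})^2}+\frac{(\mathrm{Im}\,w)^2}{(\rho-\rho^{-1})^2}<1\}$. $h(q^{-1/2}A)$ is defined by holomorphic functional calculus of the bounded self-adjoint operator $q^{-1/2}A$.
   Formalization: The factor (1+q^{-1}) in a_{r,q}(h) is replaced by its inverse (1+q^{-1})^{-1}; as printed the identity fails for h(z)=z, where the right side equals (1+q^{-1})^2 q^{-1/2}A instead of q^{-1/2}A. *)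

theory Defs
  imports
    "HOL-Complex_Analysis.Complex_Analysis"
    "Graph_Theory.Graph_Theory"
begin

section \<open>The Hilbert space of square-summable functions\<close>

text \<open>The index set is a whole type, so that the space of square-summable functions on it is a
  type as well and its bounded operators are the library's type of bounded linear functions,
  normed by the operator norm.\<close>

typedef 'v ell2 = "{f :: 'v \<Rightarrow> complex. (\<lambda>x. (cmod (f x))\<^sup>2) summable_on UNIV}"
  morphisms ell2_apply Abs_ell2
  by (rule exI[of _ "\<lambda>_. 0"]) simp

setup_lifting type_definition_ell2

lemma cmod_add_sq_le: "(cmod (a + b))\<^sup>2 \<le> 2 * (cmod a)\<^sup>2 + 2 * (cmod b)\<^sup>2"
proof -
  have "(cmod (a + b))\<^sup>2 \<le> (cmod a + cmod b)\<^sup>2"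
    by (simp add: norm_triangle_ineq power_mono)
  also have "\<dots> \<le> 2 * (cmod a)\<^sup>2 + 2 * (cmod b)\<^sup>2"
    using sum_squares_bound[of "cmod a" "cmod b"] by (simp add: power2_sum)
  finally show ?thesis .
qed

lemma square_summable_add:
  fixes f g :: "'v \<Rightarrow> complex"
  assumes "(\<lambda>x. (cmod (f x))\<^sup>2) summable_on UNIV" "(\<lambda>x. (cmod (g x))\<^sup>2) summable_on UNIV"
  shows "(\<lambda>x. (cmod (f x + g x))\<^sup>2) summable_on UNIV"
proof (rule summable_on_comparison_test)
  show "(\<lambda>x. 2 * (cmod (f x))\<^sup>2 + 2 * (cmod (g x))\<^sup>2) summable_on UNIV"
    using assms by (intro summable_on_add summable_on_cmult_right)
qed (auto simp: cmod_add_sq_le)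

lemma square_summable_scale:
  fixes f :: "'v \<Rightarrow> complex"
  assumes "(\<lambda>x. (cmod (f x))\<^sup>2) summable_on UNIV"
  shows "(\<lambda>x. (cmod (c * f x))\<^sup>2) summable_on UNIV"
  using summable_on_cmult_right[OF assms, of "(cmod c)\<^sup>2"]
  by (simp add: norm_mult power_mult_distrib)

lemma square_summable_inner:
  fixes f g :: "'v \<Rightarrow> complex"
  assumes "(\<lambda>x. (cmod (f x))\<^sup>2) summable_on UNIV" "(\<lambda>x. (cmod (g x))\<^sup>2) summable_on UNIV"
  shows "(\<lambda>x. inner (f x) (g x)) summable_on UNIV"
proof -
  have "(\<lambda>x. (cmod (f x + g x))\<^sup>2 + - (cmod (f x))\<^sup>2 + - (cmod (g x))\<^sup>2) summable_on UNIV"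
    using assms square_summable_add[OF assms]
    by (intro summable_on_add) (simp_all add: summable_on_uminus)
  then have "(\<lambda>x. (1/2) * ((cmod (f x + g x))\<^sup>2 + - (cmod (f x))\<^sup>2 + - (cmod (g x))\<^sup>2)) summable_on UNIV"
    by (rule summable_on_cmult_right)
  moreover have "(1/2) * ((cmod (a + b))\<^sup>2 + - (cmod a)\<^sup>2 + - (cmod b)\<^sup>2) = inner a b" for a b
    by (simp add: power2_norm_eq_inner inner_add_left inner_add_right inner_commute)
  ultimately show ?thesis by simp
qed

lemma ell2_summable: "(\<lambda>x. (cmod (ell2_apply f x))\<^sup>2) summable_on UNIV"
  using ell2_apply[of f] by simp

instantiation ell2 :: (type) real_inner
begin

lift_definition zero_ell2 :: "'a ell2" is "\<lambda>_. 0" by simp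

lift_definition plus_ell2 :: "'a ell2 \<Rightarrow> 'a ell2 \<Rightarrow> 'a ell2" is "\<lambda>f g x. f x + g x"
  by (rule square_summable_add)

lift_definition uminus_ell2 :: "'a ell2 \<Rightarrow> 'a ell2" is "\<lambda>f x. - f x" by simp

lift_definition minus_ell2 :: "'a ell2 \<Rightarrow> 'a ell2 \<Rightarrow> 'a ell2" is "\<lambda>f g x. f x - g x"
  using square_summable_add[of _ "\<lambda>x. - g x" for g] by auto

lift_definition scaleR_ell2 :: "real \<Rightarrow> 'a ell2 \<Rightarrow> 'a ell2" is "\<lambda>c f x. of_real c * f x"
  by (rule square_summable_scale)

definition norm_ell2 :: "'a ell2 \<Rightarrow> real" where
  "norm_ell2 f = sqrt (\<Sum>\<^sub>\<infinity>x. (cmod (ell2_apply f x))\<^sup>2)"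

text \<open>The real part of the usual Hermitian inner product.\<close>

definition inner_ell2 :: "'a ell2 \<Rightarrow> 'a ell2 \<Rightarrow> real" where
  "inner_ell2 f g = (\<Sum>\<^sub>\<infinity>x. inner (ell2_apply f x) (ell2_apply g x))"

definition "dist_ell2 (f :: 'a ell2) g = norm (f - g)"
definition "sgn_ell2 (f :: 'a ell2) = inverse (norm f) *\<^sub>R f"
definition [code del]:
  "(uniformity :: ('a ell2 \<times> 'a ell2) filter) = (INF e\<in>{0<..}. principal {(x, y). dist x y < e})"
definition [code del]:
  "open (U :: 'a ell2 set) \<longleftrightarrow> (\<forall>x\<in>U. eventually (\<lambda>(x', y). x' = x \<longrightarrow> y \<in> U) uniformity)"

instance
proof
  fix f g h :: "'a ell2" and a b :: real
  show "f + g + h = f + (g + h)" "f + g = g + f" "0 + f = f" "- f + f = 0" "f - g = f + - g"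
    by (transfer; simp add: algebra_simps)+
  show "a *\<^sub>R (f + g) = a *\<^sub>R f + a *\<^sub>R g" "(a + b) *\<^sub>R f = a *\<^sub>R f + b *\<^sub>R f"
    "a *\<^sub>R b *\<^sub>R f = (a * b) *\<^sub>R f" "1 *\<^sub>R f = f"
    by (transfer; simp add: algebra_simps)+
  show "dist f g = norm (f - g)" by (rule dist_ell2_def)
  show "sgn f = inverse (norm f) *\<^sub>R f" by (rule sgn_ell2_def)
  show "inner f g = inner g f" by (simp add: inner_ell2_def inner_commute)
  show "inner (f + g) h = inner f h + inner g h"
    unfolding inner_ell2_def plus_ell2.rep_eq inner_add_left
    by (intro infsum_add square_summable_inner ell2_summable)
  have "inner (of_real a * u) v = a * inner u v" for u v :: complex
    by (simp add: scaleR_conv_of_real[symmetric])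
  then show "inner (a *\<^sub>R f) g = a * inner f g"
    unfolding inner_ell2_def scaleR_ell2.rep_eq
    by (simp add: infsum_cmult_right square_summable_inner ell2_summable)
  show "0 \<le> inner f f"
    unfolding inner_ell2_def by (intro infsum_nonneg) simp
  show "inner f f = 0 \<longleftrightarrow> f = 0"
  proof
    assume "inner f f = 0"
    then have "inner (ell2_apply f x) (ell2_apply f x) = 0" for x
      using nonneg_infsum_le_0D[of "\<lambda>x. inner (ell2_apply f x) (ell2_apply f x)" UNIV x]
        square_summable_inner[OF ell2_summable[of f] ell2_summable[of f]]
      by (simp add: inner_ell2_def)
    then show "f = 0"
      by (intro ell2_apply_inject[THEN iffD1] ext) (simp add: zero_ell2.rep_eq)
  next
    assume "f = 0"
    then show "inner f f = 0" by (simp add: inner_ell2_def zero_ell2.rep_eq)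
  qed
  show "norm f = sqrt (inner f f)"
    by (simp add: norm_ell2_def inner_ell2_def power2_norm_eq_inner)
qed (simp_all add: uniformity_ell2_def open_ell2_def)

end

lemma finite_sum_le_norm_ell2:
  assumes "finite F"
  shows "(\<Sum>x\<in>F. (cmod (ell2_apply f x))\<^sup>2) \<le> (norm f)\<^sup>2"
proof -
  have "(\<Sum>x\<in>F. (cmod (ell2_apply f x))\<^sup>2) \<le> (\<Sum>\<^sub>\<infinity>x. (cmod (ell2_apply f x))\<^sup>2)"
    using assms by (intro finite_sum_le_infsum ell2_summable) auto
  moreover have "0 \<le> (\<Sum>\<^sub>\<infinity>x. (cmod (ell2_apply f x))\<^sup>2)"
    by (rule infsum_nonneg) simp
  ultimately show ?thesis
    unfolding norm_ell2_def by (simp only: real_sqrt_pow2)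
qed

lemma cmod_ell2_apply_le: "cmod (ell2_apply f x) \<le> norm f"
  by (rule power2_le_imp_le) (use finite_sum_le_norm_ell2[of "{x}" f] in simp_all)

lemma ell2_of_finite_sums:
  fixes f :: "'v \<Rightarrow> complex"
  assumes "\<And>F. finite F \<Longrightarrow> (\<Sum>x\<in>F. (cmod (f x))\<^sup>2) \<le> e\<^sup>2" "e \<ge> 0"
  shows "(\<lambda>x. (cmod (f x))\<^sup>2) summable_on UNIV" "norm (Abs_ell2 f) \<le> e"
proof -
  show sm: "(\<lambda>x. (cmod (f x))\<^sup>2) summable_on UNIV"
    using assms(1) by (intro nonneg_bdd_above_summable_on) (auto simp: bdd_above_def)
  have "(\<Sum>\<^sub>\<infinity>x. (cmod (f x))\<^sup>2) \<le> e\<^sup>2"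
    using assms(1) by (intro infsum_le_finite_sums sm) auto
  then have "sqrt (\<Sum>\<^sub>\<infinity>x. (cmod (f x))\<^sup>2) \<le> e"
    using assms(2) by (intro real_le_lsqrt) auto
  then show "norm (Abs_ell2 f) \<le> e"
    unfolding norm_ell2_def using sm by (subst Abs_ell2_inverse) simp_all
qed

instance ell2 :: (type) banach
proof
  fix X :: "nat \<Rightarrow> 'a ell2"
  assume X: "Cauchy X"
  have "Cauchy (\<lambda>n. ell2_apply (X n) x)" for x
  proof (rule CauchyI)
    fix e :: real assume "e > 0"
    then obtain N where N: "\<forall>m\<ge>N. \<forall>n\<ge>N. norm (X m - X n) < e"
      using CauchyD[OF X] by blast
    have "norm (ell2_apply (X m) x - ell2_apply (X n) x) \<le> norm (X m - X n)" for m n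
      using cmod_ell2_apply_le[of "X m - X n" x] by (simp add: minus_ell2.rep_eq)
    then show "\<exists>M. \<forall>m\<ge>M. \<forall>n\<ge>M. norm (ell2_apply (X m) x - ell2_apply (X n) x) < e"
      using N by (meson le_less_trans)
  qed
  then have "\<exists>l. (\<lambda>n. ell2_apply (X n) x) \<longlonglongrightarrow> l" for x
    by (simp add: Cauchy_convergent_iff convergent_def)
  then obtain g where g: "\<And>x. (\<lambda>n. ell2_apply (X n) x) \<longlonglongrightarrow> g x"
    by metis
  have fin: "(\<Sum>x\<in>F. (cmod (ell2_apply (X n) x - g x))\<^sup>2) \<le> e\<^sup>2"
    if N: "\<forall>m\<ge>N. \<forall>n\<ge>N. norm (X m - X n) < e" and n: "n \<ge> N" and F: "finite F" for N n e F
  proof (rule tendsto_upperbound)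
    show "(\<lambda>m. \<Sum>x\<in>F. (cmod (ell2_apply (X n) x - ell2_apply (X m) x))\<^sup>2)
        \<longlonglongrightarrow> (\<Sum>x\<in>F. (cmod (ell2_apply (X n) x - g x))\<^sup>2)"
      by (intro tendsto_intros g)
    have "(\<Sum>x\<in>F. (cmod (ell2_apply (X n) x - ell2_apply (X m) x))\<^sup>2) \<le> e\<^sup>2" if "m \<ge> N" for m
    proof -
      have "(\<Sum>x\<in>F. (cmod (ell2_apply (X n) x - ell2_apply (X m) x))\<^sup>2) \<le> (norm (X n - X m))\<^sup>2"
        using finite_sum_le_norm_ell2[OF F, of "X n - X m"] by (simp add: minus_ell2.rep_eq)
      also have "\<dots> \<le> e\<^sup>2"
        using N n that by (intro power_mono) (auto intro: less_imp_le)
      finally show ?thesis .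
    qed
    then show "\<forall>\<^sub>F m in sequentially.
        (\<Sum>x\<in>F. (cmod (ell2_apply (X n) x - ell2_apply (X m) x))\<^sup>2) \<le> e\<^sup>2"
      by (auto simp: eventually_sequentially)
  qed simp
  obtain N1 where N1: "\<forall>m\<ge>N1. \<forall>n\<ge>N1. norm (X m - X n) < 1"
    using CauchyD[OF X, of 1] by auto
  have "(\<lambda>x. (cmod (ell2_apply (X N1) x - g x))\<^sup>2) summable_on UNIV"
    by (rule ell2_of_finite_sums(1)[where e = 1]) (use fin[OF N1] in auto)
  then have "(\<lambda>x. (cmod (- (ell2_apply (X N1) x - g x) + ell2_apply (X N1) x))\<^sup>2) summable_on UNIV"
    by (intro square_summable_add ell2_summable) (simp add: norm_minus_commute)
  then have gsm: "(\<lambda>x. (cmod (g x))\<^sup>2) summable_on UNIV"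
    by simp
  have diff: "X n - Abs_ell2 g = Abs_ell2 (\<lambda>x. ell2_apply (X n) x - g x)" for n
    by (simp add: minus_ell2_def Abs_ell2_inverse gsm)
  have "X \<longlonglongrightarrow> Abs_ell2 g"
  proof (rule LIMSEQ_I)
    fix r :: real assume r: "r > 0"
    then obtain N where N: "\<forall>m\<ge>N. \<forall>n\<ge>N. norm (X m - X n) < r / 2"
      using CauchyD[OF X, of "r/2"] by auto
    have "norm (X n - Abs_ell2 g) \<le> r / 2" if "n \<ge> N" for n
      unfolding diff by (rule ell2_of_finite_sums(2)) (use fin[OF N that] r in auto)
    then show "\<exists>no. \<forall>n\<ge>no. norm (X n - Abs_ell2 g) < r"
      using r by (intro exI[of _ N]) fastforce
  qed
  then show "convergent X" by (auto simp: convergent_def)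
qed

lift_definition scaleC_ell2 :: "complex \<Rightarrow> 'v ell2 \<Rightarrow> 'v ell2" is "\<lambda>c f x. c * f x"
  by (rule square_summable_scale)

lemma norm_scaleC_ell2: "norm (scaleC_ell2 c f) = cmod c * norm f"
  by (simp add: norm_ell2_def scaleC_ell2.rep_eq norm_mult power_mult_distrib
      infsum_cmult_right ell2_summable real_sqrt_mult)

lemma bounded_linear_scaleC_ell2: "bounded_linear (scaleC_ell2 c)"
proof (rule bounded_linear_intro[where K = "cmod c"])
  fix f g :: "'a ell2" and r :: real
  show "scaleC_ell2 c (f + g) = scaleC_ell2 c f + scaleC_ell2 c g"
    by transfer (simp add: algebra_simps)
  show "scaleC_ell2 c (r *\<^sub>R f) = r *\<^sub>R scaleC_ell2 c f"
    by transfer (simp add: algebra_simps)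
  show "norm (scaleC_ell2 c f) \<le> norm f * cmod c"
    by (simp add: norm_scaleC_ell2)
qed

section \<open>Operators and holomorphic functional calculus\<close>

type_synonym 'v op = "'v ell2 \<Rightarrow>\<^sub>L 'v ell2"

definition scaleC_op :: "complex \<Rightarrow> 'v op \<Rightarrow> 'v op" (infixr \<open>*\<^sub>C\<close> 75) where
  "c *\<^sub>C T = Blinfun (\<lambda>f. scaleC_ell2 c (blinfun_apply T f))"

lemma scaleC_op_apply [simp]: "blinfun_apply (c *\<^sub>C T) f = scaleC_ell2 c (blinfun_apply T f)"
  unfolding scaleC_op_def
  by (simp add: bounded_linear_Blinfun_apply blinfun.bounded_linear_right
      bounded_linear_compose[OF bounded_linear_scaleC_ell2])

text \<open>The operator with a given matrix; meaningful if the matrix defines a bounded operator.\<close>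

definition matrix_op :: "('v \<Rightarrow> 'v \<Rightarrow> complex) \<Rightarrow> 'v op" where
  "matrix_op M = Blinfun (\<lambda>f. Abs_ell2 (\<lambda>a. \<Sum>\<^sub>\<infinity>b. M a b * ell2_apply f b))"

definition is_resolvent :: "'v op \<Rightarrow> complex \<Rightarrow> 'v op \<Rightarrow> bool" where
  "is_resolvent T z R \<longleftrightarrow>
     (z *\<^sub>C id_blinfun - T) o\<^sub>L R = id_blinfun \<and> R o\<^sub>L (z *\<^sub>C id_blinfun - T) = id_blinfun"

definition op_spectrum :: "'v op \<Rightarrow> complex set" where
  "op_spectrum T = {z. \<nexists>R. is_resolvent T z R}"

definition resolvent :: "'v op \<Rightarrow> complex \<Rightarrow> 'v op" where
  "resolvent T z = (THE R. is_resolvent T z R)"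

text \<open>Closed curves in \<open>S\<close> around the spectrum of \<open>T\<close>. A single curve, rather than a cycle of
  several ones, is enough for a self-adjoint \<open>T\<close> and a connected open \<open>S\<close>, because the spectrum
  is then real and does not separate \<open>S\<close>.\<close>

definition encloses_spectrum :: "complex set \<Rightarrow> 'v op \<Rightarrow> (real \<Rightarrow> complex) \<Rightarrow> bool" where
  "encloses_spectrum S T \<gamma> \<longleftrightarrow>
     valid_path \<gamma> \<and> pathfinish \<gamma> = pathstart \<gamma> \<and>
     path_image \<gamma> \<subseteq> S - op_spectrum T \<and>
     (\<forall>z\<in>op_spectrum T. winding_number \<gamma> z = 1) \<and>
     (\<forall>z. z \<notin> S \<longrightarrow> winding_number \<gamma> z = 0)"

definition op_contour_integral :: "(real \<Rightarrow> complex) \<Rightarrow> (complex \<Rightarrow> 'v op) \<Rightarrow> 'v op" where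
  "op_contour_integral \<gamma> F =
     integral {0..1} (\<lambda>t. vector_derivative \<gamma> (at t within {0..1}) *\<^sub>C F (\<gamma> t))"

text \<open>The Riesz--Dunford integral for \<open>h\<close> holomorphic on an open set \<open>S\<close> containing the spectrum
  of \<open>T\<close>. By Cauchy's theorem it does not depend on the curve.\<close>

definition holomorphic_calculus :: "complex set \<Rightarrow> (complex \<Rightarrow> complex) \<Rightarrow> 'v op \<Rightarrow> 'v op" where
  "holomorphic_calculus S h T =
     (THE B. \<exists>\<gamma>. encloses_spectrum S T \<gamma> \<and>
        B = (1 / (2 * of_real pi * \<i>)) *\<^sub>C op_contour_integral \<gamma> (\<lambda>z. h z *\<^sub>C resolvent T z))"

section \<open>Graphs and non-backtracking walks\<close>

text \<open>An undirected graph with multiple edges and loops is given by its directed edges (arcs)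
  together with the involution \<open>bar\<close> taking each to its inverse, as in the locale
  \<open>bidirected_digraph\<close>, where no arc (not even a loop) is its own inverse.\<close>

definition regular_graph :: "nat \<Rightarrow> ('v, 'e) pre_digraph \<Rightarrow> ('e \<Rightarrow> 'e) \<Rightarrow> bool" where
  "regular_graph d G bar \<longleftrightarrow>
     bidirected_digraph G bar \<and> (\<forall>v\<in>verts G. finite (out_arcs G v) \<and> out_degree G v = d)"

definition adjacency_matrix :: "('v, 'e) pre_digraph \<Rightarrow> 'v \<Rightarrow> 'v \<Rightarrow> nat" where
  "adjacency_matrix G a b = card {e \<in> arcs G. tail G e = a \<and> head G e = b}"

definition non_backtracking :: "('e \<Rightarrow> 'e) \<Rightarrow> 'e list \<Rightarrow> bool" where
  "non_backtracking bar p \<longleftrightarrow> (\<forall>i. Suc i < length p \<longrightarrow> p ! Suc i \<noteq> bar (p ! i))"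

definition nb_matrix :: "('v, 'e) pre_digraph \<Rightarrow> ('e \<Rightarrow> 'e) \<Rightarrow> nat \<Rightarrow> 'v \<Rightarrow> 'v \<Rightarrow> nat" where
  "nb_matrix G bar r a b =
     card {p. pre_digraph.awalk G a p b \<and> length p = r \<and> non_backtracking bar p}"

definition adjacency_op :: "('v, 'e) pre_digraph \<Rightarrow> 'v op" where
  "adjacency_op G = matrix_op (\<lambda>a b. of_nat (adjacency_matrix G a b))"

definition nb_op :: "('v, 'e) pre_digraph \<Rightarrow> ('e \<Rightarrow> 'e) \<Rightarrow> nat \<Rightarrow> 'v op" where
  "nb_op G bar r = matrix_op (\<lambda>a b. of_nat (nb_matrix G bar r a b))"

section \<open>Polynomials, measure and coefficients\<close>

text \<open>The value at \<open>x\<close> of the \<open>r\<close>-th polynomial, read off from the generating function in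
  \<open>t = fps_X\<close>.\<close>

definition X_poly :: "nat \<Rightarrow> nat \<Rightarrow> 'a::field_char_0 \<Rightarrow> 'a" where
  "X_poly r q x =
     fps_nth ((1 - fps_const (1 / of_nat q) * fps_X\<^sup>2) / (1 - fps_const x * fps_X + fps_X\<^sup>2)) r"

definition kesten_mckay_density :: "nat \<Rightarrow> real \<Rightarrow> real" where
  "kesten_mckay_density q x =
     (if \<bar>x\<bar> \<le> 2 then
        (if q = 1 then 1 / (pi * sqrt (4 - x\<^sup>2))
         else 1 / (2 * pi) * ((real q + 1) * sqrt (4 - x\<^sup>2)
                / ((real q powr (1/2) + real q powr (-1/2))\<^sup>2 - x\<^sup>2)))
      else 0)"

definition kesten_mckay :: "nat \<Rightarrow> real measure" where
  "kesten_mckay q = density lborel (\<lambda>x. ennreal (kesten_mckay_density q x))"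

definition ellipse_region :: "real \<Rightarrow> complex set" where
  "ellipse_region \<rho> =
     {w. (Re w)\<^sup>2 / (\<rho> + 1 / \<rho>)\<^sup>2 + (Im w)\<^sup>2 / (\<rho> - 1 / \<rho>)\<^sup>2 < 1}"

text \<open>The measure lives on the interval from -2 to 2. The integrals are taken over that set because
  \<open>h\<close> is unconstrained (possibly not even measurable) outside its domain of holomorphy.\<close>

definition km_mean :: "nat \<Rightarrow> (complex \<Rightarrow> complex) \<Rightarrow> complex" where
  "km_mean q h = (LINT x:{-2..2}|kesten_mckay q. h (of_real x))"

text \<open>The square of \<open>X_poly r q\<close> has integral \<open>1 + 1 / q\<close> for \<open>r \<ge> 1\<close>, so this is the coefficient
  in the orthogonal expansion: the normalizing factor is the inverse of \<open>1 + 1 / q\<close>. With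
  \<open>1 + 1 / q\<close> itself, already \<open>h z = z\<close> would violate the expansion.\<close>

definition km_coeff :: "nat \<Rightarrow> nat \<Rightarrow> (complex \<Rightarrow> complex) \<Rightarrow> complex" where
  "km_coeff r q h =
     of_real (inverse (1 + 1 / real q)) *
     (LINT x:{-2..2}|kesten_mckay q. h (of_real x) * of_real (X_poly r q x))"

end

theory Submission
  imports Defs
begin

text \<open>Put \<open>T = q\<^sup>-\<^sup>1\<^sup>/\<^sup>2 A\<close>. The recursion \<open>A A\<^sub>r = A\<^sub>r\<^sub>+\<^sub>1 + q A\<^sub>r\<^sub>-\<^sub>1\<close> (\<open>r \<ge> 2\<close>) and the bound
  \<open>(q + 1) q\<^sup>r\<^sup>-\<^sup>1\<close> for the norm of \<open>A\<^sub>r\<close> show that at \<open>z = w + 1 / w\<close> with \<open>|w| > q\<^sup>1\<^sup>/\<^sup>2\<close> the resolvent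
  of \<open>T\<close> is \<open>w\<^sup>-\<^sup>1 / (1 - w\<^sup>-\<^sup>2 / q)\<close> times the sum of \<open>w\<^sup>-\<^sup>r q\<^sup>-\<^sup>r\<^sup>/\<^sup>2 A\<^sub>r\<close>. Hence the spectrum lies in
  the closed ellipse of parameter \<open>q\<^sup>1\<^sup>/\<^sup>2\<close>, and integrating \<open>h\<close> times the resolvent over the image of
  a circle \<open>|w| = r\<close> gives a series in the \<open>A\<^sub>r\<close> whose coefficients are contour integrals in \<open>w\<close>.
  Moving these to the unit circle, where \<open>w + 1 / w = 2 cos t\<close>, turns them into the
  Kesten--McKay integrals.\<close>

section \<open>Complex-linear operators and functionals\<close>

text \<open>\<open>holomorphic_calculus\<close> is a definite description over all enclosing curves,
  so the value is needed for an arbitrary one and not only for an ellipse. The spectrum is confined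
  to a closed ellipse, but its shape stays open; the domain around it might be disconnected, so two
  enclosing loops cannot simply be joined and compared by Cauchy's theorem. Instead the given curve
  is compared with an ellipse around it, by the resolvent identity and the integral of the resolvent
  alone, which follows from Cauchy's theorem outside the spectrum. Operators are tested by
  functionals so that scalar complex analysis applies.

  The resolvent formula is the generating function of the polynomials X_{r,q} at x = T and t = 1 /
  w, because 1 - t x + t^2 = t (z - x). The derivative 1 - w^(-2) of w + 1 / w times the prefactor
  in the resolvent is \<open>km_weight\<close> over w; on the unit circle its values at w and 1 / w
  add up to 2 pi times the Kesten-McKay density in the angle.\<close>

lemma ell2_eqI: "(\<And>x. ell2_apply f x = ell2_apply g x) \<Longrightarrow> f = g"
  by (simp add: ell2_apply_inject[symmetric] fun_eq_iff)

lemma scaleC_ell2_add_left: "scaleC_ell2 (c + d) f = scaleC_ell2 c f + scaleC_ell2 d f"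
  and scaleC_ell2_scaleC: "scaleC_ell2 c (scaleC_ell2 d f) = scaleC_ell2 (c * d) f"
  and scaleC_ell2_one [simp]: "scaleC_ell2 1 f = f"
  and scaleC_ell2_of_real: "scaleC_ell2 (of_real r) f = r *\<^sub>R f"
  by (rule ell2_eqI, simp add: scaleC_ell2.rep_eq plus_ell2.rep_eq scaleR_ell2.rep_eq algebra_simps)+

lemma scaleC_ell2_add_right: "scaleC_ell2 c (f + g) = scaleC_ell2 c f + scaleC_ell2 c g"
  and scaleC_ell2_diff_right: "scaleC_ell2 c (f - g) = scaleC_ell2 c f - scaleC_ell2 c g"
  and scaleC_ell2_scaleR: "scaleC_ell2 c (r *\<^sub>R f) = r *\<^sub>R scaleC_ell2 c f"
  by (rule ell2_eqI, simp add: scaleC_ell2.rep_eq plus_ell2.rep_eq minus_ell2.rep_eq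
      uminus_ell2.rep_eq scaleR_ell2.rep_eq algebra_simps)+

lemma scaleC_op_add_left: "(c + d) *\<^sub>C T = c *\<^sub>C T + d *\<^sub>C T"
  and scaleC_op_add_right: "c *\<^sub>C (S + T) = c *\<^sub>C S + c *\<^sub>C T"
  and scaleC_op_diff_right: "c *\<^sub>C (S - T) = c *\<^sub>C S - c *\<^sub>C T"
  and scaleC_op_scaleC: "c *\<^sub>C d *\<^sub>C T = (c * d) *\<^sub>C T"
  and scaleC_op_one [simp]: "1 *\<^sub>C T = T"
  and scaleC_op_of_real: "of_real r *\<^sub>C T = r *\<^sub>R T"
  and scaleC_op_scaleR: "c *\<^sub>C r *\<^sub>R T = r *\<^sub>R c *\<^sub>C T"
  by (rule blinfun_eqI, simp add: blinfun.add_left blinfun.diff_left blinfun.scaleR_left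
      scaleC_ell2_add_left scaleC_ell2_scaleC scaleC_ell2_of_real scaleC_ell2_add_right
      scaleC_ell2_diff_right scaleC_ell2_scaleR)+

lemma scaleC_op_diff_left: "(c - d) *\<^sub>C T = c *\<^sub>C T - d *\<^sub>C T"
  using scaleC_op_add_left[of "c - d" d T] by simp

lemma scaleC_op_compose_left: "(c *\<^sub>C S) o\<^sub>L T = c *\<^sub>C (S o\<^sub>L T)"
  by (rule blinfun_eqI) simp

lemma norm_scaleC_op: "norm (c *\<^sub>C T) = cmod c * norm T"
proof -
  have le: "norm (c *\<^sub>C T) \<le> cmod c * norm T" for c and T :: "'v op"
    by (rule norm_blinfun_bound)
      (auto simp: norm_scaleC_ell2 mult.assoc intro!: mult_left_mono norm_blinfun)
  show ?thesis
  proof (cases "c = 0")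
    case True
    then show ?thesis using le[of c T] by simp
  next
    case False
    then have "norm T = norm (inverse c *\<^sub>C c *\<^sub>C T)"
      by (simp add: scaleC_op_scaleC)
    also have "\<dots> \<le> inverse (cmod c) * norm (c *\<^sub>C T)"
      using le[of "inverse c" "c *\<^sub>C T"] by (simp add: norm_inverse)
    finally show ?thesis
      using le[of c T] False by (simp add: field_simps)
  qed
qed

lemma bounded_bilinear_scaleC_op: "bounded_bilinear (scaleC_op :: complex \<Rightarrow> 'v op \<Rightarrow> 'v op)"
proof
  show "\<exists>K. \<forall>c (T :: 'v op). norm (c *\<^sub>C T) \<le> norm c * norm T * K"
    by (rule exI[of _ 1]) (simp add: norm_scaleC_op)
  fix r c and T :: "'v op"
  show "(r *\<^sub>R c) *\<^sub>C T = r *\<^sub>R c *\<^sub>C T"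
    unfolding scaleR_conv_of_real scaleC_op_scaleC[symmetric] scaleC_op_of_real ..
qed (simp_all add: scaleC_op_add_left scaleC_op_add_right scaleC_op_scaleR)

interpretation scaleC_op: bounded_bilinear "scaleC_op :: complex \<Rightarrow> 'v op \<Rightarrow> 'v op"
  by (rule bounded_bilinear_scaleC_op)

text \<open>The type \<open>'v op\<close> contains all bounded real-linear maps, also
  conjugate-linear ones, through which a complex scalar cannot be pulled.\<close>

definition complex_linear :: "'v op \<Rightarrow> bool" where
  "complex_linear S \<longleftrightarrow> (\<forall>c f. S (scaleC_ell2 c f) = scaleC_ell2 c (S f))"

lemma complex_linear_scaleR: "complex_linear S \<Longrightarrow> complex_linear (r *\<^sub>R S)"
  by (simp add: complex_linear_def blinfun.scaleR_left scaleC_ell2_scaleR)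

lemma compose_scaleC_op: "complex_linear S \<Longrightarrow> S o\<^sub>L c *\<^sub>C T = c *\<^sub>C (S o\<^sub>L T)"
  by (rule blinfun_eqI) (simp add: complex_linear_def)

text \<open>Composed with an operator-valued function, such a functional gives a complex function.
  Complex homogeneity lets it pass through the factors h(z) and the tangent of a contour.\<close>

definition complex_functional :: "('v op \<Rightarrow> complex) \<Rightarrow> bool" where
  "complex_functional \<psi> \<longleftrightarrow> bounded_linear \<psi> \<and> (\<forall>c T. \<psi> (c *\<^sub>C T) = c * \<psi> T)"

lemma complex_functional_scaleC: "complex_functional \<psi> \<Longrightarrow> \<psi> (c *\<^sub>C T) = c * \<psi> T"
  and complex_functional_bounded_linear: "complex_functional \<psi> \<Longrightarrow> bounded_linear \<psi>"
  by (simp_all add: complex_functional_def)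

lemma bounded_linear_ell2_apply: "bounded_linear (\<lambda>f. ell2_apply f x)"
  by (rule bounded_linear_intro[where K = 1])
    (simp_all add: plus_ell2.rep_eq scaleR_ell2.rep_eq cmod_ell2_apply_le scaleR_conv_of_real)

lemma complex_functional_entry: "complex_functional (\<lambda>T :: 'v op. ell2_apply (T f) x)"
  unfolding complex_functional_def
  by (auto simp: scaleC_ell2.rep_eq
      intro: bounded_linear_compose[OF bounded_linear_ell2_apply blinfun.bounded_linear_left])

text \<open>The coordinates of \<open>T f\<close> already separate operators; this takes the place
  of Hahn-Banach.\<close>

lemma op_eqI_functional:
  fixes S T :: "'v op"
  assumes "\<And>\<psi>. complex_functional \<psi> \<Longrightarrow> \<psi> S = \<psi> T"
  shows "S = T"
  by (rule blinfun_eqI, rule ell2_eqI) (rule assms[OF complex_functional_entry])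

lemma bounded_linear_compose_op_left: "bounded_linear (\<lambda>T. T o\<^sub>L S)"
  and bounded_linear_compose_op_right: "bounded_linear (\<lambda>T. S o\<^sub>L T)"
  by (rule bounded_bilinear.bounded_linear_left bounded_bilinear.bounded_linear_right;
      rule bounded_bilinear_blinfun_compose)+

lemma complex_functional_compose_left:
  assumes "complex_functional \<psi>"
  shows "complex_functional (\<lambda>T. \<psi> (T o\<^sub>L S))"
  using assms unfolding complex_functional_def
  by (auto simp: scaleC_op_compose_left intro: bounded_linear_compose bounded_linear_compose_op_left)

text \<open>Here the scalar has to pass through \<open>S\<close>. The case of interest is a
  resolvent in the place of \<open>S\<close>.\<close>

lemma complex_functional_compose_right:
  assumes "complex_functional \<psi>" "complex_linear S"
  shows "complex_functional (\<lambda>T. \<psi> (S o\<^sub>L T))"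
  using assms unfolding complex_functional_def
  by (auto simp: compose_scaleC_op intro: bounded_linear_compose bounded_linear_compose_op_right)

section \<open>Resolvents\<close>

lemma compose_id_blinfun [simp]: "S o\<^sub>L id_blinfun = S" "id_blinfun o\<^sub>L S = S"
  by (auto intro: blinfun_eqI)

lemma compose_diff_left: "(S - T) o\<^sub>L U = (S o\<^sub>L U) - (T o\<^sub>L U)"
  and compose_diff_right: "U o\<^sub>L (S - T) = (U o\<^sub>L S) - (U o\<^sub>L T)"
  and compose_add_left: "(S + T) o\<^sub>L U = (S o\<^sub>L U) + (T o\<^sub>L U)"
  by (auto intro!: blinfun_eqI simp: blinfun.diff_left blinfun.diff_right blinfun.add_left)

lemma compose_assoc: "(S o\<^sub>L T) o\<^sub>L U = S o\<^sub>L (T o\<^sub>L U)"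
  by (auto intro: blinfun_eqI)

lemma two_sided_inverse_unique:
  assumes "L o\<^sub>L U = id_blinfun" "U o\<^sub>L R = id_blinfun"
  shows "L = R"
  by (metis assms compose_assoc compose_id_blinfun)

lemma is_resolvent_unique: "is_resolvent T z R \<Longrightarrow> is_resolvent T z R' \<Longrightarrow> R = R'"
  unfolding is_resolvent_def using two_sided_inverse_unique by blast

lemma resolvent_eq: "is_resolvent T z R \<Longrightarrow> resolvent T z = R"
  unfolding resolvent_def using is_resolvent_unique by blast

lemma is_resolvent_resolvent: "z \<notin> op_spectrum T \<Longrightarrow> is_resolvent T z (resolvent T z)"
  using resolvent_eq unfolding op_spectrum_def by fastforce

lemma resolvent_eqD:
  assumes "z \<notin> op_spectrum T"
  shows "(z *\<^sub>C id_blinfun - T) o\<^sub>L resolvent T z = id_blinfun"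
    "resolvent T z o\<^sub>L (z *\<^sub>C id_blinfun - T) = id_blinfun"
  using is_resolvent_resolvent[OF assms] by (auto simp: is_resolvent_def)

lemma complex_linear_shift: "complex_linear T \<Longrightarrow> complex_linear (z *\<^sub>C id_blinfun - T)"
  by (simp add: complex_linear_def blinfun.diff_left scaleC_ell2_diff_right scaleC_ell2_scaleC mult.commute)

lemma complex_linear_resolvent:
  assumes "complex_linear T" "z \<notin> op_spectrum T"
  shows "complex_linear (resolvent T z)"
  unfolding complex_linear_def
proof (intro allI)
  fix c f
  let ?U = "z *\<^sub>C id_blinfun - T" and ?R = "resolvent T z"
  have 1: "?R (?U g) = g" "?U (?R g) = g" for g
    using resolvent_eqD[OF assms(2)] by (metis blinfun_apply_blinfun_compose blinfun_apply_id_blinfun id_apply)+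
  have "?U (scaleC_ell2 c (?R f)) = scaleC_ell2 c f"
    using complex_linear_shift[OF assms(1), of z] 1 by (simp only: complex_linear_def)
  then show "?R (scaleC_ell2 c f) = scaleC_ell2 c (?R f)"
    using 1 by metis
qed

lemma resolvent_identity:
  assumes T: "complex_linear T" and z: "z \<notin> op_spectrum T" and w: "w \<notin> op_spectrum T"
  shows "resolvent T z - resolvent T w = (w - z) *\<^sub>C (resolvent T z o\<^sub>L resolvent T w)"
proof -
  let ?R = "resolvent T z" and ?S = "resolvent T w"
  have cl: "complex_linear ?R" using T z by (rule complex_linear_resolvent)
  \<comment> \<open>Each resolvent is multiplied by the identity, written as the other resolvent
    composed with its inverse; \<open>T\<close> then drops out of the difference.\<close>
  have "?R - ?S = (?R o\<^sub>L ((w *\<^sub>C id_blinfun - T) o\<^sub>L ?S)) - ((?R o\<^sub>L (z *\<^sub>C id_blinfun - T)) o\<^sub>L ?S)"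
    using resolvent_eqD[OF z] resolvent_eqD[OF w] by simp
  also have "\<dots> = ?R o\<^sub>L (((w *\<^sub>C id_blinfun - T) - (z *\<^sub>C id_blinfun - T)) o\<^sub>L ?S)"
    unfolding compose_diff_left[of "w *\<^sub>C id_blinfun - T"] compose_diff_right[of ?R "_ o\<^sub>L _"] compose_assoc ..
  also have "(w *\<^sub>C id_blinfun - T) - (z *\<^sub>C id_blinfun - T) = (w - z) *\<^sub>C id_blinfun"
    by (simp add: scaleC_op_diff_left)
  finally show ?thesis
    by (simp add: scaleC_op_compose_left compose_scaleC_op[OF cl])
qed

section \<open>Neumann series and the topology of the resolvent set\<close>

lemma neumann_inverse:
  fixes S :: "'a :: banach \<Rightarrow>\<^sub>L 'a"
  assumes "norm S < 1"
  shows "\<exists>N. (id_blinfun - S) o\<^sub>L N = id_blinfun \<and> N o\<^sub>L (id_blinfun - S) = id_blinfun"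
proof -
  define P where "P n = ((o\<^sub>L) S ^^ n) id_blinfun" for n
  have P0: "P 0 = id_blinfun" and PS: "P (Suc n) = S o\<^sub>L P n" for n
    by (simp_all add: P_def)
  have PS': "P (Suc n) = P n o\<^sub>L S" for n
    by (induction n) (simp_all add: P0 PS compose_assoc[symmetric])
  \<comment> \<open>The norm of the identity stays as a factor because it is 1 only on a nonzero
    space.\<close>
  have bound: "norm (P n) \<le> norm S ^ n * norm (P 0)" for n
  proof (induction n)
    case (Suc n)
    have "norm (P (Suc n)) \<le> norm S * norm (P n)"
      unfolding PS by (rule norm_blinfun_compose)
    also have "\<dots> \<le> norm S * (norm S ^ n * norm (P 0))"
      by (intro mult_left_mono Suc) simp
    finally show ?case by (simp add: mult.assoc)
  qed simp
  have sm: "summable P"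
    by (rule summable_comparison_test'[OF summable_mult2[OF summable_geometric] bound]) (use assms in simp)
  have shift: "(\<Sum>n. P (Suc n)) = suminf P - id_blinfun"
    using suminf_split_head[OF sm] by (simp add: P0)
  have "S o\<^sub>L suminf P = (\<Sum>n. P (Suc n))"
    unfolding PS by (rule bounded_linear.suminf[OF bounded_linear_compose_op_right sm])
  moreover have "suminf P o\<^sub>L S = (\<Sum>n. P (Suc n))"
    unfolding PS' by (rule bounded_linear.suminf[OF bounded_linear_compose_op_left sm])
  ultimately show ?thesis
    by (intro exI[of _ "suminf P"]) (simp add: shift compose_diff_left compose_diff_right)
qed

text \<open>The operator w - T is the product of z - T and 1 - S, in either order, where S = (z - w)
  R(z) has norm below 1. With N the Neumann inverse of 1 - S, one order makes N R(z) a right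
  inverse, the other makes R(z) N a left inverse, and the two agree.\<close>

lemma resolvent_set_ball:
  assumes T: "complex_linear T" and z: "z \<notin> op_spectrum T"
    and w: "cmod (w - z) * norm (resolvent T z) < 1"
  shows "w \<notin> op_spectrum T"
proof -
  let ?R = "resolvent T z" and ?U = "z *\<^sub>C id_blinfun - T"
  define S where "S = (z - w) *\<^sub>C ?R"
  have "norm S < 1" using w by (simp add: S_def norm_scaleC_op norm_minus_commute)
  then obtain N where N: "(id_blinfun - S) o\<^sub>L N = id_blinfun" "N o\<^sub>L (id_blinfun - S) = id_blinfun"
    using neumann_inverse by blast
  have cl: "complex_linear ?U" using T by (rule complex_linear_shift)
  have "?U o\<^sub>L S = (z - w) *\<^sub>C id_blinfun" "S o\<^sub>L ?U = (z - w) *\<^sub>C id_blinfun"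
    using resolvent_eqD[OF z] by (simp_all add: S_def compose_scaleC_op[OF cl] scaleC_op_compose_left)
  then have W: "w *\<^sub>C id_blinfun - T = ?U o\<^sub>L (id_blinfun - S)"
     "w *\<^sub>C id_blinfun - T = (id_blinfun - S) o\<^sub>L ?U"
    by (simp_all only: compose_diff_right[of ?U id_blinfun S] compose_diff_left[of id_blinfun S ?U]
      compose_id_blinfun scaleC_op_diff_left) (simp_all add: algebra_simps)
  have "(w *\<^sub>C id_blinfun - T) o\<^sub>L (N o\<^sub>L ?R) = id_blinfun"
    unfolding W(1) using N(1) resolvent_eqD[OF z] by (metis compose_assoc compose_id_blinfun)
  moreover have "(?R o\<^sub>L N) o\<^sub>L (w *\<^sub>C id_blinfun - T) = id_blinfun"
    unfolding W(2) using N(2) resolvent_eqD[OF z] by (metis compose_assoc compose_id_blinfun)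
  ultimately have "is_resolvent T w (N o\<^sub>L ?R)"
    unfolding is_resolvent_def using two_sided_inverse_unique[of "?R o\<^sub>L N" "w *\<^sub>C id_blinfun - T" "N o\<^sub>L ?R"] by simp
  then show ?thesis by (auto simp: op_spectrum_def)
qed

lemma closed_op_spectrum:
  assumes "complex_linear T"
  shows "closed (op_spectrum T)"
proof -
  have "\<exists>e>0. ball z e \<subseteq> - op_spectrum T" if z: "z \<in> - op_spectrum T" for z
  proof (intro exI conjI subsetI)
    \<comment> \<open>The added 1 avoids having to show that the resolvent is nonzero.\<close>
    let ?e = "1 / (norm (resolvent T z) + 1)"
    show "?e > 0" by (simp add: add_nonneg_pos)
    fix w assume "w \<in> ball z ?e"
    then have "cmod (w - z) * (norm (resolvent T z) + 1) < 1"
      by (simp add: dist_norm norm_minus_commute pos_less_divide_eq add_nonneg_pos)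
    moreover have "cmod (w - z) * norm (resolvent T z) \<le> cmod (w - z) * (norm (resolvent T z) + 1)"
      by (intro mult_left_mono) auto
    ultimately show "w \<in> - op_spectrum T"
      using resolvent_set_ball[OF assms, of z w] z by auto
  qed
  then have "open (- op_spectrum T)" by (simp add: open_contains_ball)
  then show ?thesis by (simp add: closed_def)
qed

text \<open>The resolvent identity bounds the difference by half the norm of the unknown R(w), which
  is absorbed into the left side; inserting the resulting bound for R(w) gives a Lipschitz estimate
  at z.\<close>

lemma norm_resolvent_nearby:
  assumes T: "complex_linear T" and z: "z \<notin> op_spectrum T" and w: "w \<notin> op_spectrum T"
    and d: "cmod (w - z) * norm (resolvent T z) \<le> 1 / 2"
  shows "norm (resolvent T w) \<le> 2 * norm (resolvent T z)"
    and "norm (resolvent T w - resolvent T z) \<le> cmod (w - z) * (2 * (norm (resolvent T z))\<^sup>2)"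
proof -
  let ?R = "resolvent T z" and ?S = "resolvent T w"
  have *: "norm (?S - ?R) \<le> cmod (w - z) * (norm ?S * norm ?R)"
    unfolding resolvent_identity[OF T w z] norm_scaleC_op
    by (simp add: norm_minus_commute mult_left_mono norm_blinfun_compose)
  have "cmod (w - z) * (norm ?S * norm ?R) = (cmod (w - z) * norm ?R) * norm ?S" by simp
  also have "\<dots> \<le> 1 / 2 * norm ?S" using d by (intro mult_right_mono) auto
  finally show S: "norm ?S \<le> 2 * norm ?R"
    using * norm_triangle_ineq2[of ?S ?R] by linarith
  have "cmod (w - z) * (norm ?S * norm ?R) \<le> cmod (w - z) * ((2 * norm ?R) * norm ?R)"
    by (intro mult_left_mono mult_right_mono S) auto
  then show "norm (?S - ?R) \<le> cmod (w - z) * (2 * (norm ?R)\<^sup>2)"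
    using * by (simp add: power2_eq_square mult.assoc)
qed

lemma tendsto_resolvent:
  assumes T: "complex_linear T" and z: "z \<notin> op_spectrum T"
  shows "(resolvent T \<longlongrightarrow> resolvent T z) (at z)"
proof -
  have "((\<lambda>w. cmod (w - z) * norm (resolvent T z)) \<longlongrightarrow> cmod (z - z) * norm (resolvent T z)) (at z)"
    by (intro tendsto_intros)
  then have "eventually (\<lambda>w. cmod (w - z) * norm (resolvent T z) < 1/2) (at z)"
    by (rule order_tendstoD) simp
  moreover have "eventually (\<lambda>w. w \<in> - op_spectrum T) (at z)"
    using closed_op_spectrum[OF T] z by (intro eventually_at_in_open') (auto simp: open_Compl)
  ultimately have "eventually (\<lambda>w. norm (resolvent T w - resolvent T z)
      \<le> cmod (w - z) * (2 * (norm (resolvent T z))\<^sup>2)) (at z)"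
    by eventually_elim (use norm_resolvent_nearby[OF T z] in auto)
  moreover have "((\<lambda>w. cmod (w - z) * (2 * (norm (resolvent T z))\<^sup>2)) \<longlongrightarrow> 0) (at z)"
    by (intro tendsto_mult_left_zero tendsto_norm_zero LIM_zero tendsto_ident_at)
  ultimately have "((\<lambda>w. resolvent T w - resolvent T z) \<longlongrightarrow> 0) (at z)"
    by (rule Lim_null_comparison)
  then show ?thesis by (rule LIM_zero_cancel)
qed

lemma continuous_on_resolvent:
  "complex_linear T \<Longrightarrow> continuous_on (- op_spectrum T) (resolvent T)"
  by (intro continuous_at_imp_continuous_on ballI) (auto simp: isCont_def intro: tendsto_resolvent)

text \<open>By the resolvent identity the difference quotient is exactly -\<psi>(R(w) R(z)), so
  continuity of the resolvent suffices.\<close>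

lemma holomorphic_functional_resolvent:
  assumes T: "complex_linear T" and \<psi>: "complex_functional \<psi>"
  shows "(\<lambda>z. \<psi> (resolvent T z)) holomorphic_on - op_spectrum T"
proof -
  interpret \<psi>: bounded_linear \<psi> using \<psi> by (rule complex_functional_bounded_linear)
  have "((\<lambda>z. \<psi> (resolvent T z)) has_field_derivative - \<psi> (resolvent T z o\<^sub>L resolvent T z)) (at z)"
    if z: "z \<notin> op_spectrum T" for z
    unfolding has_field_derivative_iff
  proof (rule Lim_transform_eventually)
    show "((\<lambda>w. - \<psi> (resolvent T w o\<^sub>L resolvent T z)) \<longlongrightarrow> - \<psi> (resolvent T z o\<^sub>L resolvent T z)) (at z)"
      by (intro tendsto_minus \<psi>.tendsto bounded_linear.tendsto[OF bounded_linear_compose_op_left]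
        tendsto_resolvent T z)
    have "eventually (\<lambda>w. w \<in> - op_spectrum T - {z}) (at z)"
      using closed_op_spectrum[OF T] z by (intro eventually_at_in_open) (auto simp: open_Compl)
    then show "eventually (\<lambda>w. - \<psi> (resolvent T w o\<^sub>L resolvent T z)
        = (\<psi> (resolvent T w) - \<psi> (resolvent T z)) / (w - z)) (at z)"
    proof eventually_elim
      case (elim w)
      have "\<psi> (resolvent T w) - \<psi> (resolvent T z) = (z - w) * \<psi> (resolvent T w o\<^sub>L resolvent T z)"
        using resolvent_identity[OF T, of w z] elim z complex_functional_scaleC[OF \<psi>]
        by (simp add: \<psi>.diff[symmetric])
      then show ?case using elim by (simp add: field_simps)
    qed
  qed
  then show ?thesis
    by (auto simp: holomorphic_on_def field_differentiable_def intro: has_field_derivative_at_within)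
qed

text \<open>Neumann series for z (1 - T / z). The bound follows from z R = 1 + T R after the term
  with R on the right is absorbed.\<close>

lemma resolvent_at_infinity:
  assumes T: "complex_linear T" and z: "cmod z > norm T"
  shows "z \<notin> op_spectrum T" and "norm (resolvent T z) \<le> norm (id_blinfun :: 'v op) / (cmod z - norm (T :: 'v op))"
proof -
  have z0: "z \<noteq> 0" using z norm_ge_zero[of T] by auto
  define S where "S = inverse z *\<^sub>C T"
  have "norm S = norm T / cmod z" by (simp add: S_def norm_scaleC_op norm_inverse divide_inverse_commute)
  then have "norm S < 1" using z z0 by simp
  then obtain N where N: "(id_blinfun - S) o\<^sub>L N = id_blinfun" "N o\<^sub>L (id_blinfun - S) = id_blinfun"
    using neumann_inverse by blast
  have U: "z *\<^sub>C id_blinfun - T = z *\<^sub>C (id_blinfun - S)"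
    using z0 by (simp add: S_def scaleC_op_diff_right scaleC_op_scaleC)
  have "(N o\<^sub>L inverse z *\<^sub>C id_blinfun) o\<^sub>L (z *\<^sub>C id_blinfun - T) = id_blinfun"
    using N(2) z0 by (simp add: U compose_assoc scaleC_op_compose_left scaleC_op_scaleC)
  moreover have "(z *\<^sub>C id_blinfun - T) o\<^sub>L (inverse z *\<^sub>C N) = id_blinfun"
    unfolding compose_scaleC_op[OF complex_linear_shift[OF T]]
    unfolding U using N(1) z0 by (simp add: scaleC_op_compose_left scaleC_op_scaleC)
  ultimately have "is_resolvent T z (inverse z *\<^sub>C N)"
    unfolding is_resolvent_def
    using two_sided_inverse_unique[of "N o\<^sub>L inverse z *\<^sub>C id_blinfun" "z *\<^sub>C id_blinfun - T" "inverse z *\<^sub>C N"]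
    by simp
  then show zn: "z \<notin> op_spectrum T" by (auto simp: op_spectrum_def)
  let ?R = "resolvent T z"
  have "z *\<^sub>C ?R = id_blinfun + (T o\<^sub>L ?R)"
    using resolvent_eqD(1)[OF zn] by (simp add: compose_diff_left scaleC_op_compose_left algebra_simps)
  then have "cmod z * norm ?R \<le> norm (id_blinfun :: 'v op) + norm T * norm ?R"
    by (metis norm_scaleC_op norm_triangle_le add_left_mono norm_blinfun_compose)
  then show "norm ?R \<le> norm (id_blinfun :: 'v op) / (cmod z - norm T)"
    using z by (simp add: field_simps)
qed

lemma bounded_op_spectrum: "complex_linear T \<Longrightarrow> bounded (op_spectrum T)"
  unfolding bounded_iff using resolvent_at_infinity(1) by (metis not_le)

lemma resolvent_tendsto_0:
  assumes T: "complex_linear T"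
  shows "(resolvent T \<longlongrightarrow> 0) at_infinity"
proof (rule Lim_null_comparison)
  show "eventually (\<lambda>z. norm (resolvent T z) \<le> norm (id_blinfun :: 'a op) / (cmod z - norm T)) at_infinity"
    unfolding eventually_at_infinity
    by (rule exI[of _ "norm T + 1"]) (auto intro: resolvent_at_infinity(2)[OF T])
  have "filterlim (\<lambda>z. cmod z - norm T) at_top at_infinity"
    using filterlim_tendsto_add_at_top[OF tendsto_const[of "- norm T"] filterlim_norm_at_top]
    by (simp add: add.commute)
  then show "((\<lambda>z. norm (id_blinfun :: 'a op) / (cmod z - norm T)) \<longlongrightarrow> 0) at_infinity"
    by (rule real_tendsto_divide_at_top[OF tendsto_const])
qed

text \<open>Otherwise every \<psi>(R(z)) is entire and tends to 0, hence vanishes by Liouville,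
  although R is invertible. A point of the spectrum serves below as the centre of an
  inversion.\<close>

lemma op_spectrum_nonempty:
  fixes T :: "'v op"
  assumes T: "complex_linear T"
  shows "op_spectrum T \<noteq> {}"
proof
  assume e: "op_spectrum T = {}"
  have "resolvent T 0 = 0"
  proof (rule op_eqI_functional)
    fix \<psi> :: "'v op \<Rightarrow> complex" assume \<psi>: "complex_functional \<psi>"
    interpret \<psi>: bounded_linear \<psi> using \<psi> by (rule complex_functional_bounded_linear)
    have "\<psi> (resolvent T 0) = 0"
      by (rule Liouville_weak_0[of "\<lambda>z. \<psi> (resolvent T z)"])
        (use holomorphic_functional_resolvent[OF T \<psi>] \<psi>.tendsto_zero[OF resolvent_tendsto_0[OF T]] e in auto)
    then show "\<psi> (resolvent T 0) = \<psi> 0" by simp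
  qed
  then have "(id_blinfun :: 'v op) = 0"
    using resolvent_eqD(1)[of 0 T] e by simp
  then have "(f :: 'v ell2) = 0" for f
    by (metis blinfun_apply_id_blinfun id_apply zero_blinfun.rep_eq)
  \<comment> \<open>Every type is inhabited, so the unit vector at \<open>undefined\<close> shows
    that the space is nonzero.\<close>
  moreover have "ell2_apply (Abs_ell2 (\<lambda>x. if x = undefined then 1 else 0 :: complex)) (undefined :: 'v) = 1"
  proof -
    have "(\<lambda>x. (cmod (if x = (undefined :: 'v) then 1 else 0))\<^sup>2) summable_on UNIV"
      by (rule ell2_of_finite_sums(1)[where e = 1])
        (auto simp: if_distrib[of cmod] if_distrib[of "\<lambda>x. x\<^sup>2"] cong: if_cong)
    then show ?thesis by (subst Abs_ell2_inverse) auto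
  qed
  ultimately show False
    by (metis zero_ell2.rep_eq zero_neq_one)
qed

section \<open>Contour integrals of the resolvent\<close>

text \<open>The logarithmic derivative of 1 / (u - a) - 1 / (z - a) in u is 1 / (u - z) - 1 / (u -
  a): the inversion has its pole at a.\<close>

lemma winding_number_inversion:
  assumes \<gamma>: "valid_path \<gamma>" and a: "a \<notin> path_image \<gamma>" and z: "z \<notin> path_image \<gamma>" "z \<noteq> a"
  shows "winding_number ((\<lambda>u. inverse (u - a)) \<circ> \<gamma>) (inverse (z - a)) = winding_number \<gamma> z - winding_number \<gamma> a"
proof -
  let ?f = "\<lambda>u. inverse (u - a)"
  have partial_fractions: "- (1 / p\<^sup>2) * (1 / ((r - p) / (p * r))) = 1 / (p - r) - 1 / p"
    if "p \<noteq> 0" "r \<noteq> 0" "p \<noteq> r" for p r :: complex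
    using that by (simp add: divide_simps power2_eq_square) (simp add: algebra_simps)
  have holo: "?f holomorphic_on - {a}" by (intro holomorphic_intros) auto
  have an: "?f analytic_on - {a}" using holo by (simp add: analytic_on_open open_Compl)
  have sub: "path_image \<gamma> \<subseteq> - {a}" using a by auto
  have vp: "valid_path (?f \<circ> \<gamma>)"
    by (rule valid_path_compose_holomorphic[OF \<gamma> holo _ sub]) (simp add: open_Compl)
  have notin: "?f z \<notin> path_image (?f \<circ> \<gamma>)"
    using z a by (auto simp: path_image_compose)
  have int: "(\<lambda>u. 1 / (u - z)) contour_integrable_on \<gamma>" "(\<lambda>u. 1 / (u - a)) contour_integrable_on \<gamma>"
    using has_contour_integral_winding_number[OF \<gamma>] z a by (auto simp: contour_integrable_on_def)
  have "2 * of_real pi * \<i> * winding_number (?f \<circ> \<gamma>) (?f z) = contour_integral (?f \<circ> \<gamma>) (\<lambda>w. 1 / (w - ?f z))"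
    using winding_number_valid_path[OF vp notin] by simp
  also have "\<dots> = contour_integral \<gamma> (\<lambda>u. deriv ?f u * (1 / (?f u - ?f z)))"
    by (rule contour_integral_comp_analyticW[OF an \<gamma> sub])
  also have "\<dots> = contour_integral \<gamma> (\<lambda>u. 1 / (u - z) - 1 / (u - a))"
  proof (rule contour_integral_eq)
    fix u assume u: "u \<in> path_image \<gamma>"
    then have ne: "u \<noteq> a" "u \<noteq> z" using a z by auto
    have "(?f has_field_derivative - (1 / (u - a)\<^sup>2)) (at u)"
      using ne by (auto intro!: derivative_eq_intros simp: power2_eq_square field_simps)
    then have d: "deriv ?f u = - (1 / (u - a)\<^sup>2)" by (rule DERIV_imp_deriv)
    have "?f u - ?f z = (z - u) / ((u - a) * (z - a))"
      using ne z by (simp add: field_simps)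
    then show "deriv ?f u * (1 / (?f u - ?f z)) = 1 / (u - z) - 1 / (u - a)"
      unfolding d using ne z partial_fractions[of "u - a" "z - a"] by simp
  qed
  also have "\<dots> = 2 * of_real pi * \<i> * (winding_number \<gamma> z - winding_number \<gamma> a)"
    using winding_number_valid_path[OF \<gamma>] z a int
    by (simp add: contour_integral_diff right_diff_distrib)
  finally show ?thesis by simp
qed

text \<open>Cauchy's theorem in the exterior domain \<open>- K\<close>, which need not be connected: the inversion
  \<open>z \<mapsto> 1 / (z - a)\<close> turns equal winding numbers around \<open>K\<close> into vanishing ones, and the decay
  at infinity makes the origin a removable singularity.\<close>

lemma Cauchy_theorem_exterior:
  assumes K: "compact K" "a \<in> K" and F: "F holomorphic_on - K"
    and decay: "eventually (\<lambda>z. cmod ((z - a)\<^sup>2 * F z) \<le> C) at_infinity"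
    and \<gamma>: "valid_path \<gamma>" "pathfinish \<gamma> = pathstart \<gamma>" "path_image \<gamma> \<subseteq> - K"
    and wind: "\<And>z. z \<in> K \<Longrightarrow> winding_number \<gamma> z = winding_number \<gamma> a"
  shows "(F has_contour_integral 0) \<gamma>"
proof -
  let ?f = "\<lambda>u. inverse (u - a)"
  \<comment> \<open>\<open>U\<close> is the image of the exterior under the inversion, with 0
    standing for the point at infinity. \<open>G\<close> is the form F du in the coordinate w = 1 /
    (u - a), where du = - dw / w^2.\<close>
  define U where "U = {w. w \<noteq> 0 \<longrightarrow> a + inverse w \<notin> K}"
  define G where "G = (\<lambda>w. - (F (a + inverse w) * (inverse w)\<^sup>2))"
  have cK: "open (- K)" using compact_imp_closed[OF K(1)] by (simp add: open_Compl)
  have U0: "open (U - {0})"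
  proof -
    have "open ((- {0}) \<inter> (\<lambda>w. a + inverse w) -` (- K))"
      by (intro continuous_open_preimage continuous_intros cK) auto
    also have "(- {0}) \<inter> (\<lambda>w. a + inverse w) -` (- K) = U - {0}"
      by (auto simp: U_def)
    finally show ?thesis .
  qed
  \<comment> \<open>Everything at distance b or more from a lies outside \<open>K\<close>; inverted,
    this makes the disc of radius 1 / b around 0 part of \<open>U\<close>.\<close>
  obtain b where b: "b > 0" "\<And>z. z \<in> K \<Longrightarrow> dist a z < b"
    using compact_imp_bounded[OF K(1)] bounded_subset_ballD[of K a] by (auto simp: subset_iff)
  have "ball 0 (1 / b) \<subseteq> U"
  proof
    fix w :: complex assume w: "w \<in> ball 0 (1 / b)"
    show "w \<in> U"
    proof (cases "w = 0")
      case False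
      then have "b < cmod (inverse w)"
        using w b by (simp add: norm_divide inverse_eq_divide pos_less_divide_eq mult.commute)
      then show ?thesis
        using b(2)[of "a + inverse w"] by (auto simp: U_def dist_norm)
    qed (simp add: U_def)
  qed
  then have "U = (U - {0}) \<union> ball 0 (1 / b)" using b by auto
  then have oU: "open U" using U0 by (metis open_Un open_ball)
  have zU: "0 \<in> U" by (simp add: U_def)
  have G: "G holomorphic_on U - {0}"
    unfolding G_def using F
    by (intro holomorphic_intros holomorphic_on_compose_gen[OF _ F, unfolded o_def])
       (auto simp: U_def)
  have "filterlim (\<lambda>w. a + inverse w) at_infinity (at (0::complex))"
    by (rule tendsto_add_filterlim_at_infinity[OF tendsto_const filterlim_inverse_at_infinity])
  with decay have "eventually (\<lambda>w. cmod ((a + inverse w - a)\<^sup>2 * F (a + inverse w)) \<le> C) (at 0)"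
    by (rule eventually_compose_filterlim)
  then have "eventually (\<lambda>w. cmod (G w) \<le> C) (at 0)"
    by eventually_elim (simp add: G_def mult.commute)
  then obtain g where g: "g holomorphic_on U" "\<And>w. w \<in> U - {0} \<Longrightarrow> g w = G w"
    using holomorphic_on_extend_bounded[OF G] zU oU by (auto simp: interior_open)
  have aim: "a \<notin> path_image \<gamma>" using \<gamma> K by auto
  have sub: "path_image \<gamma> \<subseteq> - {a}" using aim by auto
  have holo: "?f holomorphic_on - {a}" by (intro holomorphic_intros) auto
  have an: "?f analytic_on - {a}" using holo by (simp add: analytic_on_open open_Compl)
  have fim: "?f u \<in> U - {0}" if "u \<in> path_image \<gamma>" for u
    using that \<gamma> aim by (auto simp: U_def)
  have "(g has_contour_integral 0) (?f \<circ> \<gamma>)"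
  proof (rule Cauchy_theorem_global[OF oU g(1)])
    show "valid_path (?f \<circ> \<gamma>)"
      by (rule valid_path_compose_holomorphic[OF \<gamma>(1) holo _ sub]) (simp add: open_Compl)
    show "pathfinish (?f \<circ> \<gamma>) = pathstart (?f \<circ> \<gamma>)"
      using \<gamma> by (simp add: pathfinish_compose pathstart_compose)
    show "path_image (?f \<circ> \<gamma>) \<subseteq> U"
      using fim by (auto simp: path_image_compose)
    fix w assume "w \<notin> U"
    then have w: "w \<noteq> 0" "a + inverse w \<in> K" by (auto simp: U_def)
    have "winding_number (?f \<circ> \<gamma>) (inverse (a + inverse w - a))
        = winding_number \<gamma> (a + inverse w) - winding_number \<gamma> a"
      using w \<gamma> aim by (intro winding_number_inversion) auto
    then show "winding_number (?f \<circ> \<gamma>) w = 0" using wind[OF w(2)] by simp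
  qed
  then have "contour_integral (?f \<circ> \<gamma>) g = 0" by (rule contour_integral_unique)
  moreover have "contour_integral (?f \<circ> \<gamma>) g = contour_integral \<gamma> (\<lambda>u. deriv ?f u * g (?f u))"
    by (rule contour_integral_comp_analyticW[OF an \<gamma>(1) sub])
  moreover have "\<dots> = contour_integral \<gamma> F"
  proof (rule contour_integral_eq)
    fix u assume u: "u \<in> path_image \<gamma>"
    then have ne: "u \<noteq> a" using aim by auto
    have "(?f has_field_derivative - (1 / (u - a)\<^sup>2)) (at u)"
      using ne by (auto intro!: derivative_eq_intros simp: power2_eq_square field_simps)
    then have d: "deriv ?f u = - (1 / (u - a)\<^sup>2)" by (rule DERIV_imp_deriv)
    show "deriv ?f u * g (?f u) = F u"
      unfolding d g(2)[OF fim[OF u]] using ne by (simp add: G_def power2_eq_square)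
  qed
  moreover have "F contour_integrable_on \<gamma>"
    using F cK \<gamma> by (intro contour_integrable_holomorphic_simple) auto
  ultimately show ?thesis
    using has_contour_integral_integral by fastforce
qed

text \<open>At infinity the resolvent is 1 / z up to an error of order z^(-2). Subtracting the
  multiple of 1 / (z - a) leaves a function covered by \<open>Cauchy_theorem_exterior\<close>, and
  the subtracted term contributes the winding number around a.\<close>

lemma contour_integral_resolvent:
  assumes T: "complex_linear T" and \<psi>: "complex_functional \<psi>"
    and \<gamma>: "valid_path \<gamma>" "pathfinish \<gamma> = pathstart \<gamma>" "path_image \<gamma> \<subseteq> - op_spectrum T"
    and wind: "\<And>z. z \<in> op_spectrum T \<Longrightarrow> winding_number \<gamma> z = 1"
  shows "((\<lambda>z. \<psi> (resolvent T z)) has_contour_integral 2 * of_real pi * \<i> * \<psi> id_blinfun) \<gamma>"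
proof -
  interpret \<psi>: bounded_linear \<psi> using \<psi> by (rule complex_functional_bounded_linear)
  obtain a where a: "a \<in> op_spectrum T" using op_spectrum_nonempty[OF T] by auto
  let ?K = "op_spectrum T"
  define F where "F = (\<lambda>z. \<psi> (resolvent T z) - \<psi> id_blinfun * (1 / (z - a)))"
  have holo: "F holomorphic_on - ?K"
    unfolding F_def using a
    by (intro holomorphic_on_diff holomorphic_functional_resolvent[OF T \<psi>] holomorphic_intros) auto
  obtain M' where M': "M' > 0" "\<And>S. cmod (\<psi> S) \<le> norm S * M'" using \<psi>.pos_bounded by blast
  define D where "D = T - a *\<^sub>C id_blinfun"
  \<comment> \<open>Two applications of (z - a) R = 1 + R D cancel the terms of order 1 / z exactly;
    what remains is bounded because R tends to 0.\<close>
  have key: "(z - a)\<^sup>2 * F z = \<psi> (D + ((resolvent T z) o\<^sub>L (D o\<^sub>L D)))"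
    if z: "z \<notin> ?K" for z
  proof -
    let ?R = "resolvent T z"
    have cl: "complex_linear ?R" using T z by (rule complex_linear_resolvent)
    have za: "z \<noteq> a" using a z by auto
    have eq: "(z - a) *\<^sub>C ?R = id_blinfun + (?R o\<^sub>L D)"
    proof -
      have "id_blinfun = ?R o\<^sub>L ((z - a) *\<^sub>C id_blinfun - D)"
        using resolvent_eqD(2)[OF z] by (simp add: D_def scaleC_op_diff_left)
      then show ?thesis by (simp add: compose_diff_right compose_scaleC_op[OF cl] eq_diff_eq)
    qed
    have "(z - a) *\<^sub>C (z - a) *\<^sub>C ?R - (z - a) *\<^sub>C id_blinfun = (z - a) *\<^sub>C (?R o\<^sub>L D)"
      by (subst eq) (simp add: scaleC_op_add_right)
    also have "\<dots> = ((z - a) *\<^sub>C ?R) o\<^sub>L D"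
      by (simp add: scaleC_op_compose_left)
    also have "\<dots> = D + (?R o\<^sub>L (D o\<^sub>L D))"
      unfolding eq by (simp add: compose_add_left compose_assoc)
    finally have "\<psi> (D + (?R o\<^sub>L (D o\<^sub>L D))) = (z - a) * ((z - a) * \<psi> ?R) - (z - a) * \<psi> id_blinfun"
      by (metis \<psi>.diff complex_functional_scaleC[OF \<psi>])
    also have "\<dots> = (z - a)\<^sup>2 * F z"
    proof -
      have "d * (d * x) - d * y = d\<^sup>2 * (x - y * (1 / d))" if "d \<noteq> 0" for d x y :: complex
        using that by (simp add: power2_eq_square field_simps)
      then show ?thesis using za by (simp add: F_def)
    qed
    finally show ?thesis ..
  qed
  have "eventually (\<lambda>z. norm (resolvent T z) < 1) at_infinity"
    using tendstoD[OF resolvent_tendsto_0[OF T], of 1] by simp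
  moreover have "eventually (\<lambda>z. z \<notin> ?K) at_infinity"
    unfolding eventually_at_infinity
    by (rule exI[of _ "norm T + 1"]) (intro allI impI resolvent_at_infinity(1)[OF T], linarith)
  ultimately have "eventually (\<lambda>z. cmod ((z - a)\<^sup>2 * F z) \<le> (norm D + norm (D o\<^sub>L D)) * M') at_infinity"
  proof eventually_elim
    case (elim z)
    have "norm (resolvent T z o\<^sub>L (D o\<^sub>L D)) \<le> norm (resolvent T z) * norm (D o\<^sub>L D)"
      by (rule norm_blinfun_compose)
    also have "\<dots> \<le> 1 * norm (D o\<^sub>L D)" using elim by (intro mult_right_mono) auto
    finally have "norm (D + (resolvent T z o\<^sub>L (D o\<^sub>L D))) \<le> norm D + norm (D o\<^sub>L D)"
      by (intro norm_triangle_le) simp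
    then show ?case
      unfolding key[OF elim(2)] using M' by (meson mult_right_mono order_trans less_imp_le)
  qed
  moreover have "compact ?K"
    using closed_op_spectrum[OF T] bounded_op_spectrum[OF T] by (simp add: compact_eq_bounded_closed)
  ultimately have 0: "(F has_contour_integral 0) \<gamma>"
    using wind a \<gamma> holo by (intro Cauchy_theorem_exterior[of ?K a]) auto
  have "((\<lambda>z. \<psi> id_blinfun * (1 / (z - a))) has_contour_integral \<psi> id_blinfun * (2 * of_real pi * \<i> * 1)) \<gamma>"
    using has_contour_integral_winding_number[of \<gamma> a] wind[OF a] a \<gamma>
    by (intro has_contour_integral_lmul) auto
  from has_contour_integral_add[OF 0 this] show ?thesis
    by (simp add: F_def mult_ac)
qed

section \<open>Operator-valued contour integrals\<close>

text \<open>The derivative of a valid path may be unbounded, so continuity of the integrand is not enough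
  for integrability; the integral is obtained from local primitives instead.\<close>

lemma weakly_holomorphic_local_primitive:
  fixes F :: "complex \<Rightarrow> 'v op"
  assumes cont: "continuous_on (ball c d) F"
    and holo: "\<And>\<psi>. complex_functional \<psi> \<Longrightarrow> (\<lambda>z. \<psi> (F z)) holomorphic_on ball c d"
  obtains P where "\<And>z. z \<in> ball c d \<Longrightarrow> (P has_derivative (\<lambda>v. v *\<^sub>C F z)) (at z)"
proof -
  define seg where "seg x y = integral {0..1} (\<lambda>t. (y - x) *\<^sub>C F (linepath x y t))" for x y
  have seg_in: "linepath x y t \<in> ball c d" if "x \<in> ball c d" "y \<in> ball c d" "t \<in> {0..1}" for x y t
    using that convex_contains_segment[THEN iffD1, OF convex_ball[of c d]] linepath_in_path[of t x y] by blast
  have cont_seg: "continuous_on {0..1} (\<lambda>t. F (linepath x y t))" if "x \<in> ball c d" "y \<in> ball c d" for x y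
    by (rule continuous_on_compose2[OF cont]) (use seg_in[OF that] in \<open>auto intro!: continuous_intros\<close>)
  have int: "(\<lambda>t. (y - x) *\<^sub>C F (linepath x y t)) integrable_on {0..1}"
    if "x \<in> ball c d" "y \<in> ball c d" for x y
    by (intro integrable_continuous_interval scaleC_op.continuous_on continuous_on_const cont_seg that)
  \<comment> \<open>Additivity along the sides of a triangle holds for each scalar function
    \<psi>(F(z)), which has a primitive on the disc; the functionals then carry it over to
    operators.\<close>
  have seg_add: "seg c y = seg c x + seg x y" if x: "x \<in> ball c d" and y: "y \<in> ball c d" for x y
  proof (rule op_eqI_functional)
    fix \<psi> :: "'v op \<Rightarrow> complex" assume \<psi>: "complex_functional \<psi>"
    interpret \<psi>: bounded_linear \<psi> using \<psi> by (rule complex_functional_bounded_linear)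
    obtain g where g: "\<And>z. z \<in> ball c d \<Longrightarrow> (g has_field_derivative \<psi> (F z)) (at z within ball c d)"
      using holomorphic_convex_primitive'[OF convex_ball open_ball holo[OF \<psi>]] by metis
    have seg: "\<psi> (seg u v) = g v - g u" if u: "u \<in> ball c d" and v: "v \<in> ball c d" for u v
    proof -
      have "\<psi> (seg u v) = integral {0..1} (\<psi> \<circ> (\<lambda>t. (v - u) *\<^sub>C F (linepath u v t)))"
        unfolding seg_def by (rule integral_linear[OF int[OF u v] \<psi>.bounded_linear_axioms, symmetric])
      also have "\<dots> = contour_integral (linepath u v) (\<lambda>z. \<psi> (F z))"
        by (simp add: contour_integral_integral o_def complex_functional_scaleC[OF \<psi>] mult.commute)
      also have "\<dots> = g v - g u"
        using contour_integral_primitive[of "ball c d" g "\<lambda>z. \<psi> (F z)" "linepath u v"] g u v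
        by (auto simp: closed_segment_subset intro!: contour_integral_unique)
      finally show ?thesis .
    qed
    have "c \<in> ball c d" using x by (auto intro: le_less_trans[OF zero_le_dist])
    then show "\<psi> (seg c y) = \<psi> (seg c x + seg x y)"
      using x y by (simp add: seg \<psi>.add)
  qed
  have "(seg c has_derivative (\<lambda>v. v *\<^sub>C F x)) (at x)" if x: "x \<in> ball c d" for x
    unfolding has_derivative_at_alt
  proof (intro conjI allI impI)
    show "bounded_linear (\<lambda>v. v *\<^sub>C F x)" by (rule scaleC_op.bounded_linear_left)
    fix e :: real assume e: "e > 0"
    have "isCont F x" using cont x by (simp add: continuous_on_eq_continuous_at)
    then obtain \<delta> where \<delta>: "\<delta> > 0" "\<And>y. dist y x < \<delta> \<Longrightarrow> dist (F y) (F x) < e"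
      unfolding continuous_at_eps_delta using e by blast
    obtain \<delta>' where \<delta>': "\<delta>' > 0" "ball x \<delta>' \<subseteq> ball c d" using x open_contains_ball by blast
    show "\<exists>\<delta>>0. \<forall>y. norm (y - x) < \<delta> \<longrightarrow> norm (seg c y - seg c x - (y - x) *\<^sub>C F x) \<le> e * norm (y - x)"
    proof (intro exI[of _ "min \<delta> \<delta>'"] conjI allI impI)
      show "min \<delta> \<delta>' > 0" using \<delta> \<delta>' by simp
      fix y assume y: "norm (y - x) < min \<delta> \<delta>'"
      then have yb: "y \<in> ball c d" using \<delta>' by (auto simp: subset_iff dist_norm norm_minus_commute)
      have "seg c y - seg c x - (y - x) *\<^sub>C F x = seg x y - (y - x) *\<^sub>C F x"
        using seg_add[OF x yb] by simp
      also have "\<dots> = integral {0..1} (\<lambda>t. (y - x) *\<^sub>C (F (linepath x y t) - F x))"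
        unfolding seg_def scaleC_op_diff_right
        by (subst integral_diff) (use int[OF x yb] in auto)
      also have "norm \<dots> \<le> (e * norm (y - x)) * (1 - 0)"
      proof (rule integral_bound)
        show "continuous_on {0..1} (\<lambda>t. (y - x) *\<^sub>C (F (linepath x y t) - F x))"
          by (intro scaleC_op.continuous_on continuous_intros cont_seg x yb)
        fix t :: real assume t: "t \<in> {0..1}"
        have "linepath x y t - x = t *\<^sub>R (y - x)" by (simp add: linepath_def algebra_simps)
        then have "norm (linepath x y t - x) \<le> norm (y - x)" using t by (simp add: mult_left_le_one_le)
        then have "dist (F (linepath x y t)) (F x) < e" using y by (intro \<delta>) (simp add: dist_norm)
        then show "norm ((y - x) *\<^sub>C (F (linepath x y t) - F x)) \<le> e * norm (y - x)"
          by (simp add: norm_scaleC_op dist_norm mult.commute[of e] mult_left_mono)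
      qed simp
      finally show "norm (seg c y - seg c x - (y - x) *\<^sub>C F x) \<le> e * norm (y - x)" by simp
    qed
  qed
  then show thesis by (rule that)
qed

lemma weakly_holomorphic_integrable_on_path:
  fixes F :: "complex \<Rightarrow> 'v op"
  assumes U: "open U" and cont: "continuous_on U F"
    and holo: "\<And>\<psi>. complex_functional \<psi> \<Longrightarrow> (\<lambda>z. \<psi> (F z)) holomorphic_on U"
    and \<gamma>: "valid_path \<gamma>" "path_image \<gamma> \<subseteq> U"
  shows "(\<lambda>t. vector_derivative \<gamma> (at t within {0..1}) *\<^sub>C F (\<gamma> t)) integrable_on {0..1}"
proof -
  obtain N where N: "finite N" "\<gamma> C1_differentiable_on ({0..1} - N)" and \<gamma>c: "continuous_on {0..1} \<gamma>"
    using \<gamma>(1) unfolding valid_path_def piecewise_C1_differentiable_on_def by blast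
  have deriv: "(\<gamma> has_vector_derivative vector_derivative \<gamma> (at t within {0..1})) (at t)"
    if "t \<in> {0<..<1} - N" for t
  proof -
    have "\<gamma> differentiable at t"
      using N(2) that by (auto simp: C1_differentiable_on_eq)
    moreover have "vector_derivative \<gamma> (at t within {0..1}) = vector_derivative \<gamma> (at t)"
      using that by (intro vector_derivative_at_within_ivl vector_derivative_works[THEN iffD1])
        (use calculation in auto)
    ultimately show ?thesis by (simp add: vector_derivative_works)
  qed
  have "\<exists>\<delta>>0. \<forall>u v. s \<in> cbox u v \<and> cbox u v \<subseteq> ball s \<delta> \<and> cbox u v \<subseteq> cbox 0 1 \<longrightarrow>
      (\<lambda>t. vector_derivative \<gamma> (at t within {0..1}) *\<^sub>C F (\<gamma> t)) integrable_on cbox u v"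
    if s: "s \<in> cbox 0 (1 :: real)" for s
  proof -
    have "\<gamma> s \<in> U" using s \<gamma>(2) by (auto simp: path_image_def)
    then obtain d where d: "d > 0" "ball (\<gamma> s) d \<subseteq> U" using U open_contains_ball by blast
    obtain P where P: "\<And>z. z \<in> ball (\<gamma> s) d \<Longrightarrow> (P has_derivative (\<lambda>v. v *\<^sub>C F z)) (at z)"
      using weakly_holomorphic_local_primitive[of "\<gamma> s" d F] cont holo d
      by (metis continuous_on_subset holomorphic_on_subset)
    obtain \<delta> where \<delta>: "\<delta> > 0" "\<And>t. t \<in> {0..1} \<Longrightarrow> dist t s < \<delta> \<Longrightarrow> dist (\<gamma> t) (\<gamma> s) < d"
      using \<gamma>c s d unfolding continuous_on_iff by (metis box_real(2))
    show ?thesis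
    proof (intro exI[of _ \<delta>] conjI allI impI)
      fix u v assume uv: "s \<in> cbox u v \<and> cbox u v \<subseteq> ball s \<delta> \<and> cbox u v \<subseteq> cbox 0 (1::real)"
      then have le: "u \<le> v" by auto
      have in_ball: "\<gamma> t \<in> ball (\<gamma> s) d" if "t \<in> {u..v}" for t
        using \<delta>(2)[of t] uv that by (auto simp: subset_iff dist_commute)
      have P_cont: "continuous_on (ball (\<gamma> s) d) P"
        using P by (meson continuous_at_imp_continuous_on has_derivative_continuous)
      \<comment> \<open>Off the finite set \<open>N\<close> the integrand is the derivative of the
        continuous map \<open>P \<circ> \<gamma>\<close>, so the fundamental theorem gives gauge
        integrability even where the derivative of \<gamma> is unbounded.\<close>
      have "((\<lambda>t. vector_derivative \<gamma> (at t within {0..1}) *\<^sub>C F (\<gamma> t)) has_integral ((P \<circ> \<gamma>) v - (P \<circ> \<gamma>) u)) {u..v}"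
      proof (rule fundamental_theorem_of_calculus_interior_strong[OF N(1) le])
        show "continuous_on {u..v} (P \<circ> \<gamma>)"
          unfolding o_def
          by (rule continuous_on_compose2[OF P_cont continuous_on_subset[OF \<gamma>c]]) (use in_ball uv in auto)
        fix t assume t: "t \<in> {u<..<v} - N"
        then have "0 \<le> u" "v \<le> 1" using uv by auto
        then have t': "t \<in> {0<..<1} - N" using t by auto
        have "((P \<circ> \<gamma>) has_derivative
            (\<lambda>v. v *\<^sub>C F (\<gamma> t)) \<circ> (\<lambda>h. h *\<^sub>R vector_derivative \<gamma> (at t within {0..1}))) (at t)"
          using deriv[OF t'] P[OF in_ball, of t] t
          by (intro diff_chain_at) (auto simp: has_vector_derivative_def)
        then show "((P \<circ> \<gamma>) has_vector_derivative
            vector_derivative \<gamma> (at t within {0..1}) *\<^sub>C F (\<gamma> t)) (at t)"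
          by (simp add: has_vector_derivative_def o_def scaleC_op.scaleR_left)
      qed
      then show "(\<lambda>t. vector_derivative \<gamma> (at t within {0..1}) *\<^sub>C F (\<gamma> t)) integrable_on cbox u v"
        by auto
    qed (use \<delta> in auto)
  qed
  then have "(\<lambda>t. vector_derivative \<gamma> (at t within {0..1}) *\<^sub>C F (\<gamma> t)) integrable_on cbox 0 1"
    by (intro integrable_on_little_subintervals) blast
  then show ?thesis by simp
qed

lemma functional_op_contour_integral:
  fixes F :: "complex \<Rightarrow> 'v op"
  assumes U: "open U" and cont: "continuous_on U F"
    and holo: "\<And>\<psi>. complex_functional \<psi> \<Longrightarrow> (\<lambda>z. \<psi> (F z)) holomorphic_on U"
    and \<gamma>: "valid_path \<gamma>" "path_image \<gamma> \<subseteq> U" and \<psi>: "complex_functional \<psi>"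
  shows "\<psi> (op_contour_integral \<gamma> F) = contour_integral \<gamma> (\<lambda>z. \<psi> (F z))"
proof -
  have "((\<lambda>t. \<psi> (F (\<gamma> t)) * vector_derivative \<gamma> (at t within {0..1})) has_integral \<psi> (op_contour_integral \<gamma> F)) {0..1}"
    using has_integral_linear[OF integrable_integral[OF weakly_holomorphic_integrable_on_path[OF U cont holo \<gamma>]]
        complex_functional_bounded_linear[OF \<psi>]]
    by (simp add: op_contour_integral_def o_def complex_functional_scaleC[OF \<psi>] mult.commute)
  then have "((\<lambda>z. \<psi> (F z)) has_contour_integral \<psi> (op_contour_integral \<gamma> F)) \<gamma>"
    by (simp add: has_contour_integral_def)
  then show ?thesis by (simp add: contour_integral_unique)
qed

section \<open>Holomorphic functional calculus\<close>

text \<open>To evaluate the definite description, one enclosing curve must exist and every enclosing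
  curve must give \<open>B\<close>; the second condition is reduced here to scalar contour
  integrals.\<close>

lemma holomorphic_calculus_eqI:
  fixes T B :: "'v op"
  assumes T: "complex_linear T" and S: "open S" and h: "h holomorphic_on S"
    and ex: "encloses_spectrum S T \<gamma>\<^sub>0"
    and val: "\<And>\<gamma> \<psi>. encloses_spectrum S T \<gamma> \<Longrightarrow> complex_functional \<psi> \<Longrightarrow>
      contour_integral \<gamma> (\<lambda>z. h z * \<psi> (resolvent T z)) = 2 * of_real pi * \<i> * \<psi> B"
  shows "holomorphic_calculus S h T = B"
proof -
  let ?U = "S - op_spectrum T"
  let ?F = "\<lambda>z. h z *\<^sub>C resolvent T z"
  have U: "open ?U" using S closed_op_spectrum[OF T] by (rule open_Diff)
  have hU: "h holomorphic_on ?U" using h by (rule holomorphic_on_subset) auto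
  have cont: "continuous_on ?U ?F"
    by (intro scaleC_op.continuous_on holomorphic_on_imp_continuous_on hU
        continuous_on_subset[OF continuous_on_resolvent[OF T]]) auto
  have holo: "(\<lambda>z. \<psi> (?F z)) holomorphic_on ?U" if \<psi>: "complex_functional \<psi>" for \<psi>
    unfolding complex_functional_scaleC[OF \<psi>]
    by (intro holomorphic_on_mult hU
        holomorphic_on_subset[OF holomorphic_functional_resolvent[OF T \<psi>]]) auto
  have B: "(1 / (2 * of_real pi * \<i>)) *\<^sub>C op_contour_integral \<gamma> ?F = B" if \<gamma>: "encloses_spectrum S T \<gamma>" for \<gamma>
  proof (rule op_eqI_functional)
    fix \<psi> :: "'v op \<Rightarrow> complex" assume \<psi>: "complex_functional \<psi>"
    have "\<psi> (op_contour_integral \<gamma> ?F) = contour_integral \<gamma> (\<lambda>z. \<psi> (?F z))"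
      using \<gamma> by (intro functional_op_contour_integral[OF U cont holo _ _ \<psi>]) (auto simp: encloses_spectrum_def)
    then show "\<psi> ((1 / (2 * of_real pi * \<i>)) *\<^sub>C op_contour_integral \<gamma> ?F) = \<psi> B"
      using val[OF \<gamma> \<psi>] by (simp add: complex_functional_scaleC[OF \<psi>])
  qed
  show ?thesis
    unfolding holomorphic_calculus_def by (rule the_equality) (use ex B in auto)
qed

text \<open>If \<open>B\<close> is the Riesz--Dunford integral over one curve \<open>\<epsilon>\<close> surrounding \<open>\<gamma>\<close>, then the resolvent
  identity gives \<open>h z R(z) - R(z) B = \<integral> h \<zeta> R(\<zeta>) / (\<zeta> - z) d\<zeta> / (2 \<pi> \<i>)\<close>, which extends
  holomorphically across the spectrum.\<close>

lemma riesz_dunford_inner_curve: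
  fixes T B :: "'v op"
  assumes T: "complex_linear T" and S: "convex S" "open S" and h: "h holomorphic_on S"
    and E: "valid_path \<epsilon>" "pathfinish \<epsilon> = pathstart \<epsilon>" "path_image \<epsilon> \<subseteq> S - op_spectrum T"
    and E': "\<And>t. t \<in> {0..1} \<Longrightarrow> cmod (vector_derivative \<epsilon> (at t)) \<le> M"
    and B: "\<And>\<psi>. complex_functional \<psi> \<Longrightarrow>
      contour_integral \<epsilon> (\<lambda>z. h z * \<psi> (resolvent T z)) = 2 * of_real pi * \<i> * \<psi> B"
    and V: "convex V" "open V" "V \<subseteq> S" "V \<inter> path_image \<epsilon> = {}" "\<And>z. z \<in> V \<Longrightarrow> winding_number \<epsilon> z = 1"
    and \<gamma>: "encloses_spectrum S T \<gamma>" "path_image \<gamma> \<subseteq> V"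
    and \<psi>: "complex_functional \<psi>"
  shows "contour_integral \<gamma> (\<lambda>z. h z * \<psi> (resolvent T z)) = 2 * of_real pi * \<i> * \<psi> B"
proof -
  let ?R = "resolvent T" and ?c = "2 * of_real pi * \<i> :: complex"
  interpret \<psi>: bounded_linear \<psi> using \<psi> by (rule complex_functional_bounded_linear)
  have g: "valid_path \<gamma>" "pathfinish \<gamma> = pathstart \<gamma>" "path_image \<gamma> \<subseteq> S - op_spectrum T"
    "\<And>z. z \<in> op_spectrum T \<Longrightarrow> winding_number \<gamma> z = 1"
    using \<gamma> by (auto simp: encloses_spectrum_def)
  have U: "open (S - op_spectrum T)" using S closed_op_spectrum[OF T] by (intro open_Diff)
  have hU: "h holomorphic_on S - op_spectrum T" using h by (rule holomorphic_on_subset) auto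
  have holo: "(\<lambda>z. h z * \<phi> (?R z)) holomorphic_on S - op_spectrum T" if "complex_functional \<phi>" for \<phi>
    by (intro holomorphic_on_mult hU holomorphic_on_subset[OF holomorphic_functional_resolvent[OF T that]]) auto
  define Q where "Q z = contour_integral \<epsilon> (\<lambda>w. h w * \<psi> (?R w) / (w - z))" for z
  have Q_int: "(\<lambda>w. h w * \<psi> (?R w) / (w - z)) contour_integrable_on \<epsilon>" if "z \<in> V" for z
  proof (rule contour_integrable_holomorphic_simple)
    show "(\<lambda>w. h w * \<psi> (?R w) / (w - z)) holomorphic_on (S - op_spectrum T) - {z}"
      by (intro holomorphic_on_divide holomorphic_intros holomorphic_on_subset[OF holo[OF \<psi>]]) auto
  qed (use E U V that in \<open>auto intro: open_delete\<close>)
  have "Q holomorphic_on V"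
  proof -
    \<comment> \<open>\<open>Q\<close> is an integral of Cauchy type, holomorphic off \<epsilon> and
      hence on all of \<open>V\<close>, including spectral points there. The speed bound
      \<open>M\<close> is what differentiation under the integral asks for.\<close>
    have "\<exists>D. (Q has_field_derivative D) (at z)" if z: "z \<in> V" for z
    proof (rule exI, rule Cauchy_next_derivative(2)[where S = V and k = 1 and f' = "\<lambda>w. h w * \<psi> (?R w)"])
      show "continuous_on (path_image \<epsilon>) (\<lambda>w. h w * \<psi> (?R w))"
        using E by (intro holomorphic_on_imp_continuous_on holomorphic_on_subset[OF holo[OF \<psi>]])
      show "((\<lambda>u. h u * \<psi> (?R u) / (u - w) ^ 1) has_contour_integral Q w) \<epsilon>" if "w \<in> V - path_image \<epsilon>" for w
        using Q_int[of w] that unfolding Q_def by (simp add: has_contour_integral_integral)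
    qed (use E E' V z in auto)
    then show ?thesis
      by (auto simp: holomorphic_on_def field_differentiable_def intro: has_field_derivative_at_within)
  qed
  then have Q0: "(Q has_contour_integral 0) \<gamma>"
    using V g \<gamma>(2) by (intro Cauchy_theorem_convex_simple[of Q V]) auto
  \<comment> \<open>As \<open>Q\<close> integrates to 0 over \<gamma>, only this term survives.
    Integrating R(z) over \<gamma> turns it into a multiple of \<psi>(B), with a second factor 2 pi
    i that is divided out at the end.\<close>
  have "((\<lambda>z. ?c * \<psi> (?R z o\<^sub>L B)) has_contour_integral ?c * (?c * \<psi> (id_blinfun o\<^sub>L B))) \<gamma>"
    using g by (intro has_contour_integral_lmul contour_integral_resolvent[OF T complex_functional_compose_left[OF \<psi>]]) auto
  from has_contour_integral_add[OF this Q0]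
  have "((\<lambda>z. ?c * \<psi> (?R z o\<^sub>L B) + Q z) has_contour_integral ?c * (?c * \<psi> B)) \<gamma>"
    by simp
  moreover have "?c * \<psi> (?R z o\<^sub>L B) + Q z = ?c * (h z * \<psi> (?R z))" if z: "z \<in> path_image \<gamma>" for z
  proof -
    have zV: "z \<in> V" and zK: "z \<notin> op_spectrum T" using z \<gamma>(2) g by auto
    have cl: "complex_linear (?R z)" using T zK by (rule complex_linear_resolvent)
    note \<psi>' = complex_functional_compose_right[OF \<psi> cl]
    have "?c * \<psi> (?R z o\<^sub>L B) + Q z = contour_integral \<epsilon> (\<lambda>w. h w * \<psi> (?R z o\<^sub>L ?R w) + h w * \<psi> (?R w) / (w - z))"
      unfolding B[OF \<psi>', symmetric] Q_def
      using E U by (intro contour_integral_add[symmetric] Q_int zV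
        contour_integrable_holomorphic_simple[OF holo[OF \<psi>']]) auto
    also have "\<dots> = contour_integral \<epsilon> (\<lambda>w. \<psi> (?R z) * (h w / (w - z)))"
    proof (rule contour_integral_eq)
      fix w assume w: "w \<in> path_image \<epsilon>"
      then have wz: "w \<noteq> z" and wK: "w \<notin> op_spectrum T" using V zV E by auto
      have "\<psi> (?R z) - \<psi> (?R w) = (w - z) * \<psi> (?R z o\<^sub>L ?R w)"
        using resolvent_identity[OF T zK wK] by (metis \<psi>.diff complex_functional_scaleC[OF \<psi>])
      then have eq: "\<psi> (?R z o\<^sub>L ?R w) = (\<psi> (?R z) - \<psi> (?R w)) / (w - z)"
        using wz by simp
      show "h w * \<psi> (?R z o\<^sub>L ?R w) + h w * \<psi> (?R w) / (w - z) = \<psi> (?R z) * (h w / (w - z))"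
        unfolding eq by (simp add: diff_divide_distrib right_diff_distrib)
    qed
    also have "\<dots> = \<psi> (?R z) * (?c * 1 * h z)"
    proof -
      have "((\<lambda>w. h w / (w - z)) has_contour_integral of_real (2 * pi) * \<i> * winding_number \<epsilon> z * h z) \<epsilon>"
        using E V(3,4) zV
        by (intro Cauchy_integral_formula_convex_simple[OF S(1) h]) (auto simp: S interior_open)
      then show ?thesis
        using V(5)[OF zV] by (intro contour_integral_unique has_contour_integral_lmul) simp
    qed
    finally show ?thesis by (simp add: mult_ac)
  qed
  ultimately have "((\<lambda>z. ?c * (h z * \<psi> (?R z))) has_contour_integral ?c * (?c * \<psi> B)) \<gamma>"
    by (rule has_contour_integral_eq)
  then have "((\<lambda>z. ?c * (h z * \<psi> (?R z)) / ?c) has_contour_integral ?c * (?c * \<psi> B) / ?c) \<gamma>"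
    by (rule has_contour_integral_div)
  then show ?thesis by (simp add: contour_integral_unique)
qed

section \<open>Non-backtracking walks\<close>

locale regular_bidirected_digraph = bidirected_digraph G bar
  for G :: "('v, 'e) pre_digraph" and bar :: "'e \<Rightarrow> 'e" +
  fixes q :: nat
  assumes verts_UNIV: "verts G = UNIV"
    and finite_out: "finite (out_arcs G v)"
    and card_out: "card (out_arcs G v) = q + 1"
begin

primrec walk_end :: "'v \<Rightarrow> 'e list \<Rightarrow> 'v" where
  "walk_end a [] = a"
| "walk_end a (e # p) = walk_end (head G e) p"

text \<open>Walks are indexed by their start alone, so that applying the matrix to f becomes a
  finite sum of values of f at the ends of walks.\<close>

definition nb_walks :: "'v \<Rightarrow> nat \<Rightarrow> 'e list set" where
  "nb_walks a k = {p. awalk a p (walk_end a p) \<and> length p = k \<and> non_backtracking bar p}"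

definition walk_count :: "nat \<Rightarrow> nat" where
  "walk_count k = (if k = 0 then 1 else (q + 1) * q ^ (k - 1))"

lemma cas_iff: "cas a p b \<longleftrightarrow> cas a p (walk_end a p) \<and> walk_end a p = b"
  by (induction p arbitrary: a) auto

lemma awalk_iff: "awalk a p b \<longleftrightarrow> awalk a p (walk_end a p) \<and> walk_end a p = b"
  unfolding awalk_def using cas_iff by blast

lemma non_backtracking_Cons:
  "non_backtracking bar (e # p) \<longleftrightarrow> (p = [] \<or> hd p \<noteq> bar e) \<and> non_backtracking bar p"
  unfolding non_backtracking_def by (cases p) (auto simp: nth_Cons less_Suc_eq_0_disj split: nat.splits)

lemma nb_walks_0 [simp]: "nb_walks a 0 = {[]}"
  by (auto simp: nb_walks_def awalk_def verts_UNIV non_backtracking_def)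

lemma Cons_in_nb_walks:
  "e # p \<in> nb_walks a (Suc k) \<longleftrightarrow>
     e \<in> out_arcs G a \<and> p \<in> nb_walks (head G e) k \<and> (p = [] \<or> hd p \<noteq> bar e)"
  by (auto simp: nb_walks_def awalk_def verts_UNIV non_backtracking_Cons)

lemma nb_walks_Suc_cases:
  assumes "p \<in> nb_walks a (Suc k)"
  obtains e p' where "p = e # p'"
  using assms by (cases p) (auto simp: nb_walks_def)

lemma nb_walks_1: "nb_walks a (Suc 0) = (\<lambda>e. [e]) ` out_arcs G a"
proof (intro set_eqI iffI)
  fix p assume p: "p \<in> nb_walks a (Suc 0)"
  then obtain e p' where "p = e # p'" by (rule nb_walks_Suc_cases)
  with p show "p \<in> (\<lambda>e. [e]) ` out_arcs G a" by (auto simp: Cons_in_nb_walks)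
qed (auto simp: Cons_in_nb_walks)

lemma finite_nb_walks: "finite (nb_walks a k)"
proof (induction k arbitrary: a)
  case (Suc k)
  have "nb_walks a (Suc k) \<subseteq> (\<lambda>(e, p). e # p) ` Sigma (out_arcs G a) (\<lambda>e. nb_walks (head G e) k)"
  proof
    fix p assume p: "p \<in> nb_walks a (Suc k)"
    then obtain e p' where "p = e # p'" by (rule nb_walks_Suc_cases)
    with p show "p \<in> (\<lambda>(e, p). e # p) ` Sigma (out_arcs G a) (\<lambda>e. nb_walks (head G e) k)"
      by (intro image_eqI[of _ _ "(e, p')"]) (auto simp: Cons_in_nb_walks)
  qed
  moreover have "finite (Sigma (out_arcs G a) (\<lambda>e. nb_walks (head G e) k))"
    using Suc finite_out by (intro finite_SigmaI) auto
  ultimately show ?case by (meson finite_imageI finite_subset)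
qed simp

text \<open>Prepending an arc to a non-backtracking walk either extends it or, if that arc is the
  inverse of the first one, undoes its first step.\<close>

lemma sum_nb_walks_step:
  fixes f :: "'v \<Rightarrow> 'a :: comm_semiring_1"
  shows "(\<Sum>e\<in>out_arcs G a. \<Sum>p\<in>nb_walks (head G e) (Suc k). f (walk_end (head G e) p)) =
    (\<Sum>p\<in>nb_walks a (Suc (Suc k)). f (walk_end a p)) +
    of_nat (if k = 0 then q + 1 else q) * (\<Sum>p\<in>nb_walks a k. f (walk_end a p))"
proof -
  let ?A = "Sigma (out_arcs G a) (\<lambda>e. nb_walks (head G e) (Suc k))"
  let ?X = "{x \<in> ?A. hd (snd x) \<noteq> bar (fst x)}" and ?Y = "{x \<in> ?A. hd (snd x) = bar (fst x)}"
  let ?g = "\<lambda>(e, p). f (walk_end (head G e) p)"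
  let ?B = "Sigma (nb_walks a k) (\<lambda>p. {e \<in> out_arcs G a. p = [] \<or> hd p \<noteq> e})"
  have fin: "finite ?A" by (intro finite_SigmaI finite_out finite_nb_walks)
  have "(\<Sum>e\<in>out_arcs G a. \<Sum>p\<in>nb_walks (head G e) (Suc k). f (walk_end (head G e) p)) = sum ?g ?A"
    by (rule sum.Sigma) (auto intro: finite_out finite_nb_walks)
  also have "\<dots> = sum ?g (?X \<union> ?Y)" by (rule arg_cong[where f = "sum ?g"]) auto
  also have "\<dots> = sum ?g ?X + sum ?g ?Y"
    using fin by (intro sum.union_disjoint finite_Collect_conjI finite_subset[OF _ fin]) auto
  also have "sum ?g ?X = (\<Sum>p\<in>nb_walks a (Suc (Suc k)). f (walk_end a p))"
  proof (rule sum.reindex_bij_witness[where j = "\<lambda>(e, p). e # p" and i = "\<lambda>p. (hd p, tl p)"])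
    fix p assume p: "p \<in> nb_walks a (Suc (Suc k))"
    then obtain e p' where "p = e # p'" by (rule nb_walks_Suc_cases)
    then show "(hd p, tl p) \<in> ?X" using p by (auto simp: Cons_in_nb_walks elim!: nb_walks_Suc_cases)
  next
    fix p assume "p \<in> nb_walks a (Suc (Suc k))"
    then show "(case (hd p, tl p) of (e, p) \<Rightarrow> e # p) = p" by (auto elim!: nb_walks_Suc_cases)
  qed (auto simp: Cons_in_nb_walks)
  \<comment> \<open>A cancelling pair has the form (e, bar e # p) with p starting at a again. That
    \<open>bar e # p\<close> does not backtrack says only that p does not start with bar (bar e) =
    e. So e avoids one of the q + 1 arcs at a, or none if p is empty.\<close>
  also have "sum ?g ?Y = sum (\<lambda>(p, e). f (walk_end a p)) ?B"
  proof (rule sum.reindex_bij_witness[where j = "\<lambda>(e, p). (tl p, e)" and i = "\<lambda>(p, e). (e, bar e # p)"])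
    fix x assume x: "x \<in> ?Y"
    obtain e p where ep: "x = (e, p)" by (cases x)
    with x obtain p' where p: "p = bar e # p'" by (auto elim!: nb_walks_Suc_cases)
    have "e \<in> arcs G" using x ep by auto
    with x show "(case x of (e, p) \<Rightarrow> (tl p, e)) \<in> ?B"
      "(case (case x of (e, p) \<Rightarrow> (tl p, e)) of (p, e) \<Rightarrow> (e, bar e # p)) = x"
      "(case (case x of (e, p) \<Rightarrow> (tl p, e)) of (p, e) \<Rightarrow> f (walk_end a p)) = ?g x"
      unfolding ep p by (auto simp: Cons_in_nb_walks)
  qed (auto simp: Cons_in_nb_walks)
  also have "\<dots> = (\<Sum>p\<in>nb_walks a k. \<Sum>e | e \<in> out_arcs G a \<and> (p = [] \<or> hd p \<noteq> e). f (walk_end a p))"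
    by (intro sum.Sigma[symmetric] finite_nb_walks ballI finite_subset[OF _ finite_out[of a]]) auto
  also have "\<dots> = (\<Sum>p\<in>nb_walks a k. of_nat (if k = 0 then q + 1 else q) * f (walk_end a p))"
  proof (rule sum.cong[OF refl])
    fix p assume p: "p \<in> nb_walks a k"
    have "card {e. e \<in> out_arcs G a \<and> (p = [] \<or> hd p \<noteq> e)} = (if k = 0 then q + 1 else q)"
    proof (cases k)
      case 0
      then show ?thesis using p card_out[of a] by (simp add: out_arcs_def)
    next
      case (Suc k')
      with p obtain e p' where e: "p = e # p'" by (auto elim: nb_walks_Suc_cases)
      then have "e \<in> out_arcs G a" using p Suc by (simp add: Cons_in_nb_walks)
      with e have "{e. e \<in> out_arcs G a \<and> (p = [] \<or> hd p \<noteq> e)} = out_arcs G a - {e}" by auto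
      then show ?thesis using Suc \<open>e \<in> out_arcs G a\<close> card_out[of a] by simp
    qed
    then show "(\<Sum>e | e \<in> out_arcs G a \<and> (p = [] \<or> hd p \<noteq> e). f (walk_end a p)) =
        of_nat (if k = 0 then q + 1 else q) * f (walk_end a p)"
      by simp
  qed
  also have "\<dots> = of_nat (if k = 0 then q + 1 else q) * (\<Sum>p\<in>nb_walks a k. f (walk_end a p))"
    by (rule sum_distrib_left[symmetric])
  finally show ?thesis .
qed

text \<open>With f = 1 the step identity becomes a two-term recursion for the counts, which
  \<open>walk_count\<close> solves.\<close>

lemma card_nb_walks: "card (nb_walks a k) = walk_count k"
proof (induction k arbitrary: a rule: less_induct)
  case (less k)
  consider "k = 0" | "k = Suc 0" | l where "k = Suc (Suc l)" by (metis not0_implies_Suc)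
  then show ?case
  proof cases
    case 2
    then show ?thesis by (simp add: nb_walks_1 card_image inj_on_def card_out walk_count_def)
  next
    case 3
    have "(q + 1) * walk_count (Suc l) = card (nb_walks a k) + (if l = 0 then q + 1 else q) * walk_count l"
      using sum_nb_walks_step[where f = "\<lambda>_. 1 :: nat" and a = a and k = l] less[of "Suc l"] less[of l] 3
      by (simp add: card_out)
    moreover have "(q + 1) * walk_count (Suc l) = walk_count k + (if l = 0 then q + 1 else q) * walk_count l"
      using 3 by (cases l) (simp_all add: walk_count_def algebra_simps)
    ultimately show ?thesis by simp
  qed (simp add: walk_count_def)
qed

section \<open>Reversal of walks and column sums\<close>

lemma cas_snoc: "cas a (p @ [e]) b \<longleftrightarrow> cas a p (tail G e) \<and> head G e = b"
  by (induction p arbitrary: a) auto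

lemma cas_rev: "set p \<subseteq> arcs G \<Longrightarrow> cas a p b \<Longrightarrow> cas b (rev (map bar p)) a"
  by (induction p arbitrary: a) (auto simp: cas_snoc simp del: cas_append_iff)

text \<open>Consecutive arcs e, e' turn into bar e', bar e, and the new condition that bar e differs
  from bar (bar e') = e' is the old one.\<close>

lemma non_backtracking_rev:
  assumes "set p \<subseteq> arcs G" "non_backtracking bar p"
  shows "non_backtracking bar (rev (map bar p))"
proof -
  have *: "non_backtracking bar p \<longleftrightarrow> successively (\<lambda>e e'. e' \<noteq> bar e) p" for p
    by (simp add: non_backtracking_def successively_conv_nth)
  show ?thesis
    using assms(2) unfolding * successively_rev successively_map
    by (rule successively_mono) auto
qed

lemma rev_nb_walk:
  assumes "p \<in> nb_walks a k"
  shows "rev (map bar p) \<in> nb_walks (walk_end a p) k" "walk_end (walk_end a p) (rev (map bar p)) = a"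
proof -
  have p: "set p \<subseteq> arcs G" "cas a p (walk_end a p)" "length p = k" "non_backtracking bar p"
    using assms by (auto simp: nb_walks_def awalk_def)
  have *: "cas (walk_end a p) (rev (map bar p)) a" using p by (intro cas_rev)
  then show "walk_end (walk_end a p) (rev (map bar p)) = a"
    by (subst (asm) cas_iff) simp
  with * show "rev (map bar p) \<in> nb_walks (walk_end a p) k"
    using p non_backtracking_rev by (auto simp: nb_walks_def awalk_def verts_UNIV)
qed

text \<open>Reversal sends the walks that end at b injectively to walks that start at b, so columns
  are bounded by the row count. The starting point is recovered as the end of the reversed
  walk.\<close>

lemma card_nb_walks_into:
  "card {x \<in> Sigma F (\<lambda>a. nb_walks a k). walk_end (fst x) (snd x) = b} \<le> walk_count k" (is "card ?W \<le> _")
proof -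
  have "inj_on (\<lambda>x. rev (map bar (snd x))) ?W"
  proof (rule inj_onI)
    fix x y assume x: "x \<in> ?W" and y: "y \<in> ?W" and e: "rev (map bar (snd x)) = rev (map bar (snd y))"
    have "inj bar" using bij_arev by (rule bij_is_inj)
    then have "snd x = snd y" using e by simp
    moreover have "walk_end b (rev (map bar (snd x))) = fst x"
      using x rev_nb_walk(2)[of "snd x" "fst x" k] by auto
    moreover have "walk_end b (rev (map bar (snd y))) = fst y"
      using y rev_nb_walk(2)[of "snd y" "fst y" k] by auto
    ultimately show "x = y" by (simp add: prod_eq_iff)
  qed
  then have "card ?W \<le> card (nb_walks b k)"
    by (rule card_inj_on_le) (auto intro: rev_nb_walk finite_nb_walks)
  then show ?thesis by (simp add: card_nb_walks)
qed

section \<open>The non-backtracking operators\<close>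

lemma nb_matrix_eq: "nb_matrix G bar k a b = card {p \<in> nb_walks a k. walk_end a p = b}"
proof -
  have "{p. awalk a p b \<and> length p = k \<and> non_backtracking bar p} = {p \<in> nb_walks a k. walk_end a p = b}"
    by (subst awalk_iff) (auto simp: nb_walks_def)
  then show ?thesis by (simp add: nb_matrix_def)
qed

lemma infsum_nb_matrix:
  fixes f :: "'v \<Rightarrow> complex"
  shows "(\<Sum>\<^sub>\<infinity>b. of_nat (nb_matrix G bar k a b) * f b) = (\<Sum>p\<in>nb_walks a k. f (walk_end a p))"
proof -
  have "(\<Sum>\<^sub>\<infinity>b. of_nat (nb_matrix G bar k a b) * f b) =
      (\<Sum>\<^sub>\<infinity>b\<in>walk_end a ` nb_walks a k. of_nat (nb_matrix G bar k a b) * f b)"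
    by (rule infsum_cong_neutral) (auto simp: nb_matrix_eq card_eq_0_iff)
  also have "\<dots> = (\<Sum>b\<in>walk_end a ` nb_walks a k. of_nat (nb_matrix G bar k a b) * f b)"
    by (simp add: finite_nb_walks)
  also have "\<dots> = (\<Sum>b\<in>walk_end a ` nb_walks a k. \<Sum>p | p \<in> nb_walks a k \<and> walk_end a p = b. f (walk_end a p))"
    by (rule sum.cong[OF refl]) (simp add: nb_matrix_eq)
  also have "\<dots> = (\<Sum>p\<in>nb_walks a k. f (walk_end a p))"
    by (rule sum.image_gen[OF finite_nb_walks, symmetric])
  finally show ?thesis .
qed

text \<open>Schur's test: both the rows and the columns of the matrix have sum \<open>walk_count k\<close>.\<close>

lemma nb_walks_square_sum:
  assumes F: "finite F"
  shows "(\<Sum>a\<in>F. (cmod (\<Sum>p\<in>nb_walks a k. ell2_apply f (walk_end a p)))\<^sup>2) \<le> (real (walk_count k) * norm f)\<^sup>2"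
proof -
  let ?c = "real (walk_count k)" and ?S = "Sigma F (\<lambda>a. nb_walks a k)"
  let ?e = "\<lambda>(a, p). walk_end a p" and ?g = "\<lambda>b. (cmod (ell2_apply f b))\<^sup>2"
  have fin: "finite ?S" by (intro finite_SigmaI F finite_nb_walks)
  have "(\<Sum>x\<in>?S. ?g (?e x)) = (\<Sum>b\<in>?e ` ?S. \<Sum>x | x \<in> ?S \<and> ?e x = b. ?g (?e x))"
    by (rule sum.image_gen[OF fin])
  also have "\<dots> \<le> (\<Sum>b\<in>?e ` ?S. ?c * ?g b)"
  proof (rule sum_mono)
    fix b
    have "(\<Sum>x | x \<in> ?S \<and> ?e x = b. ?g (?e x)) = real (card {x \<in> ?S. ?e x = b}) * ?g b"
      by simp
    also have "\<dots> \<le> ?c * ?g b"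
      using card_nb_walks_into[of F k b]
      by (intro mult_right_mono of_nat_mono) (simp_all add: split_def)
    finally show "(\<Sum>x | x \<in> ?S \<and> ?e x = b. ?g (?e x)) \<le> ?c * ?g b" .
  qed
  also have "\<dots> \<le> ?c * (norm f)\<^sup>2"
    unfolding sum_distrib_left[symmetric]
    by (intro mult_left_mono finite_sum_le_norm_ell2 finite_imageI fin) auto
  finally have into: "(\<Sum>x\<in>?S. ?g (?e x)) \<le> ?c * (norm f)\<^sup>2" .
  have "(\<Sum>a\<in>F. (cmod (\<Sum>p\<in>nb_walks a k. ell2_apply f (walk_end a p)))\<^sup>2)
      \<le> (\<Sum>a\<in>F. ?c * (\<Sum>p\<in>nb_walks a k. ?g (walk_end a p)))"
  proof (rule sum_mono)
    fix a
    \<comment> \<open>Cauchy-Schwarz over the \<open>walk_count k\<close> walks from a yields one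
      factor; \<open>into\<close> yields the other, as each b is the end of at most
      \<open>walk_count k\<close> walks.\<close>
    have "(cmod (\<Sum>p\<in>nb_walks a k. ell2_apply f (walk_end a p)))\<^sup>2
        \<le> (\<Sum>p\<in>nb_walks a k. cmod (ell2_apply f (walk_end a p)))\<^sup>2"
      by (intro power_mono norm_sum) simp
    also have "\<dots> \<le> ?c * (\<Sum>p\<in>nb_walks a k. ?g (walk_end a p))"
      using sum_squared_le_sum_of_squares[of "\<lambda>p. cmod (ell2_apply f (walk_end a p))" "nb_walks a k"]
      by (simp add: card_nb_walks mult.commute)
    finally show "(cmod (\<Sum>p\<in>nb_walks a k. ell2_apply f (walk_end a p)))\<^sup>2
        \<le> ?c * (\<Sum>p\<in>nb_walks a k. ?g (walk_end a p))" .
  qed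
  also have "\<dots> = ?c * (\<Sum>x\<in>?S. ?g (?e x))"
    unfolding sum_distrib_left[symmetric]
    by (subst sum.Sigma) (auto simp: F finite_nb_walks split_def)
  also have "\<dots> \<le> ?c * (?c * (norm f)\<^sup>2)"
    by (intro mult_left_mono into) simp
  finally show ?thesis
    by (simp add: power2_eq_square mult_ac)
qed

lemma bounded_linear_nb:
  "bounded_linear (\<lambda>f. Abs_ell2 (\<lambda>a. \<Sum>p\<in>nb_walks a k. ell2_apply f (walk_end a p)))" (is "bounded_linear ?A")
  and norm_nb_le: "norm (Abs_ell2 (\<lambda>a. \<Sum>p\<in>nb_walks a k. ell2_apply f (walk_end a p))) \<le> norm f * real (walk_count k)"
  and ell2_apply_nb: "ell2_apply (Abs_ell2 (\<lambda>a. \<Sum>p\<in>nb_walks a k. ell2_apply f (walk_end a p))) a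
    = (\<Sum>p\<in>nb_walks a k. ell2_apply f (walk_end a p))"
proof -
  show norm: "norm (?A f) \<le> norm f * real (walk_count k)" for f
    by (rule ell2_of_finite_sums(2)) (use nb_walks_square_sum[where k = k and f = f] in \<open>auto simp: mult.commute\<close>)
  have "(\<lambda>a. (cmod (\<Sum>p\<in>nb_walks a k. ell2_apply f (walk_end a p)))\<^sup>2) summable_on UNIV" for f
    by (rule ell2_of_finite_sums(1)[where e = "real (walk_count k) * norm f"])
      (use nb_walks_square_sum[where k = k and f = f] in auto)
  then show ap: "ell2_apply (?A f) a = (\<Sum>p\<in>nb_walks a k. ell2_apply f (walk_end a p))" for f a
    by (subst Abs_ell2_inverse) auto
  show "bounded_linear ?A"
  proof (rule bounded_linear_intro[OF _ _ norm])
    show "?A (f + g) = ?A f + ?A g" for f g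
      by (rule ell2_eqI, simp only: ap, simp add: ap plus_ell2.rep_eq sum.distrib)
    show "?A (r *\<^sub>R f) = r *\<^sub>R ?A f" for r f
      by (rule ell2_eqI, simp only: ap, simp add: ap scaleR_ell2.rep_eq sum_distrib_left)
  qed
qed

lemma nb_op_eq: "blinfun_apply (nb_op G bar k) f = Abs_ell2 (\<lambda>a. \<Sum>p\<in>nb_walks a k. ell2_apply f (walk_end a p))"
  unfolding nb_op_def matrix_op_def infsum_nb_matrix
  by (simp add: bounded_linear_Blinfun_apply bounded_linear_nb)

lemma nb_op_apply: "ell2_apply (nb_op G bar k f) a = (\<Sum>p\<in>nb_walks a k. ell2_apply f (walk_end a p))"
  by (simp add: nb_op_eq ell2_apply_nb)

lemma norm_nb_op: "norm (nb_op G bar k) \<le> real (walk_count k)"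
  by (rule norm_blinfun_bound) (use norm_nb_le in \<open>simp_all add: nb_op_eq mult.commute\<close>)

lemma complex_linear_nb_op: "complex_linear (nb_op G bar k)"
  unfolding complex_linear_def
  by (auto intro!: ell2_eqI simp: nb_op_apply scaleC_ell2.rep_eq sum_distrib_left)

lemma nb_op_0: "nb_op G bar 0 = id_blinfun"
  by (rule blinfun_eqI, rule ell2_eqI) (simp add: nb_op_apply)

lemma nb_op_1_apply: "ell2_apply (nb_op G bar (Suc 0) f) a = (\<Sum>e\<in>out_arcs G a. ell2_apply f (head G e))"
  by (simp add: nb_op_apply nb_walks_1 sum.reindex inj_on_def)

lemma nb_op_step:
  "nb_op G bar (Suc 0) o\<^sub>L nb_op G bar (Suc k) =
     nb_op G bar (Suc (Suc k)) + real (if k = 0 then q + 1 else q) *\<^sub>R nb_op G bar k"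
  by (rule blinfun_eqI, rule ell2_eqI)
    (simp add: nb_op_1_apply nb_op_apply[where k = k] nb_op_apply[where k = "Suc k"]
      nb_op_apply[where k = "Suc (Suc k)"] sum_nb_walks_step plus_ell2.rep_eq scaleR_ell2.rep_eq
      blinfun.add_left blinfun.scaleR_left del: of_nat_add)

lemma adjacency_op_eq: "adjacency_op G = nb_op G bar (Suc 0)"
proof -
  have "adjacency_matrix G a b = nb_matrix G bar (Suc 0) a b" for a b
  proof -
    have "{p \<in> nb_walks a (Suc 0). walk_end a p = b} = (\<lambda>e. [e]) ` {e \<in> arcs G. tail G e = a \<and> head G e = b}"
      by (auto simp: nb_walks_1)
    then show ?thesis
      unfolding nb_matrix_eq adjacency_matrix_def by (simp add: card_image inj_on_def)
  qed
  then show ?thesis by (simp add: adjacency_op_def nb_op_def)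
qed

end

lemma regular_graph_imp_locale:
  assumes "verts G = UNIV" "regular_graph (q + 1) G bar"
  shows "regular_bidirected_digraph G bar q"
  using assms unfolding regular_graph_def regular_bidirected_digraph_def
    regular_bidirected_digraph_axioms_def out_degree_def by auto

section \<open>The Joukowski map\<close>

definition joukowski :: "complex \<Rightarrow> complex" where
  "joukowski w = w + inverse w"

lemma joukowski_inverse [simp]: "joukowski (inverse w) = joukowski w"
  by (simp add: joukowski_def add.commute)

text \<open>The two roots of w^2 - z w + 1 have product 1, so one of them has modulus at least
  1.\<close>

lemma joukowski_surj:
  obtains w where "cmod w \<ge> 1" "z = joukowski w"
proof -
  define w where "w = (z + csqrt (z\<^sup>2 - 4)) / 2"
  have "w\<^sup>2 - z * w + 1 = ((csqrt (z\<^sup>2 - 4))\<^sup>2 - z\<^sup>2 + 4) / 4"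
    unfolding w_def by (simp add: power2_eq_square field_simps)
  then have eq: "w\<^sup>2 - z * w + 1 = 0" by simp
  then have w0: "w \<noteq> 0" by auto
  then have z: "z = joukowski w"
    using eq by (simp add: joukowski_def field_simps power2_eq_square)
  show thesis
  proof (cases "cmod w \<ge> 1")
    case True
    then show ?thesis using that z by blast
  next
    case False
    then have "cmod (inverse w) \<ge> 1"
      using w0 by (simp add: norm_inverse one_le_inverse)
    then show ?thesis using that[of "inverse w"] z by simp
  qed
qed

lemma holomorphic_joukowski: "joukowski holomorphic_on - {0}"
  unfolding joukowski_def by (intro holomorphic_intros) auto

lemma analytic_joukowski: "joukowski analytic_on - {0}"
  using holomorphic_joukowski by (simp add: analytic_on_open open_Compl)

lemma has_field_derivative_joukowski:
  assumes "w \<noteq> 0"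
  shows "(joukowski has_field_derivative 1 - inverse w ^ 2) (at w)"
proof -
  have "(joukowski has_field_derivative 1 + - (inverse w * 1 * inverse w)) (at w)"
    unfolding joukowski_def[abs_def] using assms by (intro derivative_intros)
  then show ?thesis by (simp add: power2_eq_square)
qed

section \<open>Ellipses as images of annuli\<close>

lemma ellipse_region_vimage:
  assumes "\<rho> > 1"
  shows "ellipse_region \<rho> = (\<lambda>w. Complex (Re w / (\<rho> + 1 / \<rho>)) (Im w / (\<rho> - 1 / \<rho>))) -` ball 0 1"
  by (auto simp: ellipse_region_def cmod_def power_divide)

lemma open_ellipse_region: "\<rho> > 1 \<Longrightarrow> open (ellipse_region \<rho>)"
proof -
  assume \<rho>: "\<rho> > 1"
  then have "0 < 1 / \<rho>" "1 / \<rho> < 1" by auto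
  then have "\<rho> + 1 / \<rho> \<noteq> 0" "\<rho> - 1 / \<rho> \<noteq> 0" using \<rho> by linarith+
  then show ?thesis
    unfolding ellipse_region_def by (intro open_Collect_less continuous_intros) auto
qed

lemma convex_ellipse_region:
  assumes "\<rho> > 1"
  shows "convex (ellipse_region \<rho>)"
proof -
  have "linear (\<lambda>w. Complex (Re w / (\<rho> + 1 / \<rho>)) (Im w / (\<rho> - 1 / \<rho>)))"
    by (rule linearI) (simp_all add: complex_eq_iff add_divide_distrib)
  then show ?thesis
    unfolding ellipse_region_vimage[OF assms] by (rule convex_linear_vimage) simp
qed

text \<open>In polar form the real and imaginary parts of w + 1 / w are cos \<theta> (s + 1 / s) and
  sin \<theta> (s - 1 / s). Since (x - 1 / x)^2 = (x + 1 / x)^2 - 4, the defining form of the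
  ellipse is a convex combination of A / B and (A - 4) / (B - 4), and both are below 1 exactly when
  A < B. So membership depends only on the modulus of w.\<close>

lemma joukowski_ellipse_form:
  assumes w: "w \<noteq> 0" and \<rho>: "\<rho> > 1"
  defines "A \<equiv> (cmod w + 1 / cmod w)\<^sup>2" and "B \<equiv> (\<rho> + 1 / \<rho>)\<^sup>2"
  shows "(Re (joukowski w))\<^sup>2 / (\<rho> + 1 / \<rho>)\<^sup>2 + (Im (joukowski w))\<^sup>2 / (\<rho> - 1 / \<rho>)\<^sup>2
      = (Re w / cmod w)\<^sup>2 * (A / B) + (Im w / cmod w)\<^sup>2 * ((A - 4) / (B - 4))"
    and "(Re w / cmod w)\<^sup>2 + (Im w / cmod w)\<^sup>2 = 1" and "A \<ge> 4" "B > 4"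
proof -
  let ?s = "cmod w"
  have s: "?s > 0" using w by simp
  have s2: "?s\<^sup>2 = (Re w)\<^sup>2 + (Im w)\<^sup>2" by (rule cmod_power2)
  have split: "x / ?s * (?s + 1 / ?s) = x + x / ?s\<^sup>2" "x / ?s * (?s - 1 / ?s) = x - x / ?s\<^sup>2" for x
    using s by (simp_all add: field_simps power2_eq_square)
  have re: "Re (joukowski w) = Re w / ?s * (?s + 1 / ?s)" and im: "Im (joukowski w) = Im w / ?s * (?s - 1 / ?s)"
    unfolding split by (simp_all add: joukowski_def s2)
  have sq: "(x - 1 / x)\<^sup>2 = (x + 1 / x)\<^sup>2 - 4" if "x > 0" for x :: real
    using that by (simp add: power2_eq_square field_simps)
  show "(Re (joukowski w))\<^sup>2 / (\<rho> + 1 / \<rho>)\<^sup>2 + (Im (joukowski w))\<^sup>2 / (\<rho> - 1 / \<rho>)\<^sup>2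
      = (Re w / cmod w)\<^sup>2 * (A / B) + (Im w / cmod w)\<^sup>2 * ((A - 4) / (B - 4))"
    unfolding re im power_mult_distrib A_def B_def using sq[OF s] sq[of \<rho>] \<rho> by simp
  show "(Re w / ?s)\<^sup>2 + (Im w / ?s)\<^sup>2 = 1"
    using s by (simp add: power_divide add_divide_distrib[symmetric] s2[symmetric])
  show "A \<ge> 4" unfolding A_def using sq[OF s] zero_le_power2[of "?s - 1 / ?s"] by linarith
  have "1 / \<rho> < \<rho>" using \<rho> by (simp add: field_simps) (simp add: less_1_mult)
  then have "(\<rho> - 1 / \<rho>)\<^sup>2 > 0" by simp
  then show "B > 4" unfolding B_def using sq[of \<rho>] \<rho> by simp
qed

lemma add_inverse_strict_mono:
  fixes s t :: real
  assumes "1 \<le> s" "s < t"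
  shows "s + 1 / s < t + 1 / t"
proof -
  have "s * t > 1" using assms by (metis less_1_mult mult.left_neutral less_le order_less_le_trans)
  then have "0 < (t - s) * (1 - 1 / (s * t))" using assms by (intro mult_pos_pos) auto
  also have "\<dots> = t + 1 / t - (s + 1 / s)" using assms by (simp add: field_simps)
  finally show ?thesis by simp
qed

lemma joukowski_in_ellipse_iff:
  assumes w: "cmod w \<ge> 1" and \<rho>: "\<rho> > 1"
  shows "joukowski w \<in> ellipse_region \<rho> \<longleftrightarrow> cmod w < \<rho>"
proof -
  have w0: "w \<noteq> 0" using w by auto
  define A where "A = (cmod w + 1 / cmod w)\<^sup>2"
  define B where "B = (\<rho> + 1 / \<rho>)\<^sup>2"
  define c where "c = (Re w / cmod w)\<^sup>2"
  define d where "d = (Im w / cmod w)\<^sup>2"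
  note form = joukowski_ellipse_form[OF w0 \<rho>, folded A_def B_def, folded c_def d_def]
  have nn: "c \<ge> 0" "d \<ge> 0" by (simp_all add: c_def d_def)
  have iff: "joukowski w \<in> ellipse_region \<rho> \<longleftrightarrow> c * (A / B) + d * ((A - 4) / (B - 4)) < 1"
    using form(1) unfolding ellipse_region_def B_def by simp
  show ?thesis
  proof (cases "cmod w < \<rho>")
    case True
    then have "A < B" unfolding A_def B_def
      using add_inverse_strict_mono[OF w True] by (intro power_strict_mono) auto
    define m where "m = max (A / B) ((A - 4) / (B - 4))"
    have "m < 1" using \<open>A < B\<close> form by (simp add: m_def)
    have "c * (A / B) + d * ((A - 4) / (B - 4)) \<le> c * m + d * m"
      using nn by (intro add_mono mult_left_mono) (auto simp: m_def)
    also have "\<dots> = m" using form(2) by (simp add: distrib_right[symmetric])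
    finally show ?thesis using iff True \<open>m < 1\<close> by linarith
  next
    case False
    then have "\<rho> + 1 / \<rho> \<le> cmod w + 1 / cmod w"
      using add_inverse_strict_mono[of \<rho> "cmod w"] \<rho> by (cases "\<rho> = cmod w") auto
    then have "A \<ge> B" unfolding A_def B_def using \<rho> by (intro power_mono) auto
    then have "1 \<le> A / B" "1 \<le> (A - 4) / (B - 4)" using form by auto
    then have "c * 1 + d * 1 \<le> c * (A / B) + d * ((A - 4) / (B - 4))"
      using nn by (intro add_mono mult_left_mono)
    then show ?thesis using form(2) iff False by simp
  qed
qed

lemma ellipse_regionE:
  assumes "z \<in> ellipse_region \<rho>" "\<rho> > 1"
  obtains w where "1 \<le> cmod w" "cmod w < \<rho>" "z = joukowski w"
  using joukowski_surj[of z] joukowski_in_ellipse_iff assms by metis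

lemma ellipse_region_mono:
  assumes "1 < r" "r \<le> \<rho>"
  shows "ellipse_region r \<subseteq> ellipse_region \<rho>"
proof
  fix z assume "z \<in> ellipse_region r"
  then obtain w where "1 \<le> cmod w" "cmod w < r" "z = joukowski w"
    using assms by (auto elim: ellipse_regionE)
  then show "z \<in> ellipse_region \<rho>" using assms joukowski_in_ellipse_iff[of w \<rho>] by simp
qed

text \<open>The open ellipses increase with their parameter and exhaust the large one. Applied with
  s = sqrt q, the lower bound keeps the chosen ellipse around the spectrum.\<close>

lemma compact_subset_smaller_ellipse:
  assumes K: "compact K" "K \<subseteq> ellipse_region \<rho>" and s: "1 \<le> s" "s < \<rho>"
  obtains r where "s < r" "r < \<rho>" "K \<subseteq> ellipse_region r"
proof -
  have \<rho>: "\<rho> > 1" using s by simp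
  have "K \<subseteq> (\<Union>r\<in>{s<..<\<rho>}. ellipse_region r)"
  proof
    fix z assume "z \<in> K"
    then obtain w where w: "1 \<le> cmod w" "cmod w < \<rho>" "z = joukowski w"
      using K \<rho> by (auto elim: ellipse_regionE)
    obtain r where r: "max s (cmod w) < r" "r < \<rho>" using dense[of "max s (cmod w)" \<rho>] s w by auto
    then have "z \<in> ellipse_region r" using w s joukowski_in_ellipse_iff[of w r] by simp
    then show "z \<in> (\<Union>r\<in>{s<..<\<rho>}. ellipse_region r)" using r by auto
  qed
  moreover have "open (ellipse_region r)" if "r \<in> {s<..<\<rho>}" for r
    using that s by (intro open_ellipse_region) simp
  ultimately obtain C where C: "C \<subseteq> {s<..<\<rho>}" "finite C" "K \<subseteq> (\<Union>r\<in>C. ellipse_region r)"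
    using compactE_image[OF K(1), of "{s<..<\<rho>}" ellipse_region] by metis
  \<comment> \<open>\<open>r0\<close> keeps the maximum defined when the subcover is empty.\<close>
  obtain r0 where r0: "s < r0" "r0 < \<rho>" using dense s by blast
  define r where "r = Max (insert r0 C)"
  have r: "r \<in> insert r0 C" unfolding r_def using C by (intro Max_in) auto
  have "K \<subseteq> ellipse_region r"
  proof
    fix z assume "z \<in> K"
    then obtain r' where r': "r' \<in> C" "z \<in> ellipse_region r'" using C by auto
    then have "r' \<le> r" unfolding r_def using C by (intro Max_ge) auto
    then show "z \<in> ellipse_region r" using ellipse_region_mono[of r' r] r' C s by fastforce
  qed
  then show thesis using that[of r] r C r0 by auto
qed

section \<open>Ellipses as contours\<close>

definition ellipse_path :: "real \<Rightarrow> real \<Rightarrow> complex" where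
  "ellipse_path r = joukowski \<circ> circlepath 0 r"

lemma path_image_ellipse_path: "r > 0 \<Longrightarrow> path_image (ellipse_path r) = joukowski ` sphere 0 r"
  by (simp add: ellipse_path_def path_image_compose)

lemma circlepath_avoids_0: "r > 0 \<Longrightarrow> path_image (circlepath 0 r) \<subseteq> - {0}"
  by auto

lemma valid_ellipse_path: "r > 0 \<Longrightarrow> valid_path (ellipse_path r)"
  unfolding ellipse_path_def
  by (rule valid_path_compose_holomorphic[OF _ holomorphic_joukowski _ circlepath_avoids_0])
    (auto simp: open_Compl)

lemma loop_ellipse_path: "pathfinish (ellipse_path r) = pathstart (ellipse_path r)"
  by (simp add: ellipse_path_def pathfinish_compose pathstart_compose)

lemma contour_integral_ellipse_path:
  assumes "r > 0"
  shows "contour_integral (ellipse_path r) g =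
    contour_integral (circlepath 0 r) (\<lambda>w. (1 - inverse w ^ 2) * g (joukowski w))"
proof -
  have "contour_integral (ellipse_path r) g =
      contour_integral (circlepath 0 r) (\<lambda>w. deriv joukowski w * g (joukowski w))"
    unfolding ellipse_path_def
    by (rule contour_integral_comp_analyticW[OF analytic_joukowski valid_path_circlepath circlepath_avoids_0[OF assms]])
  also have "\<dots> = contour_integral (circlepath 0 r) (\<lambda>w. (1 - inverse w ^ 2) * g (joukowski w))"
    using assms by (intro contour_integral_eq) (auto simp: DERIV_imp_deriv[OF has_field_derivative_joukowski])
  finally show ?thesis .
qed

text \<open>This supplies the speed bound that \<open>riesz_dunford_inner_curve\<close> asks of the
  outer curve.\<close>

lemma vector_derivative_ellipse_path_le:
  assumes "r > 0"
  shows "cmod (vector_derivative (ellipse_path r) (at t)) \<le> 2 * pi * r * (1 + inverse r ^ 2)"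
proof -
  let ?w = "circlepath 0 r t"
  have nw: "cmod ?w = r" using assms by (simp add: circlepath norm_mult norm_exp_eq_Re)
  then have w: "?w \<noteq> 0" using assms by auto
  have "(ellipse_path r has_vector_derivative (2 * pi * \<i> * r * exp (2 * of_real pi * \<i> * t)) * (1 - inverse ?w ^ 2)) (at t)"
    unfolding ellipse_path_def
    by (rule field_vector_diff_chain_at[OF has_vector_derivative_circlepath has_field_derivative_joukowski[OF w]])
  then have "vector_derivative (ellipse_path r) (at t) = (2 * pi * \<i> * r * exp (2 * of_real pi * \<i> * t)) * (1 - inverse ?w ^ 2)"
    by (rule vector_derivative_at)
  then have "cmod (vector_derivative (ellipse_path r) (at t)) = 2 * pi * r * cmod (1 - inverse ?w ^ 2)"
    using assms by (simp add: norm_mult)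
  also have "\<dots> \<le> 2 * pi * r * (1 + inverse r ^ 2)"
    using norm_triangle_ineq4[of 1 "inverse ?w ^ 2"] assms nw
    by (intro mult_left_mono) (auto simp: norm_power norm_inverse)
  finally show ?thesis .
qed

text \<open>Pulled back to the circle, dz / (z - z0) splits into the forms with poles at v and 1 / v
  minus the one with pole at 0. The points 1 / v and 0 lie inside and cancel, which leaves the
  winding number of the circle around v.\<close>

lemma winding_number_ellipse_path:
  assumes r: "r > 1" and v: "cmod v \<ge> 1" "cmod v \<noteq> r"
  shows "winding_number (ellipse_path r) (joukowski v) = (if cmod v < r then 1 else 0)"
proof -
  let ?C = "circlepath 0 r"
  have v0: "v \<noteq> 0" using v by auto
  have iv: "cmod (inverse v) < r" using v r by (simp add: norm_inverse) (meson inverse_le_1_iff le_less_trans)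
  have jdiff: "joukowski w - joukowski v = (w - v) * (w - inverse v) / w" if "w \<noteq> 0" for w
    using that v0 by (simp add: joukowski_def field_simps)
  have partial_fractions: "(1 - inverse w ^ 2) * (1 / ((w - x) * (w - y) / w)) = 1 / (w - x) + 1 / (w - y) - 1 / w"
    if "x * y = 1" "w \<noteq> x" "w \<noteq> y" "w \<noteq> 0" for x y w :: complex
  proof -
    have "1 / (w - x) + 1 / (w - y) - 1 / w = (w\<^sup>2 - x * y) / (w * ((w - x) * (w - y)))"
      using that(2-4) by (simp add: divide_simps power2_eq_square) (simp add: algebra_simps)
    also have "\<dots> = (1 - inverse w ^ 2) * (1 / ((w - x) * (w - y) / w))"
      unfolding that(1) using that(2-4) by (simp add: divide_simps power2_eq_square)
    finally show ?thesis ..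
  qed
  have ne: "w \<noteq> v" "w \<noteq> inverse v" "w \<noteq> 0" if "w \<in> path_image ?C" for w
    using that v iv r by auto
  have notin: "joukowski v \<notin> path_image (ellipse_path r)"
  proof
    assume "joukowski v \<in> path_image (ellipse_path r)"
    then obtain w where "w \<in> path_image ?C" "joukowski w = joukowski v"
      using r by (auto simp: path_image_ellipse_path)
    then show False using jdiff[of w] ne[of w] by simp
  qed
  have hci: "((\<lambda>w. 1 / (w - x)) has_contour_integral 2 * of_real pi * \<i> * winding_number ?C x) ?C"
    if "x \<notin> path_image ?C" for x
    using has_contour_integral_winding_number[OF valid_path_circlepath that] by simp
  have in_C: "v \<notin> path_image ?C" "inverse v \<notin> path_image ?C" "0 \<notin> path_image ?C"
    using ne by blast+
  have inside: "winding_number ?C x = 1" if "cmod x < r" for x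
    using that by (intro winding_number_circlepath) simp
  have wv: "winding_number ?C v = (if cmod v < r then 1 else 0)"
  proof (cases "cmod v < r")
    case False
    then have "winding_number ?C v = 0"
      using v r by (intro winding_number_zero_outside[of _ "cball 0 r"]) auto
    then show ?thesis using False by simp
  qed (simp add: inside)
  have "2 * of_real pi * \<i> * winding_number (ellipse_path r) (joukowski v)
      = contour_integral (ellipse_path r) (\<lambda>z. 1 / (z - joukowski v))"
    using winding_number_valid_path[OF valid_ellipse_path notin] r by simp
  also have "\<dots> = contour_integral ?C (\<lambda>w. (1 - inverse w ^ 2) * (1 / (joukowski w - joukowski v)))"
    using r by (intro contour_integral_ellipse_path) simp
  also have "\<dots> = contour_integral ?C (\<lambda>w. 1 / (w - v) + 1 / (w - inverse v) - 1 / (w - 0))"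
  proof (rule contour_integral_eq)
    fix w assume "w \<in> path_image ?C"
    note n = ne[OF this]
    show "(1 - inverse w ^ 2) * (1 / (joukowski w - joukowski v)) = 1 / (w - v) + 1 / (w - inverse v) - 1 / (w - 0)"
      unfolding jdiff[OF n(3)] using partial_fractions[of v "inverse v" w] n v0 by simp
  qed
  also have "\<dots> = 2 * of_real pi * \<i> * winding_number ?C v + 2 * of_real pi * \<i> * winding_number ?C (inverse v)
      - 2 * of_real pi * \<i> * winding_number ?C 0"
    by (intro contour_integral_unique has_contour_integral_diff has_contour_integral_add hci in_C)
  also have "\<dots> = 2 * of_real pi * \<i> * (if cmod v < r then 1 else 0)"
    using inside[OF iv] inside[of 0] r wv by simp
  finally show ?thesis by simp
qed

section \<open>The resolvent of the adjacency operator\<close>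

locale nontrivial_regular_digraph = regular_bidirected_digraph +
  assumes q_pos: "q \<ge> 1"
begin

definition T :: "'a op" where "T = (1 / sqrt (real q)) *\<^sub>R nb_op G bar (Suc 0)"

text \<open>With this scaling \<open>Y k\<close> is the polynomial X_{k,q} evaluated at
  \<open>T\<close>: \<open>T_Y\<close> is the recursion of the polynomials, with the same
  start.\<close>

definition Y :: "nat \<Rightarrow> 'a op" where "Y k = (1 / sqrt (real q)) ^ k *\<^sub>R nb_op G bar k"

lemma complex_linear_T: "complex_linear T"
  unfolding T_def by (intro complex_linear_scaleR complex_linear_nb_op)

lemma Y_0: "Y 0 = id_blinfun" and Y_1: "Y (Suc 0) = T"
  by (simp_all add: Y_def T_def nb_op_0)

text \<open>The extra 1 / q at k = 0 reflects that a step can be undone in q + 1 ways after the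
  trivial walk and in q ways otherwise.\<close>

lemma T_Y: "T o\<^sub>L Y (Suc k) = Y (Suc (Suc k)) + (if k = 0 then 1 + 1 / real q else 1) *\<^sub>R Y k"
proof -
  let ?s = "1 / sqrt (real q)"
  have s: "?s * ?s = 1 / real q" by simp
  have "T o\<^sub>L Y (Suc k) = (?s * ?s ^ Suc k) *\<^sub>R (nb_op G bar (Suc 0) o\<^sub>L nb_op G bar (Suc k))"
    unfolding T_def Y_def
    by (simp add: bounded_bilinear.scaleR_left[OF bounded_bilinear_blinfun_compose]
        bounded_bilinear.scaleR_right[OF bounded_bilinear_blinfun_compose])
  also have "\<dots> = Y (Suc (Suc k)) + (?s * ?s * real (if k = 0 then q + 1 else q)) *\<^sub>R Y k"
    unfolding nb_op_step Y_def by (simp add: scaleR_add_right mult_ac)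
  also have "?s * ?s * real (if k = 0 then q + 1 else q) = (if k = 0 then 1 + 1 / real q else 1)"
    unfolding s using q_pos by (simp add: field_simps)
  finally show ?thesis .
qed

lemma Y_commutes: "Y k o\<^sub>L T = T o\<^sub>L Y k"
proof (induction k rule: less_induct)
  case (less k)
  consider "k = 0" | "k = Suc 0" | l where "k = Suc (Suc l)" by (metis not0_implies_Suc)
  then show ?case
  proof cases
    case 3
    have "Y k = (T o\<^sub>L Y (Suc l)) - (if l = 0 then 1 + 1 / real q else 1) *\<^sub>R Y l"
      using T_Y[of l] 3 by simp
    then show ?thesis
      using less[of "Suc l"] less[of l] 3
      by (simp add: compose_diff_left compose_diff_right compose_assoc
        bounded_bilinear.scaleR_left[OF bounded_bilinear_blinfun_compose]
        bounded_bilinear.scaleR_right[OF bounded_bilinear_blinfun_compose])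
  qed (simp_all add: Y_0 Y_1)
qed

text \<open>The count (q + 1) q^(k-1) is at most 2 q^k, and half of the exponent goes into the
  scaling. The remaining growth sqrt(q)^k is what forces |w| > sqrt q below.\<close>

lemma norm_Y: "norm (Y k) \<le> 2 * sqrt (real q) ^ k"
proof -
  let ?s = "sqrt (real q)"
  have s: "?s > 0" using q_pos by simp
  have "real (walk_count k) \<le> 2 * ?s ^ k * ?s ^ k"
  proof (cases k)
    case (Suc l)
    have "?s ^ k * ?s ^ k = real q ^ k" by (simp add: power_mult_distrib[symmetric])
    moreover have "real (walk_count k) \<le> 2 * real q ^ k"
      using q_pos Suc by (simp add: walk_count_def mult_right_mono)
    ultimately show ?thesis by simp
  qed (simp add: walk_count_def)
  then have "norm (nb_op G bar k) \<le> 2 * ?s ^ k * ?s ^ k" using norm_nb_op[of k] by linarith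
  then show ?thesis using s by (simp add: Y_def power_divide field_simps)
qed

text \<open>With s = 1 / w, summing the recursion \<open>T_Y\<close> against s^(k+2) gives (1 - s T
  + s^2) Z = 1 - s^2 / q. Multiplication by w turns this into (z - T) Z = w (1 - s^2 / q), a nonzero
  multiple of the identity.\<close>

lemma resolvent_joukowski:
  assumes w: "cmod w > sqrt (real q)"
  obtains Z where "(\<lambda>k. inverse w ^ k *\<^sub>C Y k) sums Z"
    and "joukowski w \<notin> op_spectrum T"
    and "resolvent T (joukowski w) = (inverse w / (1 - inverse w ^ 2 / of_nat q)) *\<^sub>C Z"
proof -
  define s where "s = inverse w"
  have q1: "sqrt (real q) \<ge> 1" using q_pos by simp
  then have w0: "w \<noteq> 0" using w by auto
  have s0: "s \<noteq> 0" and sw: "s * w = 1" using w0 by (auto simp: s_def)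
  have sq: "cmod s * sqrt (real q) < 1"
  proof -
    have "cmod s * sqrt (real q) = sqrt (real q) / cmod w"
      by (simp add: s_def norm_inverse divide_inverse_commute)
    then show ?thesis using w w0 by simp
  qed
  define a where "a k = s ^ k *\<^sub>C Y k" for k
  have "norm (a k) \<le> 2 * (cmod s * sqrt (real q)) ^ k" for k
    using mult_left_mono[OF norm_Y[of k], of "cmod s ^ k"]
    by (simp add: a_def norm_scaleC_op norm_power power_mult_distrib mult_ac)
  then have "summable a"
    using sq by (intro summable_comparison_test'[OF summable_mult[OF summable_geometric]]) auto
  then obtain Z where Z: "a sums Z" by (auto simp: summable_def)
  have tail: "(\<lambda>k. f (Suc k)) sums (S - f 0)" if "f sums S" for f :: "nat \<Rightarrow> 'a op" and S
    using that sums_Suc_iff[of f "S - f 0"] by simp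
  have shift: "(\<lambda>k. a (Suc (Suc k))) sums (Z - a 0 - a (Suc 0))"
    using tail[OF tail[OF Z]] .
  have c: "s *\<^sub>C (T o\<^sub>L a (Suc k)) = a (Suc (Suc k)) + s\<^sup>2 *\<^sub>C (a k + (if k = 0 then (1 / real q) *\<^sub>R id_blinfun else 0))" for k
  proof -
    have "s *\<^sub>C (T o\<^sub>L a (Suc k)) = (s * s ^ Suc k) *\<^sub>C (T o\<^sub>L Y (Suc k))"
      by (simp add: a_def compose_scaleC_op[OF complex_linear_T] scaleC_op_scaleC)
    then show ?thesis
      unfolding T_Y
      by (simp add: a_def Y_0 scaleC_op_add_right scaleC_op_scaleC scaleC_op_scaleR scaleR_add_left scaleC_op.zero_right power2_eq_square mult_ac)
  qed
  have sg: "(\<lambda>k. if k = 0 then (1 / real q) *\<^sub>R id_blinfun else 0) sums ((1 / real q) *\<^sub>R id_blinfun :: 'a op)"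
    using sums_single[of 0 "\<lambda>_. (1 / real q) *\<^sub>R id_blinfun :: 'a op"] by simp
  have "(\<lambda>k. s *\<^sub>C (T o\<^sub>L a (Suc k))) sums
      (Z - a 0 - a (Suc 0) + s\<^sup>2 *\<^sub>C (Z + (1 / real q) *\<^sub>R id_blinfun))"
    unfolding c by (intro sums_add shift bounded_linear.sums[OF scaleC_op.bounded_linear_right] Z sg)
  moreover have "(\<lambda>k. s *\<^sub>C (T o\<^sub>L a k)) sums (s *\<^sub>C (T o\<^sub>L Z))"
    by (intro bounded_linear.sums[OF scaleC_op.bounded_linear_right]
        bounded_linear.sums[OF bounded_linear_compose_op_right] Z)
  then have "(\<lambda>k. s *\<^sub>C (T o\<^sub>L a (Suc k))) sums (s *\<^sub>C (T o\<^sub>L Z) - s *\<^sub>C (T o\<^sub>L a 0))"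
    by (rule tail)
  ultimately have "Z - a 0 - a (Suc 0) + s\<^sup>2 *\<^sub>C (Z + (1 / real q) *\<^sub>R id_blinfun) = s *\<^sub>C (T o\<^sub>L Z) - s *\<^sub>C (T o\<^sub>L a 0)"
    by (rule sums_unique2)
  moreover have "s *\<^sub>C (T o\<^sub>L a 0) = a (Suc 0)" by (simp add: a_def Y_0 Y_1)
  ultimately have key: "Z + s\<^sup>2 *\<^sub>C Z - s *\<^sub>C (T o\<^sub>L Z) = id_blinfun - (s\<^sup>2 / of_nat q) *\<^sub>C id_blinfun"
    by (simp add: a_def Y_0 scaleC_op_add_right scaleC_op_of_real[symmetric] scaleC_op_scaleC algebra_simps)
  have ss: "cmod (s\<^sup>2 / of_nat q) < 1"
  proof -
    have "cmod s * 1 \<le> cmod s * sqrt (real q)" using q1 by (intro mult_left_mono) auto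
    then have "cmod s < 1" using sq by simp
    then have "cmod s ^ 2 < 1" by (intro power_less_one_iff[THEN iffD2]) auto
    then show ?thesis using q_pos by (simp add: norm_divide norm_power field_simps)
  qed
  define d where "d = 1 - s\<^sup>2 / of_nat q"
  have d0: "d \<noteq> 0" using ss by (auto simp: d_def)
  have key': "(joukowski w *\<^sub>C id_blinfun - T) o\<^sub>L Z = (w * d) *\<^sub>C id_blinfun"
  proof -
    have "(w * d) *\<^sub>C id_blinfun = w *\<^sub>C (Z + s\<^sup>2 *\<^sub>C Z - s *\<^sub>C (T o\<^sub>L Z))"
      unfolding key d_def by (simp add: scaleC_op_scaleC[symmetric] scaleC_op_diff_left)
    also have "\<dots> = joukowski w *\<^sub>C Z - (T o\<^sub>L Z)"
      using sw by (simp add: joukowski_def scaleC_op_add_left scaleC_op_add_right scaleC_op_diff_right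
        scaleC_op_scaleC power2_eq_square mult.assoc[symmetric] mult.commute s_def w0)
    finally show ?thesis by (simp add: compose_diff_left scaleC_op_compose_left)
  qed
  \<comment> \<open>Commuting turns the right inverse into a left one; complex linearity of
    \<open>Z\<close> lets the scalar z pass through it.\<close>
  have "T o\<^sub>L Z = Z o\<^sub>L T"
  proof (rule sums_unique2)
    show "(\<lambda>k. T o\<^sub>L a k) sums (T o\<^sub>L Z)"
      by (intro bounded_linear.sums[OF bounded_linear_compose_op_right] Z)
    have "T o\<^sub>L a k = a k o\<^sub>L T" for k
      by (simp add: a_def compose_scaleC_op[OF complex_linear_T] scaleC_op_compose_left Y_commutes)
    then show "(\<lambda>k. T o\<^sub>L a k) sums (Z o\<^sub>L T)"
      using bounded_linear.sums[OF bounded_linear_compose_op_left Z, of T] by simp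
  qed
  moreover have Zlin: "complex_linear Z"
    unfolding complex_linear_def
  proof (intro allI, rule sums_unique2)
    fix c f
    have app: "(\<lambda>k. a k g) sums Z g" for g
      by (rule bounded_linear.sums[OF blinfun.bounded_linear_left Z])
    show "(\<lambda>k. a k (scaleC_ell2 c f)) sums Z (scaleC_ell2 c f)" by (rule app)
    have "a k (scaleC_ell2 c f) = scaleC_ell2 c (a k f)" for k
      using complex_linear_scaleR[OF complex_linear_nb_op, of _ k]
      by (simp add: a_def Y_def complex_linear_def scaleC_ell2_scaleC mult.commute)
    then show "(\<lambda>k. a k (scaleC_ell2 c f)) sums scaleC_ell2 c (Z f)"
      using bounded_linear.sums[OF bounded_linear_scaleC_ell2 app] by simp
  qed
  ultimately have key'': "Z o\<^sub>L (joukowski w *\<^sub>C id_blinfun - T) = (w * d) *\<^sub>C id_blinfun"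
    using key' by (simp add: compose_diff_left compose_diff_right scaleC_op_compose_left compose_scaleC_op)
  have "is_resolvent T (joukowski w) ((s / d) *\<^sub>C Z)"
    unfolding is_resolvent_def compose_scaleC_op[OF complex_linear_shift[OF complex_linear_T]] key'
      scaleC_op_compose_left key''
    using d0 sw by (simp add: scaleC_op_scaleC)
  then show thesis
    using that[of Z] Z resolvent_eq[of T "joukowski w"]
    by (auto simp: a_def[abs_def] s_def d_def op_spectrum_def)
qed

end

section \<open>Expansion coefficients\<close>

text \<open>At \<open>q = 1\<close> the quotient is \<open>1\<close>, except that \<open>0 / 0 = 0\<close> at \<open>w = 1\<close> and \<open>w = - 1\<close>,
  which lie on the unit circle.\<close>

definition km_weight :: "nat \<Rightarrow> complex \<Rightarrow> complex" where
  "km_weight q w = (if q = 1 then 1 else (w\<^sup>2 - 1) / (w\<^sup>2 - 1 / of_nat q))"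

text \<open>The coefficient of w^k in the Laurent expansion of h(w + 1 / w) times the weight. It is
  taken on the unit circle, where w + 1 / w is real.\<close>

definition laurent_coeff :: "nat \<Rightarrow> (complex \<Rightarrow> complex) \<Rightarrow> nat \<Rightarrow> complex" where
  "laurent_coeff q h k = contour_integral (circlepath 0 1)
     (\<lambda>w. h (joukowski w) * km_weight q w * inverse w ^ Suc k) / (2 * of_real pi * \<i>)"

lemma joukowski_cis: "joukowski (cis t) = of_real (2 * cos t)"
  by (simp add: joukowski_def complex_eq_iff)

context
  fixes q :: nat and \<rho> :: real and h :: "complex \<Rightarrow> complex"
  assumes q: "q \<ge> 1" and \<rho>: "\<rho> > 1" and h: "h holomorphic_on ellipse_region \<rho>"
begin

text \<open>As w + 1 / w is symmetric under w -> 1 / w, this is the annulus 1 / \<rho> < |w| <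
  \<rho> without the poles w^2 = 1 / q of the weight. At q = 1 the weight is constant, so nothing is
  removed from the unit circle.\<close>

private definition annulus :: "complex set" where
  "annulus = {w. w \<noteq> 0 \<and> joukowski w \<in> ellipse_region \<rho>} \<inter> {w. q = 1 \<or> w\<^sup>2 \<noteq> 1 / of_nat q}"

private lemma open_annulus: "open annulus"
proof -
  have "open ((- {0}) \<inter> joukowski -` ellipse_region \<rho>)"
    by (intro continuous_open_preimage holomorphic_on_imp_continuous_on holomorphic_joukowski
        open_ellipse_region \<rho> open_Compl closed_singleton)
  also have "(- {0}) \<inter> joukowski -` ellipse_region \<rho> = {w. w \<noteq> 0 \<and> joukowski w \<in> ellipse_region \<rho>}"
    by auto
  finally have 1: "open {w. w \<noteq> 0 \<and> joukowski w \<in> ellipse_region \<rho>}" .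
  have "open {w :: complex. w\<^sup>2 \<noteq> 1 / of_nat q}"
    by (intro open_Collect_neq continuous_intros)
  then have "open {w :: complex. q = 1 \<or> w\<^sup>2 \<noteq> 1 / of_nat q}"
    by (cases "q = 1") auto
  with 1 show ?thesis unfolding annulus_def by (rule open_Int)
qed

private lemma in_annulus:
  assumes "1 \<le> cmod w" "cmod w < \<rho>"
  shows "w \<in> annulus"
proof -
  have "w\<^sup>2 \<noteq> 1 / of_nat q" if "q \<noteq> 1"
  proof
    assume "w\<^sup>2 = 1 / of_nat q"
    then have "cmod w ^ 2 = 1 / real q" by (metis norm_power norm_divide norm_one norm_of_nat)
    moreover have "1 / real q < 1" using q that by simp
    ultimately show False using assms(1) one_le_power[of "cmod w" 2] by linarith
  qed
  then show ?thesis
    using assms joukowski_in_ellipse_iff[OF assms(1) \<rho>] by (auto simp: annulus_def)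
qed

private lemma holomorphic_weight: "(\<lambda>w. h (joukowski w) * km_weight q w) holomorphic_on annulus"
proof -
  have "(\<lambda>w. h (joukowski w)) holomorphic_on annulus"
    using holomorphic_on_compose_gen[OF holomorphic_on_subset[OF holomorphic_joukowski] h, of annulus]
    by (auto simp: annulus_def o_def)
  moreover have "km_weight q holomorphic_on annulus"
  proof (cases "q = 1")
    case False
    then have "km_weight q = (\<lambda>w. (w\<^sup>2 - 1) / (w\<^sup>2 - 1 / of_nat q))" by (simp add: km_weight_def fun_eq_iff)
    moreover have "(\<lambda>w :: complex. (w\<^sup>2 - 1) / (w\<^sup>2 - 1 / of_nat q)) holomorphic_on annulus"
      using False by (intro holomorphic_intros) (auto simp: annulus_def)
    ultimately show ?thesis by simp
  next
    case True
    then have "km_weight q = (\<lambda>_. 1)" by (simp add: km_weight_def fun_eq_iff)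
    then show ?thesis by simp
  qed
  ultimately show ?thesis by (rule holomorphic_on_mult)
qed

private lemma holomorphic_integrand:
  "(\<lambda>w. h (joukowski w) * km_weight q w * inverse w ^ Suc k) holomorphic_on annulus"
  by (intro holomorphic_on_mult holomorphic_weight holomorphic_intros) (auto simp: annulus_def)

private lemma sphere_subset_annulus: "1 \<le> r \<Longrightarrow> r < \<rho> \<Longrightarrow> sphere 0 r \<subseteq> annulus"
  using in_annulus by auto

private lemma integrable_circle:
  assumes "1 \<le> r" "r < \<rho>"
  shows "(\<lambda>w. h (joukowski w) * km_weight q w * inverse w ^ Suc k) contour_integrable_on circlepath 0 r"
  using assms sphere_subset_annulus[OF assms]
  by (intro contour_integrable_holomorphic_simple[OF holomorphic_integrand open_annulus]) auto

text \<open>The radial homotopy stays in 1 \<le> |w| \<le> r, and the poles of the weight lie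
  strictly inside the unit disc.\<close>

lemma laurent_coeff_circle:
  assumes r: "1 \<le> r" "r < \<rho>"
  shows "((\<lambda>w. h (joukowski w) * km_weight q w * inverse w ^ Suc k) has_contour_integral
    2 * of_real pi * \<i> * laurent_coeff q h k) (circlepath 0 r)"
proof -
  have "homotopic_loops annulus (circlepath 0 1) (circlepath 0 r)"
  proof (rule homotopic_loops_linear)
    fix t :: real
    define e where "e = exp (2 * of_real pi * \<i> * of_real t)"
    have ne: "cmod e = 1" by (simp add: e_def norm_exp_eq_Re)
    have c: "circlepath 0 s t = of_real s * e" for s by (simp add: circlepath e_def)
    show "closed_segment (circlepath 0 1 t) (circlepath 0 r t) \<subseteq> annulus"
    proof
      fix w assume "w \<in> closed_segment (circlepath 0 1 t) (circlepath 0 r t)"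
      then obtain u where u: "0 \<le> u" "u \<le> 1" "w = of_real (1 - u + u * r) * e"
        by (auto simp: closed_segment_def c scaleR_conv_of_real algebra_simps)
      have "0 \<le> u * (r - 1)" "0 \<le> (1 - u) * (r - 1)" using u r by (auto intro!: mult_nonneg_nonneg)
      then have "1 \<le> 1 - u + u * r" "1 - u + u * r \<le> r" by (simp_all only: algebra_simps)
      moreover have "cmod w = \<bar>1 - u + u * r\<bar>" unfolding u(3) norm_mult norm_of_real ne by simp
      ultimately show "w \<in> annulus" using r by (intro in_annulus) auto
    qed
  qed auto
  then have "contour_integral (circlepath 0 1) (\<lambda>w. h (joukowski w) * km_weight q w * inverse w ^ Suc k)
      = contour_integral (circlepath 0 r) (\<lambda>w. h (joukowski w) * km_weight q w * inverse w ^ Suc k)"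
    by (rule Cauchy_theorem_homotopic_loops[OF _ open_annulus holomorphic_integrand]) auto
  then show ?thesis
    using has_contour_integral_integral[OF integrable_circle[OF r]]
    by (simp add: laurent_coeff_def)
qed

lemma weight_bounded_on_circle:
  assumes r: "1 \<le> r" "r < \<rho>"
  obtains M where "M \<ge> 0" "\<And>w. cmod w = r \<Longrightarrow> cmod (h (joukowski w) * km_weight q w) \<le> M"
proof -
  have "compact ((\<lambda>w. h (joukowski w) * km_weight q w) ` sphere 0 r)"
    by (intro compact_continuous_image holomorphic_on_imp_continuous_on
        holomorphic_on_subset[OF holomorphic_weight] sphere_subset_annulus r) simp
  from compact_imp_bounded[OF this] obtain M
    where "M > 0" "\<forall>y\<in>(\<lambda>w. h (joukowski w) * km_weight q w) ` sphere 0 r. cmod y \<le> M"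
    unfolding bounded_pos by blast
  then show thesis by (intro that[of M]) auto
qed

lemma laurent_coeff_bound:
  assumes r: "1 \<le> r" "r < \<rho>" and M: "M \<ge> 0" "\<And>w. cmod w = r \<Longrightarrow> cmod (h (joukowski w) * km_weight q w) \<le> M"
  shows "cmod (laurent_coeff q h k) \<le> M * inverse r ^ k"
proof -
  have "cmod (2 * of_real pi * \<i> * laurent_coeff q h k) \<le> (M * inverse r ^ Suc k) * (2 * pi * r)"
  proof (rule has_contour_integral_bound_circlepath[OF laurent_coeff_circle[OF r]])
    show "cmod (h (joukowski w) * km_weight q w * inverse w ^ Suc k) \<le> M * inverse r ^ Suc k" if "cmod (w - 0) = r" for w
      using M r that by (simp add: norm_mult[of "_ * _"] norm_mult[of "inverse w"] norm_power norm_inverse mult_right_mono)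
  qed (use M r in auto)
  then show ?thesis using r by (simp add: norm_mult field_simps)
qed

lemma continuous_on_circle_integrand:
  "continuous_on (sphere 0 1) (\<lambda>w. h (joukowski w) * km_weight q w * inverse w ^ k)"
proof -
  have "(\<lambda>w. h (joukowski w) * km_weight q w * inverse w ^ k) holomorphic_on annulus"
    by (intro holomorphic_on_mult holomorphic_weight holomorphic_intros) (auto simp: annulus_def)
  moreover have "sphere 0 1 \<subseteq> annulus" using \<rho> by (intro sphere_subset_annulus) auto
  ultimately show ?thesis
    by (rule holomorphic_on_imp_continuous_on[OF holomorphic_on_subset])
qed

text \<open>The two halves of the unit circle are folded onto each other by \<open>w \<mapsto> 1 / w\<close>.\<close>

lemma laurent_coeff_integral:
  "laurent_coeff q h k = integral {0..pi} (\<lambda>t. h (of_real (2 * cos t)) *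
     (km_weight q (cis t) * cis (- t) ^ k + km_weight q (cis (- t)) * cis t ^ k)) / of_real (2 * pi)"
proof -
  define g where "g t = h (of_real (2 * cos t)) * km_weight q (cis t) * cis (- t) ^ k" for t
  have g_alt: "g = (\<lambda>t. (\<lambda>w. h (joukowski w) * km_weight q w * inverse w ^ k) (cis t))"
    by (simp add: g_def joukowski_cis fun_eq_iff)
  have cont: "continuous_on A g" for A
    unfolding g_alt by (rule continuous_on_compose2[OF continuous_on_circle_integrand]) (auto intro!: continuous_intros)
  have cont': "continuous_on A (\<lambda>t. g (- t))" "continuous_on A (\<lambda>t. g (2 * pi - t))" for A
    by (rule continuous_on_compose2[OF cont[of UNIV]], auto intro!: continuous_intros)+
  have "contour_integral (circlepath 0 1) (\<lambda>w. h (joukowski w) * km_weight q w * inverse w ^ Suc k)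
      = integral {0..2 * pi} (\<lambda>t. \<i> * g t)"
  proof -
    \<comment> \<open>The tangent i w of the unit circle cancels one of the \<open>Suc k\<close>
      factors 1 / w.\<close>
    have move: "a * b * (x * p) * \<i> * c = \<i> * (a * b * p) * (c * x)" for a b x p c :: complex
      by (simp add: mult_ac)
    have "h (joukowski (cis t)) * km_weight q (cis t) * inverse (cis t) ^ Suc k * \<i> * cis t = \<i> * g t" for t
      unfolding g_alt power_Suc move by (simp add: cis_mult)
    then show ?thesis
      unfolding circlepath_def
      by (subst contour_integral_part_circlepath_eq) (simp_all only: add_0 of_real_1 mult_1 mult_1_right, simp_all)
  qed
  also have "\<dots> = \<i> * integral {0..2 * pi} g" by simp
  also have "integral {0..2 * pi} g = integral {0..pi} g + integral {pi..2 * pi} g"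
    using Henstock_Kurzweil_Integration.integral_combine[of 0 pi "2 * pi" g] integrable_continuous_interval[OF cont] by simp
  also have "integral {pi..2 * pi} g = integral {- (2 * pi)..- pi} (\<lambda>t. g (- t))" by simp
  also have "\<dots> = integral {0..pi} ((\<lambda>t. g (- t)) \<circ> (\<lambda>t. t + - (2 * pi)))"
    using integral_shift[of 0 "- (2 * pi)" pi "\<lambda>t. g (- t)"] cont' by simp
  also have "\<dots> = integral {0..pi} (\<lambda>t. g (2 * pi - t))"
    by (simp add: o_def)
  also have "integral {0..pi} g + \<dots> = integral {0..pi} (\<lambda>t. g t + g (2 * pi - t))"
    by (intro Henstock_Kurzweil_Integration.integral_add[symmetric] integrable_continuous_interval cont cont')
  also have "\<dots> = integral {0..pi} (\<lambda>t. h (of_real (2 * cos t)) *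
     (km_weight q (cis t) * cis (- t) ^ k + km_weight q (cis (- t)) * cis t ^ k))"
  proof (rule integral_cong)
    fix t
    have "cis (2 * pi - t) = cis (- t)" "cis (- (2 * pi - t)) = cis t" "cos (2 * pi - t) = cos t"
      by (simp_all add: complex_eq_iff sin_diff cos_diff)
    then show "g t + g (2 * pi - t) = h (of_real (2 * cos t)) *
       (km_weight q (cis t) * cis (- t) ^ k + km_weight q (cis (- t)) * cis t ^ k)"
      by (simp add: g_def distrib_left)
  qed
  finally show ?thesis by (simp add: laurent_coeff_def)
qed

end

section \<open>The Kesten--McKay integrals\<close>

text \<open>Compare coefficients after multiplying by the denominator; the numerator contributes
  only at t^0 and t^2, whence the exception at n = 0.\<close>

lemma X_poly_recurrence:
  "X_poly 0 q x = 1" "X_poly (Suc 0) q x = x"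
  "X_poly (Suc (Suc n)) q x = x * X_poly (Suc n) q x - X_poly n q x - (if n = 0 then 1 / of_nat q else 0)"
proof -
  let ?D = "1 - fps_const x * fps_X + fps_X\<^sup>2" and ?N = "1 - fps_const (1 / of_nat q) * fps_X\<^sup>2 :: 'a fps"
  define P where "P = ?N / ?D"
  have D0: "fps_nth ?D 0 \<noteq> 0" by (simp add: power2_eq_square)
  have "P * ?D = ?N"
    unfolding P_def fps_divide_unit[OF D0] by (simp add: mult.assoc inverse_mult_eq_1[OF D0])
  then have "P - fps_const x * (fps_X * P) + fps_X * (fps_X * P) = 1 - fps_const (1 / of_nat q) * (fps_X * fps_X)"
    by (simp add: algebra_simps power2_eq_square)
  then have nth: "fps_nth (P - fps_const x * (fps_X * P) + fps_X * (fps_X * P)) n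
     = fps_nth (1 - fps_const (1 / of_nat q) * (fps_X * fps_X)) n" for n by simp
  have X: "X_poly n q x = fps_nth P n" for n by (simp add: X_poly_def P_def)
  show "X_poly 0 q x = 1" using nth[of 0] by (simp add: X)
  show "X_poly (Suc 0) q x = x" using nth[of "Suc 0"] nth[of 0] by (simp add: X)
  show "X_poly (Suc (Suc n)) q x = x * X_poly (Suc n) q x - X_poly n q x - (if n = 0 then 1 / of_nat q else 0)"
    using nth[of "Suc (Suc n)"] by (simp add: X algebra_simps split: if_splits)
qed

text \<open>The generating function gives X_{n+1} = U_{n+1} - U_{n-1} / q with Chebyshev polynomials
  of the second kind, for which sin t times U_n at 2 cos t is sin ((n + 1) t).\<close>

lemma sin_X_poly:
  "sin t * X_poly (Suc n) q (2 * cos t) = sin (real (n + 2) * t) - sin (real n * t) / real q"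
proof (induction n rule: less_induct)
  case (less n)
  have sin_step: "2 * cos t * sin (x + t) = sin (x + 2 * t) + sin x" for x
  proof -
    have "sin (x + 2 * t) + sin x = sin ((x + t) + t) + sin ((x + t) - t)" by (simp add: algebra_simps)
    then show ?thesis unfolding sin_add[of "x + t" t] sin_diff[of "x + t" t] by simp
  qed
  \<comment> \<open>The case \<open>Suc 0\<close> is separate because it reaches down to X_0, which
    is outside the formula, and carries the exceptional term 1 / q.\<close>
  consider "n = 0" | "n = Suc 0" | m where "n = Suc (Suc m)" by (metis not0_implies_Suc)
  then show ?case
  proof cases
    case 1
    then show ?thesis by (simp add: X_poly_recurrence sin_double)
  next
    case 2
    have "sin t * X_poly (Suc (Suc 0)) q (2 * cos t) = 2 * cos t * (2 * cos t * sin t) - sin t - sin t / real q"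
      by (simp add: X_poly_recurrence algebra_simps)
    also have "2 * cos t * (2 * cos t * sin t) - sin t = sin (3 * t)"
      using sin_step[of 0] sin_step[of t] by simp
    finally show ?thesis using 2 by simp
  next
    case 3
    have "sin t * X_poly (Suc n) q (2 * cos t)
        = 2 * cos t * (sin t * X_poly (Suc (Suc m)) q (2 * cos t)) - sin t * X_poly (Suc m) q (2 * cos t)"
      using 3 by (simp add: X_poly_recurrence(3)[of "Suc m"] algebra_simps del: X_poly_recurrence)
    also have "\<dots> = 2 * cos t * (sin (real (m + 3) * t) - sin (real (m + 1) * t) / real q)
        - (sin (real (m + 2) * t) - sin (real m * t) / real q)"
      using less[of "Suc m"] less[of m] 3 by (simp add: numeral_3_eq_3)
    also have "\<dots> = (2 * cos t * sin (real (m + 2) * t + t) - sin (real (m + 2) * t))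
        - (2 * cos t * sin (real m * t + t) - sin (real m * t)) / real q"
      by (simp add: algebra_simps diff_divide_distrib)
    also have "\<dots> = sin (real (m + 2) * t + 2 * t) - sin (real m * t + 2 * t) / real q"
      unfolding sin_step by simp
    finally show ?thesis using 3 by (simp add: algebra_simps)
  qed
qed

text \<open>The density in the angle t with x = 2 cos t, including the Jacobian 2 sin t. This factor
  removes the singularity of the density at q = 1.\<close>

definition km_trig :: "nat \<Rightarrow> real \<Rightarrow> real" where
  "km_trig q t = (if q = 1 then 1 / pi
     else 2 * (real q + 1) * (sin t)\<^sup>2 / (pi * (real q + 2 + 1 / real q - 4 * (cos t)\<^sup>2)))"

lemma km_denominator_pos:
  assumes "q \<ge> 2"
  shows "real q + 2 + 1 / real q - 4 * (cos t)\<^sup>2 > 0"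
proof -
  have "0 < (real q - 1)\<^sup>2 / real q" using assms by simp
  also have "\<dots> = real q + 2 + 1 / real q - 4"
    using assms by (simp add: power2_eq_square field_simps)
  also have "\<dots> \<le> real q + 2 + 1 / real q - 4 * (cos t)\<^sup>2"
    using sin_squared_eq[of t] zero_le_power2[of "sin t"] by simp
  finally show ?thesis .
qed

text \<open>The end points must stay out: at q = 1 the left side is 0 there, while
  \<open>km_trig\<close> is 1 / pi.\<close>

lemma km_trig_eq:
  assumes q: "q \<ge> 1" and t: "0 < t" "t < pi"
  shows "2 * sin t * kesten_mckay_density q (2 * cos t) = km_trig q t"
proof -
  have s: "sin t > 0" using t by (rule sin_gt_zero)
  have "4 - (2 * cos t)\<^sup>2 = (2 * sin t)\<^sup>2"
    by (simp add: power_mult_distrib sin_squared_eq)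
  then have sq: "sqrt (4 - (2 * cos t)\<^sup>2) = 2 * sin t" using s by (simp only: real_sqrt_abs)
  have le: "\<bar>2 * cos t\<bar> \<le> 2" by (simp add: abs_mult)
  show ?thesis
  proof (cases "q = 1")
    case True
    then show ?thesis using le s unfolding kesten_mckay_density_def km_trig_def sq by simp
  next
    case False
    have "(real q powr (1/2) + real q powr (-1/2))\<^sup>2 = real q + 2 + 1 / real q"
    proof -
      have "real q powr (1/2) * real q powr (1/2) = real q" "real q powr (-1/2) * real q powr (-1/2) = 1 / real q"
        "real q powr (1/2) * real q powr (-1/2) = 1"
        using q by (simp_all add: powr_add[symmetric] powr_minus_divide)
      moreover have "(a + b)\<^sup>2 = a * a + 2 * (a * b) + b * b" for a b :: real
        by (simp add: power2_eq_square algebra_simps)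
      ultimately show ?thesis by (simp only:)
    qed
    then show ?thesis
      using False le unfolding kesten_mckay_density_def km_trig_def sq
      by (simp add: power_mult_distrib power2_eq_square)
  qed
qed

lemma continuous_km_trig: "q \<ge> 1 \<Longrightarrow> continuous_on A (km_trig q)"
proof (cases "q = 1")
  case True
  then show ?thesis by (simp add: km_trig_def[abs_def])
next
  case False
  moreover assume "q \<ge> 1"
  ultimately have "q \<ge> 2" by simp
  then show ?thesis
    using km_denominator_pos[OF \<open>q \<ge> 2\<close>] False unfolding km_trig_def
    by (auto intro!: continuous_intros simp: less_imp_neq[symmetric])
qed

text \<open>Substitution x = 2 cos t. The density may be unbounded near 2 and -2, so integrability
  is obtained on the side of the angle, where the integrand is continuous, and transferred back by
  the change of variables.\<close>

lemma kesten_mckay_integral: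
  fixes f :: "real \<Rightarrow> complex"
  assumes q: "q \<ge> 1" and f: "continuous_on {-2..2} f"
  shows "(LINT x:{-2..2}|kesten_mckay q. f x) = integral {0..pi} (\<lambda>t. km_trig q t *\<^sub>R f (2 * cos t))"
proof -
  let ?d = "kesten_mckay_density q" and ?S = "{0<..<pi}"
  let ?H = "\<lambda>x. ?d x *\<^sub>R f x"
  have d: "?d \<in> borel_measurable borel" unfolding kesten_mckay_density_def by measurable
  have d0: "?d x \<ge> 0" for x
  proof (cases "\<bar>x\<bar> \<le> 2 \<and> q \<noteq> 1")
    case True
    then have "x\<^sup>2 \<le> 4" using abs_le_square_iff[of x 2] by simp
    moreover have "(real q powr (1/2) + real q powr (-1/2))\<^sup>2 \<ge> 4"
    proof -
      have "real q powr (1/2) * real q powr (-1/2) = 1" using q by (simp add: powr_add[symmetric])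
      then show ?thesis using zero_le_power2[of "real q powr (1/2) - real q powr (-1/2)"]
        by (simp add: power2_sum power2_diff)
    qed
    ultimately show ?thesis by (simp add: kesten_mckay_density_def)
  next
    case False
    then show ?thesis
      using abs_le_square_iff[of x 2] by (auto simp: kesten_mckay_density_def)
  qed
  have fm: "(\<lambda>x. indicator {-2..2} x *\<^sub>R f x) \<in> borel_measurable borel"
    using borel_measurable_continuous_on_indicator[OF _ f] by simp
  have img: "(\<lambda>t. 2 * cos t) ` ?S = {-2<..<2}"
  proof (intro set_eqI iffI)
    fix x assume "x \<in> (\<lambda>t. 2 * cos t) ` ?S"
    then obtain t where t: "0 < t" "t < pi" "x = 2 * cos t" by auto
    then show "x \<in> {-2<..<2}" using cos_monotone_0_pi[of 0 t] cos_monotone_0_pi[of t pi] by simp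
  next
    fix x :: real assume x: "x \<in> {-2<..<2}"
    then have "arccos (x / 2) \<in> ?S" "x = 2 * cos (arccos (x / 2))"
      using arccos_lt_bounded[of "x / 2"] by auto
    then show "x \<in> (\<lambda>t. 2 * cos t) ` ?S" by blast
  qed
  have inj: "inj_on (\<lambda>t. 2 * cos t) ?S"
    by (rule inj_onI) (use cos_inj_pi in auto)
  have der: "((\<lambda>t. 2 * cos t) has_field_derivative - (2 * sin t)) (at t within ?S)" for t
    by (auto intro!: derivative_eq_intros)
  have pull: "\<bar>- (2 * sin t)\<bar> *\<^sub>R ?H (2 * cos t) = km_trig q t *\<^sub>R f (2 * cos t)" if "t \<in> ?S" for t
    using that sin_gt_zero[of t] km_trig_eq[OF q, of t] by (simp add: abs_mult)
  have cont: "continuous_on {0..pi} (\<lambda>t. km_trig q t *\<^sub>R f (2 * cos t))"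
    by (intro continuous_on_scaleR continuous_km_trig[OF q] continuous_on_compose2[OF f] continuous_intros)
      (use cos_ge_minus_one cos_le_one in auto)
  have "(\<lambda>t. km_trig q t *\<^sub>R f (2 * cos t)) absolutely_integrable_on ?S"
    by (rule set_integrable_subset[OF absolutely_integrable_continuous_real[OF cont]]) auto
  then have abs: "(\<lambda>t. \<bar>- (2 * sin t)\<bar> *\<^sub>R ?H (2 * cos t)) absolutely_integrable_on ?S"
    by (subst set_integrable_cong[OF refl refl pull]) auto
  have "?H absolutely_integrable_on (\<lambda>t. 2 * cos t) ` ?S \<and> integral ((\<lambda>t. 2 * cos t) ` ?S) ?H
      = integral ?S (\<lambda>t. \<bar>- (2 * sin t)\<bar> *\<^sub>R ?H (2 * cos t))"
    by (subst has_absolute_integral_change_of_variables_real[OF _ der inj, symmetric]) (use abs in auto)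
  then have HS: "?H absolutely_integrable_on {-2<..<2}"
    and HI: "integral {-2<..<2} ?H = integral ?S (\<lambda>t. \<bar>- (2 * sin t)\<bar> *\<^sub>R ?H (2 * cos t))"
    unfolding img by auto
  have "(LINT x:{-2..2}|kesten_mckay q. f x) = (LINT x|lborel. ?d x *\<^sub>R (indicator {-2..2} x *\<^sub>R f x))"
    unfolding set_lebesgue_integral_def kesten_mckay_def
    by (rule integral_density) (use fm d d0 in auto)
  also have "\<dots> = (LINT x|lebesgue. ?d x *\<^sub>R (indicator {-2..2} x *\<^sub>R f x))"
    by (rule integral_completion[symmetric]) (simp only: measurable_lborel2 borel_measurable_scaleR[OF d fm])
  also have "\<dots> = (LINT x:{-2<..<2}|lebesgue. ?H x)"
    unfolding set_lebesgue_integral_def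
  proof (rule Bochner_Integration.integral_cong[OF refl])
    fix x :: real
    \<comment> \<open>At the end points the density is 0, for q = 1 because of 1 / 0 = 0, so passing
      to the open interval changes nothing pointwise.\<close>
    have "?d x = 0" if "x \<in> {-2..2} - {-2<..<2}"
    proof -
      have "x = -2 \<or> x = 2" using that by auto
      then show ?thesis by (auto simp: kesten_mckay_density_def)
    qed
    then show "?d x *\<^sub>R (indicator {-2..2} x *\<^sub>R f x) = indicator {-2<..<2} x *\<^sub>R ?H x"
      by (auto simp: indicator_def)
  qed
  also have "\<dots> = integral {-2<..<2} ?H" by (rule set_lebesgue_integral_eq_integral(2)[OF HS])
  also have "\<dots> = integral ?S (\<lambda>t. km_trig q t *\<^sub>R f (2 * cos t))"
    unfolding HI by (rule integral_cong[OF pull])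
  finally show ?thesis by (simp add: integral_open_interval_real)
qed

text \<open>For v = 1 / w the common denominator q (w^2 - 1 / q) (v^2 - 1 / q) is the real number
  \<Delta>. Since w^2 - 1 = w (w - v) and v^2 - 1 = - v (w - v), the numerator is a product of two
  expressions that change sign when w and v are exchanged, and these are the sines.\<close>

lemma km_weight_fold:
  fixes t :: real
  assumes q: "q \<ge> 2"
  defines "\<Delta> \<equiv> real q + 2 + 1 / real q - 4 * (cos t)\<^sup>2"
  shows "km_weight q (cis t) * cis (- t) ^ k + km_weight q (cis (- t)) * cis t ^ k =
    of_real (4 * real q / \<Delta> * sin t * (sin ((real k + 1) * t) - sin ((real k - 1) * t) / real q))"
proof -
  define w where "w = cis t"
  define v where "v = cis (- t)"
  define Q where "Q = (of_nat q :: complex)"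
  have wv: "w * v = 1" "v * w = 1" by (simp_all add: w_def v_def cis_mult)
  have Q: "Q \<noteq> 0" using q by (simp add: Q_def)
  have q1: "q \<noteq> 1" using q by simp
  have \<Delta>: "\<Delta> > 0" unfolding \<Delta>_def by (rule km_denominator_pos[OF q])
  have wpv: "w + v = 2 * of_real (cos t)" by (simp add: w_def v_def complex_eq_iff)
  have prod: "Q * ((w\<^sup>2 - 1 / Q) * (v\<^sup>2 - 1 / Q)) = of_real \<Delta>"
  proof -
    have "Q * ((w\<^sup>2 - 1 / Q) * (v\<^sup>2 - 1 / Q)) = Q * (w * v)\<^sup>2 + 2 * (w * v) + 1 / Q - (w + v)\<^sup>2"
      using Q by (simp add: power2_eq_square field_simps)
    also have "\<dots> = of_real \<Delta>" unfolding wv wpv by (simp add: \<Delta>_def Q_def power_mult_distrib)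
    finally show ?thesis .
  qed
  have D0: "of_real \<Delta> \<noteq> (0 :: complex)" using \<Delta> by simp
  then have ne: "w\<^sup>2 - 1 / Q \<noteq> 0" "v\<^sup>2 - 1 / Q \<noteq> 0" unfolding prod[symmetric] by auto
  have frac: "a / x * y + b / z * u = (Q / (Q * (x * z))) * (a * z * y + b * x * u)"
    if "x \<noteq> 0" "z \<noteq> 0" for a b u x y z :: complex
    using that Q by (simp add: field_simps)
  have s: "2 * \<i> * of_real (sin x) = cis x - cis (- x)" for x by (simp add: complex_eq_iff)
  have pw: "cis (real k * t) = w ^ k" "cis (- (real k * t)) = v ^ k"
    using Complex.DeMoivre[of t k] Complex.DeMoivre[of "- t" k] by (simp_all add: w_def v_def)
  have plus: "2 * \<i> * of_real (sin ((real k + 1) * t)) = w * w ^ k - v * v ^ k"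
  proof -
    have "cis ((real k + 1) * t) = w * w ^ k" "cis (- ((real k + 1) * t)) = v * v ^ k"
      unfolding pw[symmetric] unfolding w_def v_def cis_mult by (simp_all add: algebra_simps)
    then show ?thesis unfolding s by simp
  qed
  have minus: "2 * \<i> * of_real (sin ((real k - 1) * t)) = v * w ^ k - w * v ^ k"
  proof -
    have "cis ((real k - 1) * t) = v * w ^ k" "cis (- ((real k - 1) * t)) = w * v ^ k"
      unfolding pw[symmetric] unfolding w_def v_def cis_mult by (simp_all add: algebra_simps)
    then show ?thesis unfolding s by simp
  qed
  have sin1: "2 * \<i> * of_real (sin t) = w - v" unfolding s w_def v_def ..
  have "km_weight q w * v ^ k + km_weight q v * w ^ k =
      (Q / of_real \<Delta>) * ((w\<^sup>2 - 1) * (v\<^sup>2 - 1 / Q) * v ^ k + (v\<^sup>2 - 1) * (w\<^sup>2 - 1 / Q) * w ^ k)"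
    using q1 frac[OF ne] by (simp add: km_weight_def Q_def[symmetric] prod)
  also have "(w\<^sup>2 - 1) * (v\<^sup>2 - 1 / Q) * v ^ k + (v\<^sup>2 - 1) * (w\<^sup>2 - 1 / Q) * w ^ k =
      - ((w - v) * ((w * w ^ k - v * v ^ k) - (v * w ^ k - w * v ^ k) / Q))"
  proof -
    have "w\<^sup>2 - 1 = w * (w - v)" "v\<^sup>2 - 1 = - (v * (w - v))"
      by (simp_all add: power2_eq_square right_diff_distrib wv)
    moreover have "w * (v\<^sup>2 - 1 / Q) = v - w / Q" "v * (w\<^sup>2 - 1 / Q) = w - v / Q"
      using wv by (simp_all add: power2_eq_square right_diff_distrib mult.assoc[symmetric])
    ultimately have E: "(w\<^sup>2 - 1) * (v\<^sup>2 - 1 / Q) = (w - v) * (v - w / Q)"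
      "(v\<^sup>2 - 1) * (w\<^sup>2 - 1 / Q) = - ((w - v) * (w - v / Q))"
      by (metis mult.assoc mult.commute, metis mult.assoc mult.commute minus_mult_left)
    show ?thesis unfolding E by (simp add: algebra_simps diff_divide_distrib)
  qed
  also have "\<dots> = - ((2 * \<i> * of_real (sin t)) * (2 * \<i> * of_real (sin ((real k + 1) * t))
      - 2 * \<i> * of_real (sin ((real k - 1) * t)) / Q))"
    unfolding sin1 plus minus ..
  also have "\<dots> = 4 * of_real (sin t) * (of_real (sin ((real k + 1) * t)) - of_real (sin ((real k - 1) * t)) / Q)"
    by (simp add: algebra_simps diff_divide_distrib)
  finally show ?thesis by (simp add: w_def v_def Q_def)
qed

text \<open>For k \<ge> 1 the bracket of sines is sin t times X_k. At k = 0 it is (1 + 1 / q) sin t,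
  although X_0 = 1; this is why only the constant term lacks the factor 1 / (1 + 1 / q).\<close>

lemma km_weight_fold_km_trig:
  assumes q: "q \<ge> 1" and t: "0 < t" "t < pi"
  shows "(km_weight q (cis t) * cis (- t) ^ k + km_weight q (cis (- t)) * cis t ^ k) / of_real (2 * pi) =
    of_real (km_trig q t * (if k = 0 then 1 else inverse (1 + 1 / real q) * X_poly k q (2 * cos t)))"
proof -
  have s: "sin t > 0" using t by (rule sin_gt_zero)
  have X: "X_poly k q (2 * cos t) = (sin ((real k + 1) * t) - sin ((real k - 1) * t) / real q) / sin t" if "k \<noteq> 0"
  proof -
    obtain n where k: "k = Suc n" using \<open>k \<noteq> 0\<close> by (cases k) auto
    have "real k + 1 = real (n + 2)" "real k - 1 = real n" using k by simp_all
    then show ?thesis using sin_X_poly[of t n q] s by (simp only: k eq_divide_eq mult.commute) simp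
  qed
  show ?thesis
  proof (cases "q = 1")
    case True
    have "cis (- t) ^ k + cis t ^ k = of_real (2 * cos (real k * t))"
      using Complex.DeMoivre[of t k] Complex.DeMoivre[of "- t" k] by (simp add: complex_eq_iff)
    moreover have "X_poly k q (2 * cos t) = 2 * cos (real k * t)" if "k \<noteq> 0"
      using X[OF that] True s by (simp add: distrib_right left_diff_distrib sin_add sin_diff)
    ultimately show ?thesis using True by (simp add: km_weight_def km_trig_def)
  next
    case False
    then have q2: "q \<ge> 2" using q by simp
    define \<Delta> where "\<Delta> = real q + 2 + 1 / real q - 4 * (cos t)\<^sup>2"
    have \<Delta>: "\<Delta> > 0" unfolding \<Delta>_def by (rule km_denominator_pos[OF q2])
    have tr: "km_trig q t = 2 * (real q + 1) * (sin t)\<^sup>2 / (pi * \<Delta>)"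
      using False by (simp add: km_trig_def \<Delta>_def)
    have "4 * real q / \<Delta> * sin t * (sin ((real k + 1) * t) - sin ((real k - 1) * t) / real q) / (2 * pi)
        = km_trig q t * (if k = 0 then 1 else inverse (1 + 1 / real q) * X_poly k q (2 * cos t))"
    proof (cases "k = 0")
      case True
      then show ?thesis using \<Delta> q unfolding tr by (simp add: power2_eq_square field_simps)
    next
      case k: False
      define A where "A = sin ((real k + 1) * t) - sin ((real k - 1) * t) / real q"
      have "inverse (1 + 1 / real q) = real q / (real q + 1)" using q by (simp add: field_simps)
      then show ?thesis
        using k s \<Delta> q unfolding tr X[OF k] A_def[symmetric] by (simp add: power2_eq_square divide_simps)
    qed
    then show ?thesis
      unfolding km_weight_fold[OF q2] \<Delta>_def[symmetric] by (simp only: of_real_divide[symmetric])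
  qed
qed

section \<open>Identification of the Laurent coefficients\<close>

lemma continuous_on_real_ellipse:
  assumes "\<rho> > 1" "h holomorphic_on ellipse_region \<rho>"
  shows "continuous_on {-2..2} (\<lambda>x. h (of_real x))"
proof (rule continuous_on_compose2[OF holomorphic_on_imp_continuous_on[OF assms(2)]])
  show "of_real ` {-2..2} \<subseteq> ellipse_region \<rho>"
  proof clarify
    fix x :: real assume x: "x \<in> {-2..2}"
    then have "joukowski (cis (arccos (x / 2))) = of_real x"
      by (simp add: joukowski_cis cos_arccos)
    moreover have "joukowski (cis (arccos (x / 2))) \<in> ellipse_region \<rho>"
      using assms by (subst joukowski_in_ellipse_iff) auto
    ultimately show "of_real x \<in> ellipse_region \<rho>" by simp
  qed
qed (auto intro!: continuous_intros)

lemma laurent_coeff_eq: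
  assumes q: "q \<ge> 1" and \<rho>: "\<rho> > 1" and h: "h holomorphic_on ellipse_region \<rho>"
  shows "laurent_coeff q h k = (if k = 0 then km_mean q h else km_coeff k q h)"
proof -
  let ?x = "\<lambda>t. (if k = 0 then 1 else inverse (1 + 1 / real q) * X_poly k q (2 * cos t)) :: real"
  have X_cont: "continuous_on A (\<lambda>x. X_poly n q (x :: real))" for A n
  proof (induction n rule: less_induct)
    case (less n)
    consider "n = 0" | "n = Suc 0" | m where "n = Suc (Suc m)" by (metis not0_implies_Suc)
    then show ?case
      using less by cases (auto simp: X_poly_recurrence intro!: continuous_intros)
  qed
  have hc: "continuous_on {-2..2} (\<lambda>x. h (of_real x))" using \<rho> h by (rule continuous_on_real_ellipse)
  \<comment> \<open>The integral moves to the open interval because the folded identity divides by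
    sin t; afterwards it returns to the closed one.\<close>
  have "laurent_coeff q h k = integral {0<..<pi} (\<lambda>t. h (of_real (2 * cos t)) *
     (km_weight q (cis t) * cis (- t) ^ k + km_weight q (cis (- t)) * cis t ^ k) / of_real (2 * pi))"
    unfolding laurent_coeff_integral[OF q \<rho> h] integral_open_interval_real by simp
  also have "\<dots> = integral {0<..<pi} (\<lambda>t. of_real (km_trig q t * ?x t) * h (of_real (2 * cos t)))"
  proof (rule integral_cong)
    fix t assume "t \<in> {0<..<pi}"
    then have t: "0 < t" "t < pi" by auto
    show "h (of_real (2 * cos t)) * (km_weight q (cis t) * cis (- t) ^ k + km_weight q (cis (- t)) * cis t ^ k) / of_real (2 * pi)
        = of_real (km_trig q t * ?x t) * h (of_real (2 * cos t))"
      unfolding times_divide_eq_right[symmetric] km_weight_fold_km_trig[OF q t] by (rule mult.commute)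
  qed
  also have "\<dots> = integral {0..pi} (\<lambda>t. of_real (km_trig q t * ?x t) * h (of_real (2 * cos t)))"
    by (rule integral_open_interval_real[symmetric])
  also have "\<dots> = (if k = 0 then km_mean q h else km_coeff k q h)"
  proof (cases "k = 0")
    case True
    then show ?thesis
      unfolding km_mean_def kesten_mckay_integral[OF q hc] by (simp add: scaleR_conv_of_real)
  next
    case False
    have "continuous_on {-2..2} (\<lambda>x. h (of_real x) * of_real (X_poly k q x))"
      by (intro continuous_on_mult hc continuous_on_of_real X_cont)
    then have "km_coeff k q h = of_real (inverse (1 + 1 / real q)) *
        integral {0..pi} (\<lambda>t. km_trig q t *\<^sub>R (h (of_real (2 * cos t)) * of_real (X_poly k q (2 * cos t))))"
      unfolding km_coeff_def by (simp only: kesten_mckay_integral[OF q])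
    also have "\<dots> = integral {0..pi} (\<lambda>t. of_real (inverse (1 + 1 / real q)) *
        (km_trig q t *\<^sub>R (h (of_real (2 * cos t)) * of_real (X_poly k q (2 * cos t)))))"
      by (rule integral_mult_right[symmetric])
    also have "\<dots> = integral {0..pi} (\<lambda>t. of_real (km_trig q t * ?x t) * h (of_real (2 * cos t)))"
      using False by (intro integral_cong) (simp add: scaleR_conv_of_real mult_ac)
    finally show ?thesis using False by simp
  qed
  finally show ?thesis .
qed

section \<open>The expansion\<close>

context nontrivial_regular_digraph
begin

text \<open>The Cauchy estimate on a circle of radius r > sqrt q makes the coefficients decay like
  r^(-k), against growth sqrt(q)^k of the operators.\<close>

lemma summable_laurent_Y:
  assumes \<rho>: "\<rho> > sqrt (real q)" and h: "h holomorphic_on ellipse_region \<rho>"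
  shows "summable (\<lambda>k. laurent_coeff q h k *\<^sub>C Y k)"
proof -
  let ?s = "sqrt (real q)"
  have s1: "?s \<ge> 1" using q_pos by simp
  obtain r where r: "?s < r" "r < \<rho>" using dense \<rho> by blast
  have r1: "1 \<le> r" "\<rho> > 1" using r s1 by linarith+
  obtain M where M: "M \<ge> 0" "\<And>w. cmod w = r \<Longrightarrow> cmod (h (joukowski w) * km_weight q w) \<le> M"
    using weight_bounded_on_circle[OF q_pos r1(2) h r1(1) r(2)] by metis
  have bound: "norm (laurent_coeff q h k *\<^sub>C Y k) \<le> 2 * M * (?s / r) ^ k" for k
  proof -
    have "norm (laurent_coeff q h k *\<^sub>C Y k) \<le> (M * inverse r ^ k) * (2 * ?s ^ k)"
      unfolding norm_scaleC_op
      using laurent_coeff_bound[OF q_pos r1(2) h r1(1) r(2) M] M r1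
      by (intro mult_mono norm_Y) auto
    then show ?thesis by (simp add: power_divide divide_inverse power_inverse power_mult_distrib mult_ac)
  qed
  have "summable (\<lambda>k. 2 * M * (?s / r) ^ k)"
    using r r1 q_pos by (intro summable_mult summable_geometric) (simp add: divide_less_eq)
  then show ?thesis by (rule summable_comparison_test'[OF _ bound])
qed

lemma contour_integral_ellipse_resolvent:
  assumes r: "sqrt (real q) < r" "r < \<rho>" and h: "h holomorphic_on ellipse_region \<rho>"
    and \<psi>: "complex_functional \<psi>"
  shows "contour_integral (ellipse_path r) (\<lambda>z. h z * \<psi> (resolvent T z))
    = 2 * of_real pi * \<i> * \<psi> (\<Sum>k. laurent_coeff q h k *\<^sub>C Y k)"
proof -
  interpret \<psi>: bounded_linear \<psi> using \<psi> by (rule complex_functional_bounded_linear)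
  let ?s = "sqrt (real q)" and ?C = "circlepath 0 r"
  have s1: "?s \<ge> 1" using q_pos by simp
  have r1: "1 \<le> r" "1 < r" "r > 0" "\<rho> > 1" using r s1 by linarith+
  obtain M where M: "M \<ge> 0" "\<And>w. cmod w = r \<Longrightarrow> cmod (h (joukowski w) * km_weight q w) \<le> M"
    using weight_bounded_on_circle[OF q_pos r1(4) h r1(1) r(2)] by metis
  obtain K where K: "K > 0" "\<And>S. cmod (\<psi> S) \<le> norm S * K" using \<psi>.pos_bounded by blast
  define F where "F k w = h (joukowski w) * km_weight q w * inverse w ^ Suc k * \<psi> (Y k)" for k w
  have F_int: "(F k has_contour_integral 2 * of_real pi * \<i> * laurent_coeff q h k * \<psi> (Y k)) ?C" for k
    unfolding F_def
    using has_contour_integral_rmul[OF laurent_coeff_circle[OF q_pos r1(4) h r1(1) r(2)]] .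
  have F_bound: "cmod (F k w) \<le> 2 * M * K * inverse r * (?s / r) ^ k" if w: "w \<in> sphere 0 r" for k w
  proof -
    have nw: "cmod w = r" using w by simp
    have "cmod (\<psi> (Y k)) \<le> norm (Y k) * K" by (rule K)
    also have "\<dots> \<le> 2 * ?s ^ k * K" using K norm_Y by (intro mult_right_mono) auto
    finally have \<psi>Y: "cmod (\<psi> (Y k)) \<le> 2 * ?s ^ k * K" .
    have "cmod (F k w) = cmod (h (joukowski w) * km_weight q w) * inverse r ^ Suc k * cmod (\<psi> (Y k))"
      by (simp add: F_def norm_mult norm_power norm_inverse nw)
    also have "\<dots> \<le> M * inverse r ^ Suc k * (2 * ?s ^ k * K)"
      using M nw \<psi>Y r1 by (intro mult_mono) auto
    also have "\<dots> = 2 * M * K * inverse r * (?s / r) ^ k"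
      by (simp add: power_divide divide_inverse power_inverse power_mult_distrib mult_ac)
    finally show ?thesis .
  qed
  have "summable (\<lambda>k. 2 * M * K * inverse r * (?s / r) ^ k)"
    using r r1 q_pos by (intro summable_mult summable_geometric) (simp add: divide_less_eq)
  \<comment> \<open>The geometric majorant with ratio sqrt(q) / r justifies integration term by
    term.\<close>
  then have unif: "uniform_limit (sphere 0 r) (\<lambda>n w. \<Sum>k<n. F k w) (\<lambda>w. \<Sum>k. F k w) sequentially"
    using F_bound by (intro Weierstrass_m_test)
  have partial: "((\<lambda>w. \<Sum>k<n. F k w) has_contour_integral
      (\<Sum>k<n. 2 * of_real pi * \<i> * laurent_coeff q h k * \<psi> (Y k))) ?C" for n
    by (intro has_contour_integral_sum F_int) auto
  have "(\<lambda>n. contour_integral ?C (\<lambda>w. \<Sum>k<n. F k w)) \<longlonglongrightarrow> contour_integral ?C (\<lambda>w. \<Sum>k. F k w)"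
  proof (rule contour_integral_uniform_limit_circlepath[OF _ unif])
    show "\<forall>\<^sub>F n in sequentially. (\<lambda>w. \<Sum>k<n. F k w) contour_integrable_on ?C"
      using partial by (intro always_eventually allI) (meson contour_integrable_on_def)
  qed (use r1 in auto)
  then have "(\<lambda>k. 2 * of_real pi * \<i> * laurent_coeff q h k * \<psi> (Y k)) sums contour_integral ?C (\<lambda>w. \<Sum>k. F k w)"
    by (simp add: sums_def contour_integral_unique[OF partial])
  moreover have "(\<lambda>k. 2 * of_real pi * \<i> * laurent_coeff q h k * \<psi> (Y k)) sums
      (2 * of_real pi * \<i> * \<psi> (\<Sum>k. laurent_coeff q h k *\<^sub>C Y k))"
    using sums_mult[OF \<psi>.sums[OF summable_sums[OF summable_laurent_Y[OF less_trans[OF r] h]]], of "2 * of_real pi * \<i>"]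
    by (simp add: complex_functional_scaleC[OF \<psi>] mult_ac)
  ultimately have "contour_integral ?C (\<lambda>w. \<Sum>k. F k w) = 2 * of_real pi * \<i> * \<psi> (\<Sum>k. laurent_coeff q h k *\<^sub>C Y k)"
    by (rule sums_unique2)
  moreover have "contour_integral (ellipse_path r) (\<lambda>z. h z * \<psi> (resolvent T z)) = contour_integral ?C (\<lambda>w. \<Sum>k. F k w)"
    unfolding contour_integral_ellipse_path[OF r1(3)]
  proof (rule contour_integral_eq)
    fix w assume "w \<in> path_image ?C"
    then have nw: "cmod w = r" using r1 by simp
    then have w0: "w \<noteq> 0" and ws: "cmod w > ?s" using r r1 by auto
    obtain Z where Z: "(\<lambda>k. inverse w ^ k *\<^sub>C Y k) sums Z"
      and R: "resolvent T (joukowski w) = (inverse w / (1 - inverse w ^ 2 / of_nat q)) *\<^sub>C Z"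
      by (rule resolvent_joukowski[OF ws])
    have w2: "w\<^sup>2 \<noteq> 1 / of_nat q"
    proof
      assume "w\<^sup>2 = 1 / of_nat q"
      then have "r ^ 2 = 1 / real q" by (metis nw norm_power norm_divide norm_one norm_of_nat)
      moreover have "1 / real q \<le> 1" using q_pos by simp
      moreover have "r ^ 2 > 1" using r1 by (simp add: one_less_power)
      ultimately show False by linarith
    qed
    \<comment> \<open>The origin of \<open>km_weight\<close>: derivative of w + 1 / w times the
      prefactor of the resolvent. At q = 1 the two cancel up to 1 / w, which leaves the constant
      weight.\<close>
    have weight: "(1 - inverse w ^ 2) * (inverse w / (1 - inverse w ^ 2 / of_nat q)) = km_weight q w * inverse w"
    proof (cases "q = 1")
      case True
      then show ?thesis using w2 w0 by (simp add: km_weight_def field_simps power2_eq_square)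
    next
      case False
      have "1 - inverse w ^ 2 = (w\<^sup>2 - 1) / w\<^sup>2" "1 - inverse w ^ 2 / of_nat q = (w\<^sup>2 - 1 / of_nat q) / w\<^sup>2"
        using w0 by (simp_all add: divide_simps)
      then show ?thesis using False w0 w2 by (simp add: km_weight_def)
    qed
    have "(\<lambda>k. h (joukowski w) * (km_weight q w * inverse w) * \<psi> (inverse w ^ k *\<^sub>C Y k))
        sums (h (joukowski w) * (km_weight q w * inverse w) * \<psi> Z)"
      by (intro sums_mult \<psi>.sums Z)
    then have "(\<lambda>k. F k w) sums (h (joukowski w) * (km_weight q w * inverse w) * \<psi> Z)"
      by (simp add: F_def complex_functional_scaleC[OF \<psi>] mult_ac)
    then have "(\<Sum>k. F k w) = h (joukowski w) * (km_weight q w * inverse w) * \<psi> Z" by (rule sums_unique[symmetric])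
    then show "(1 - inverse w ^ 2) * (h (joukowski w) * \<psi> (resolvent T (joukowski w))) = (\<Sum>k. F k w)"
      unfolding R complex_functional_scaleC[OF \<psi>] weight[symmetric] by (simp only: mult_ac)
  qed
  ultimately show ?thesis by simp
qed

lemma op_spectrum_T:
  assumes "z \<in> op_spectrum T"
  obtains w where "1 \<le> cmod w" "cmod w \<le> sqrt (real q)" "z = joukowski w"
proof -
  obtain w where w: "1 \<le> cmod w" "z = joukowski w" using joukowski_surj .
  then have "\<not> cmod w > sqrt (real q)" using assms resolvent_joukowski[of w] by metis
  then show thesis using that w by simp
qed

lemma ellipse_path_encloses:
  assumes r: "sqrt (real q) < r" "r < \<rho>"
  shows "encloses_spectrum (ellipse_region \<rho>) T (ellipse_path r)"
  unfolding encloses_spectrum_def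
proof (intro conjI ballI allI impI)
  have s1: "sqrt (real q) \<ge> 1" using q_pos by simp
  have r1: "1 < r" "r > 0" "\<rho> > 1" using r s1 by linarith+
  show "valid_path (ellipse_path r)" using r1 by (intro valid_ellipse_path)
  show "pathfinish (ellipse_path r) = pathstart (ellipse_path r)" by (rule loop_ellipse_path)
  show "path_image (ellipse_path r) \<subseteq> ellipse_region \<rho> - op_spectrum T"
  proof
    fix z assume "z \<in> path_image (ellipse_path r)"
    then obtain w where w: "cmod w = r" "z = joukowski w" using r1 by (auto simp: path_image_ellipse_path)
    moreover have "joukowski w \<notin> op_spectrum T" using resolvent_joukowski[of w] w r by metis
    ultimately show "z \<in> ellipse_region \<rho> - op_spectrum T"
      using joukowski_in_ellipse_iff[of w \<rho>] r r1 by auto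
  qed
  show "winding_number (ellipse_path r) z = 1" if "z \<in> op_spectrum T" for z
    using that r r1 by (auto elim!: op_spectrum_T simp: winding_number_ellipse_path)
  show "winding_number (ellipse_path r) z = 0" if z: "z \<notin> ellipse_region \<rho>" for z
  proof -
    obtain w where w: "1 \<le> cmod w" "z = joukowski w" using joukowski_surj .
    then have "\<not> cmod w < \<rho>" using z joukowski_in_ellipse_iff[of w \<rho>] r1 by auto
    then show ?thesis using w r r1 by (simp add: winding_number_ellipse_path)
  qed
qed

text \<open>The curve is arbitrary, so the comparison ellipse is chosen after it: by compactness the
  curve lies in some \<open>ellipse_region r\<close> with sqrt q < r < \<rho>, which then serves as
  the domain inside the outer curve.\<close>

lemma holomorphic_calculus_T:
  assumes \<rho>: "\<rho> > sqrt (real q)" and h: "h holomorphic_on ellipse_region \<rho>"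
  shows "holomorphic_calculus (ellipse_region \<rho>) h T = (\<Sum>k. laurent_coeff q h k *\<^sub>C Y k)" (is "_ = ?B")
proof -
  have s1: "sqrt (real q) \<ge> 1" using q_pos by simp
  have \<rho>1: "\<rho> > 1" using \<rho> s1 by linarith
  obtain r0 where r0: "sqrt (real q) < r0" "r0 < \<rho>" using dense \<rho> by blast
  show ?thesis
  proof (rule holomorphic_calculus_eqI[OF complex_linear_T open_ellipse_region[OF \<rho>1] h ellipse_path_encloses[OF r0]])
    fix \<gamma> and \<psi> :: "'a op \<Rightarrow> complex"
    assume \<gamma>: "encloses_spectrum (ellipse_region \<rho>) T \<gamma>" and \<psi>: "complex_functional \<psi>"
    have "compact (path_image \<gamma>)" "path_image \<gamma> \<subseteq> ellipse_region \<rho>"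
      using \<gamma> by (auto simp: encloses_spectrum_def compact_valid_path_image)
    then obtain r where r: "sqrt (real q) < r" "r < \<rho>" "path_image \<gamma> \<subseteq> ellipse_region r"
      using compact_subset_smaller_ellipse s1 \<rho> by metis
    have r1: "r > 1" "r > 0" using r s1 by linarith+
    have E: "encloses_spectrum (ellipse_region \<rho>) T (ellipse_path r)" using r by (intro ellipse_path_encloses)
    show "contour_integral \<gamma> (\<lambda>z. h z * \<psi> (resolvent T z)) = 2 * of_real pi * \<i> * \<psi> ?B"
    proof (rule riesz_dunford_inner_curve[OF complex_linear_T convex_ellipse_region[OF \<rho>1]
          open_ellipse_region[OF \<rho>1] h _ _ _ vector_derivative_ellipse_path_le[OF r1(2)]
          contour_integral_ellipse_resolvent[OF r(1,2) h] convex_ellipse_region[OF r1(1)]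
          open_ellipse_region[OF r1(1)] ellipse_region_mono[OF r1(1) less_imp_le[OF r(2)]] _ _ \<gamma> r(3) \<psi>])
      show "ellipse_region r \<inter> path_image (ellipse_path r) = {}"
      proof -
        have "joukowski w \<notin> ellipse_region r" if "cmod w = r" for w
          using joukowski_in_ellipse_iff[of w r] r1 that by simp
        then show ?thesis using r1 by (auto simp: path_image_ellipse_path)
      qed
      show "winding_number (ellipse_path r) z = 1" if z: "z \<in> ellipse_region r" for z
      proof -
        obtain w where "1 \<le> cmod w" "cmod w < r" "z = joukowski w" using ellipse_regionE[OF z r1(1)] by metis
        then show ?thesis using r1 by (simp add: winding_number_ellipse_path)
      qed
    qed (use E in \<open>auto simp: encloses_spectrum_def\<close>)
  qed
qed

end

theorem theorem4p2:
  fixes G :: "('v, 'e) pre_digraph" and bar :: "'e \<Rightarrow> 'e"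
    and q :: nat and \<rho> :: real and h :: "complex \<Rightarrow> complex"
  assumes "q \<ge> 1"
    and "verts G = UNIV"
    and "regular_graph (q + 1) G bar"
    and "\<rho> > real q powr (1/2)"
    and "h holomorphic_on ellipse_region \<rho>"
  shows "summable (\<lambda>n. (of_real (real q powr (- real (Suc n) / 2)) * km_coeff (Suc n) q h)
                        *\<^sub>C nb_op G bar (Suc n))
    \<and> holomorphic_calculus (ellipse_region \<rho>) h ((real q powr (-1/2)) *\<^sub>R adjacency_op G)
      = km_mean q h *\<^sub>C id_blinfun
        + (\<Sum>n. (of_real (real q powr (- real (Suc n) / 2)) * km_coeff (Suc n) q h)
                *\<^sub>C nb_op G bar (Suc n))"
proof -
  interpret regular_bidirected_digraph G bar q
    using assms(2,3) by (rule regular_graph_imp_locale)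
  interpret nontrivial_regular_digraph G bar q by unfold_locales (rule assms(1))
  have \<rho>: "\<rho> > sqrt (real q)" using assms(4) by (simp add: powr_half_sqrt)
  have \<rho>1: "\<rho> > 1" using \<rho> assms(1) real_sqrt_ge_1_iff[of "real q"] by linarith
  have half: "real q powr (-1/2) = 1 / sqrt (real q)"
    using assms(1) by (simp add: powr_minus_divide powr_half_sqrt)
  have pw: "real q powr (- real n / 2) = (1 / sqrt (real q)) ^ n" for n
  proof -
    have "real q powr (- real n / 2) = (real q powr (-1/2)) powr real n" by (simp add: powr_powr)
    then show ?thesis unfolding half using assms(1) by (simp add: powr_realpow)
  qed
  have T: "(real q powr (-1/2)) *\<^sub>R adjacency_op G = T"
    unfolding half adjacency_op_eq T_def ..
  have summand: "(of_real (real q powr (- real (Suc n) / 2)) * km_coeff (Suc n) q h) *\<^sub>C nb_op G bar (Suc n)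
      = laurent_coeff q h (Suc n) *\<^sub>C Y (Suc n)" for n
    unfolding pw laurent_coeff_eq[OF assms(1) \<rho>1 assms(5)] Y_def
    by (simp add: scaleC_op_of_real[symmetric] scaleC_op_scaleC mult.commute)
  have sm: "summable (\<lambda>k. laurent_coeff q h k *\<^sub>C Y k)" using \<rho> assms(5) by (rule summable_laurent_Y)
  \<comment> \<open>Index 0 is split off because its coefficient is the plain mean; the remaining
    indices are shifted by \<open>Suc\<close>.\<close>
  have "holomorphic_calculus (ellipse_region \<rho>) h T = laurent_coeff q h 0 *\<^sub>C Y 0 + (\<Sum>n. laurent_coeff q h (Suc n) *\<^sub>C Y (Suc n))"
    unfolding holomorphic_calculus_T[OF \<rho> assms(5)] using suminf_split_head[OF sm] by simp
  then show ?thesis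
    unfolding summand T using summable_Suc_iff[THEN iffD2, OF sm] laurent_coeff_eq[OF assms(1) \<rho>1 assms(5), of 0]
    by (simp add: Y_0)
qed

end
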